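(* Let $\{\ell_\epsilon\}_{\epsilon>0}\subset H^1_0(0,T;\mathbb{R}^n)$ be given. If $\ell_\epsilon\rightharpoonup\ell$ weakly in $H^1(0,T;\mathbb{R}^n)$ as $\epsilon\searrow0$, then $$S_\epsilon(\ell_\epsilon)\rightharpoonup S(\ell)\quad\text{weakly in }H^1_0(0,T;\mathbb{R}^n),\ \text{as }\epsilon\searrow0.$$ Moreover, if $\ell_\epsilon\to\ell$ strongly in $H^1(0,T;\mathbb{R}^n)$ as $\epsilon\searrow0$, then $$S_\epsilon(\ell_\epsilon)\to S(\ell)\quad\text{strongly in }H^1_0(0,T;\mathbb{R}^n),\ \text{as }\epsilon\searrow0.$$
   Context: Fix $T>0$, $n\in\mathbb{N}$, $\alpha>0$. $H^1_0(0,T;\mathbb{R}^n):=\{y\in H^1(0,T;\mathbb{R}^n):y(0)=0\}$ (only the initial value vanishes). Scalar functions act on vectors componentwise. Standing assumptions. The history operator is $\mathcal{H}:L^1(0,T;\mathbb{R}^n)\to W^{1,1}(0,T;\mathbb{R}^n)$, $\mathcal{H}(y)(t):=\int_0^t y(s)\,ds+y_0$, with fixed $y_0\in\mathbb{R}^n$. The function $\kappa:\mathbb{R}\to[0,\infty)$ is Lipschitz continuous, differentiable, and $\kappa'\in W^{1,2}(\mathbb{R})$. State equations. Let $\mathcal{C}:=\{\eta\in\mathbb{R}^n:\eta_i\ge0\ \forall i\}$. For $\epsilon>0$ let $\mathcal{R}(\zeta,\eta):=\langle\kappa(\zeta),\eta\rangle_{\mathbb{R}^n}$ and $\mathcal{R}_\epsilon(\zeta,\eta):=\langle\kappa(\zeta),\eta\rangle_{\mathbb{R}^n}+\frac\epsilon2\|\eta\|^2_{\mathbb{R}^n}$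 if $\eta\in\mathcal{C}$, and both are $\infty$ otherwise. With $\partial_2$ the convex subdifferential in the second argument: (a) for $\ell\in H^1_0(0,T;\mathbb{R}^n)$, $S(\ell)\in H^1_0(0,T;\mathbb{R}^n)$ is the unique $q$ with $-\alpha q(t)+\ell(t)\in\partial_2\mathcal{R}(\mathcal{H}(q)(t),\dot q(t))$ for a.e. $t\in(0,T)$, $q(0)=0$; (b) for $\ell\in L^2(0,T;\mathbb{R}^n)$, $S_\epsilon(\ell)\in H^1_0(0,T;\mathbb{R}^n)$ is the unique $q$ with $-\alpha q(t)+\ell(t)\in\partial_2\mathcal{R}_\epsilon(\mathcal{H}(q)(t),\dot q(t))$ for a.e. $t\in(0,T)$, $q(0)=0$; equivalently (known), $\dot q(t)=\frac1\epsilon\max\{-\alpha q(t)+\ell(t)-\kappa(\mathcal{H}(q)(t)),0\}$, $q(0)=0$. (Unique solvability of both problems is known and may be assumed.) *)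

theory Defs
  imports "HOL-Analysis.Analysis"
begin

definition L2 :: "real set \<Rightarrow> (real \<Rightarrow> 'a::euclidean_space) set" where
  "L2 I = {f \<in> borel_measurable (lebesgue_on I). integrable (lebesgue_on I) (\<lambda>x. (norm (f x))\<^sup>2)}"

text \<open>Test functions of class $C^1_c(I)$, as is customary for Sobolev spaces on intervals.\<close>

definition test_functions :: "real set \<Rightarrow> (real \<Rightarrow> real) set" where
  "test_functions I =
     {\<phi>. \<phi> C1_differentiable_on UNIV \<and> (\<exists>K. compact K \<and> K \<subseteq> I \<and> (\<forall>x. x \<notin> K \<longrightarrow> \<phi> x = 0))}"

definition has_weak_deriv ::
  "real set \<Rightarrow> (real \<Rightarrow> 'a::euclidean_space) \<Rightarrow> (real \<Rightarrow> 'a) \<Rightarrow> bool" where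
  "has_weak_deriv I u g \<longleftrightarrow>
     (\<forall>\<phi>\<in>test_functions I.
        (LINT x|lebesgue_on I. deriv \<phi> x *\<^sub>R u x) = - (LINT x|lebesgue_on I. \<phi> x *\<^sub>R g x))"

definition W12 :: "real set \<Rightarrow> (real \<Rightarrow> 'a::euclidean_space) set" where
  "W12 I = {u \<in> L2 I. \<exists>g\<in>L2 I. has_weak_deriv I u g}"

text \<open>The choice of the weak derivative is immaterial up to null sets; it is only used under
  integrals and almost-everywhere quantifiers.\<close>

definition weak_deriv :: "real set \<Rightarrow> (real \<Rightarrow> 'a::euclidean_space) \<Rightarrow> real \<Rightarrow> 'a" where
  "weak_deriv I u = (SOME g. g \<in> L2 I \<and> has_weak_deriv I u g)"

text \<open>Each element of $H^1(0,T)$ is represented by its continuous representative on $[0,T]$,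
  extended by zero to the real line.  Thus distinct functions are distinct elements of the space,
  pointwise values are meaningful, and \<open>H1\<close> is closed under pointwise linear combinations.\<close>

definition H1 :: "real \<Rightarrow> (real \<Rightarrow> 'a::euclidean_space) set" where
  "H1 T = {y \<in> W12 {0<..<T}. continuous_on {0..T} y \<and> (\<forall>t. t \<notin> {0..T} \<longrightarrow> y t = 0)}"

text \<open>Only the initial value is prescribed.\<close>

definition H10 :: "real \<Rightarrow> (real \<Rightarrow> 'a::euclidean_space) set" where
  "H10 T = {y \<in> H1 T. y 0 = 0}"

definition H1_norm :: "real \<Rightarrow> (real \<Rightarrow> 'a::euclidean_space) \<Rightarrow> real" where
  "H1_norm T y =
     sqrt ((LINT t|lebesgue_on {0<..<T}. (norm (y t))\<^sup>2) +
           (LINT t|lebesgue_on {0<..<T}. (norm (weak_deriv {0<..<T} y t))\<^sup>2))"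

text \<open>The space \<open>X\<close> is a set of functions closed under pointwise linear combinations and \<open>N\<close>
  is its norm; functionals are only constrained on \<open>X\<close>.\<close>

definition dual_space ::
  "(real \<Rightarrow> 'a::real_vector) set \<Rightarrow> ((real \<Rightarrow> 'a) \<Rightarrow> real) \<Rightarrow> ((real \<Rightarrow> 'a) \<Rightarrow> real) set" where
  "dual_space X N =
     {\<Phi>. (\<forall>u\<in>X. \<forall>v\<in>X. \<Phi> (\<lambda>t. u t + v t) = \<Phi> u + \<Phi> v) \<and>
         (\<forall>c. \<forall>u\<in>X. \<Phi> (\<lambda>t. c *\<^sub>R u t) = c * \<Phi> u) \<and>
         (\<exists>C. \<forall>u\<in>X. \<bar>\<Phi> u\<bar> \<le> C * N u)}"

definition weak_conv ::
  "(real \<Rightarrow> 'a::real_vector) set \<Rightarrow> ((real \<Rightarrow> 'a) \<Rightarrow> real) \<Rightarrow>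
   ('b \<Rightarrow> real \<Rightarrow> 'a) \<Rightarrow> (real \<Rightarrow> 'a) \<Rightarrow> 'b filter \<Rightarrow> bool" where
  "weak_conv X N f l F \<longleftrightarrow>
     (\<forall>\<^sub>F e in F. f e \<in> X) \<and> l \<in> X \<and> (\<forall>\<Phi>\<in>dual_space X N. ((\<lambda>e. \<Phi> (f e)) \<longlongrightarrow> \<Phi> l) F)"

definition strong_conv ::
  "(real \<Rightarrow> 'a::real_vector) set \<Rightarrow> ((real \<Rightarrow> 'a) \<Rightarrow> real) \<Rightarrow>
   ('b \<Rightarrow> real \<Rightarrow> 'a) \<Rightarrow> (real \<Rightarrow> 'a) \<Rightarrow> 'b filter \<Rightarrow> bool" where
  "strong_conv X N f l F \<longleftrightarrow>
     (\<forall>\<^sub>F e in F. f e \<in> X) \<and> l \<in> X \<and> ((\<lambda>e. N (\<lambda>t. f e t - l t)) \<longlongrightarrow> 0) F"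

definition subdifferential :: "('a::real_inner \<Rightarrow> ereal) \<Rightarrow> 'a \<Rightarrow> 'a set" where
  "subdifferential f x = {\<xi>. \<forall>v. f x + ereal (\<xi> \<bullet> (v - x)) \<le> f v}"

definition nonneg_cone :: "(real ^ 'n) set" where
  "nonneg_cone = {\<eta>. \<forall>i. 0 \<le> \<eta> $ i}"

definition history :: "real ^ 'n \<Rightarrow> (real \<Rightarrow> real ^ 'n) \<Rightarrow> real \<Rightarrow> real ^ 'n" where
  "history y0 y t = (LINT s|lebesgue_on {0..t}. y s) + y0"

definition dissip :: "(real \<Rightarrow> real) \<Rightarrow> real ^ 'n \<Rightarrow> real ^ 'n \<Rightarrow> ereal" where
  "dissip \<kappa> \<zeta> \<eta> = (if \<eta> \<in> nonneg_cone then ereal ((\<chi> i. \<kappa> (\<zeta> $ i)) \<bullet> \<eta>) else \<infinity>)"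

definition dissip_eps :: "(real \<Rightarrow> real) \<Rightarrow> real \<Rightarrow> real ^ 'n \<Rightarrow> real ^ 'n \<Rightarrow> ereal" where
  "dissip_eps \<kappa> \<epsilon> \<zeta> \<eta> =
     (if \<eta> \<in> nonneg_cone then ereal ((\<chi> i. \<kappa> (\<zeta> $ i)) \<bullet> \<eta> + \<epsilon> / 2 * (norm \<eta>)\<^sup>2) else \<infinity>)"

definition solves ::
  "real \<Rightarrow> real \<Rightarrow> real ^ 'n \<Rightarrow> (real ^ 'n \<Rightarrow> real ^ 'n \<Rightarrow> ereal) \<Rightarrow>
   (real \<Rightarrow> real ^ 'n) \<Rightarrow> (real \<Rightarrow> real ^ 'n) \<Rightarrow> bool" where
  "solves T \<alpha> y0 \<R> \<l> q \<longleftrightarrow>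
     q \<in> H10 T \<and>
     (AE t in lebesgue_on {0<..<T}.
        - (\<alpha> *\<^sub>R q t) + \<l> t \<in> subdifferential (\<R> (history y0 q t)) (weak_deriv {0<..<T} q t))"

definition sol_op ::
  "real \<Rightarrow> real \<Rightarrow> real ^ 'n \<Rightarrow> (real \<Rightarrow> real) \<Rightarrow> (real \<Rightarrow> real ^ 'n) \<Rightarrow> real \<Rightarrow> real ^ 'n" where
  "sol_op T \<alpha> y0 \<kappa> \<l> = (THE q. solves T \<alpha> y0 (dissip \<kappa>) \<l> q)"

definition sol_op_eps ::
  "real \<Rightarrow> real \<Rightarrow> real ^ 'n \<Rightarrow> (real \<Rightarrow> real) \<Rightarrow> real \<Rightarrow>
   (real \<Rightarrow> real ^ 'n) \<Rightarrow> real \<Rightarrow> real ^ 'n" where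
  "sol_op_eps T \<alpha> y0 \<kappa> \<epsilon> \<l> = (THE q. solves T \<alpha> y0 (dissip_eps \<kappa> \<epsilon>) \<l> q)"

end

theory Submission
  imports Defs
begin

text \<open>
Both inclusions decouple into scalar problems. With the residual \<open>G = \<l> - \<alpha> q - \<kappa>(\<H>(q))\<close>, the
regularized one reads \<open>\<epsilon> q' = max G 0\<close>, the limit one \<open>q' \<ge> 0\<close>, \<open>G \<le> 0\<close>, \<open>q' G = 0\<close>.
Multiplying the derivative of \<open>G\<close> by \<open>max G 0\<close> gives \<open>\<alpha> \<integral>(q')\<^sup>2 \<le> \<integral>q' (\<l>' - \<kappa>(\<H>(q))')\<close>,
hence an \<open>H1\<close> bound uniform in \<open>\<epsilon>\<close>, and \<open>G \<le> O(\<surd>\<epsilon>)\<close>. A comparison argument in the maximum norm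
and Gronwall's lemma then give uniform convergence of the solutions when the loads converge
uniformly, which, with the \<open>H1\<close> bound, is weak convergence in \<open>H1\<close>. In the limit problem the energy
inequality is an equality, because the derivative of \<open>G\<close> vanishes almost everywhere where \<open>G\<close> does;
for strongly converging loads this yields convergence of the norms, hence strong convergence.
\<close>

section \<open>Square-integrable functions on an interval\<close>

text \<open>The energy estimate leaves nothing at the initial time: load and solution start at 0 and
  \<open>\<kappa>\<close> is nonnegative, so the residual starts nonpositive. The same identity,
  read at every time, carries the factor \<epsilon> on its right side, which is why the positive
  part of G has size \<surd>\<epsilon>. The comparison needs no bound on the difference of the
  rates: a nondecreasing solution shifted by a constant is a barrier for the other one. Weak
  convergence is tested by all bounded functionals, and completeness of \<open>H1\<close> is not
  established. Boundedness of weakly convergent loads therefore comes from a gliding hump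
  functional, and functionals are represented up to a small error by near minimizers. The loads then
  converge uniformly, because evaluation is a bounded functional and bounded sets of
  \<open>H1\<close> share a modulus of continuity of order 1/2. The history integrates q, so the
  rate of the term \<kappa>(\<H>(q)) contains q but not q'; uniform convergence of the solutions
  controls it once \<kappa>' is continuous. Membership of \<kappa>' in a Sobolev space only speaks
  up to null sets, so continuity at every point is proved separately.\<close>

lemma step_monotone:
  fixes F m :: "real \<Rightarrow> real"
  assumes "a \<le> b" "N > 0" and h: "h = (b - a) / real N"
    and step: "\<And>s. a \<le> s \<Longrightarrow> s + h \<le> b \<Longrightarrow> F (s + h) - F s \<le> m (s + h) - m s"
  shows "F b - F a \<le> m b - m a"
proof -
  have h0: "h \<ge> 0" using assms by simp
  have "F (a + real i * h) - F a \<le> m (a + real i * h) - m a" if "i \<le> N" for i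
    using that
  proof (induction i)
    case (Suc i)
    have eq: "a + real i * h + h = a + real (Suc i) * h" by (simp add: algebra_simps)
    have "real (Suc i) * h \<le> real N * h"
      using Suc.prems h0 by (intro mult_right_mono) auto
    moreover have "a + real N * h = b" using assms by simp
    ultimately have "a + real i * h + h \<le> b" unfolding eq by linarith
    moreover have "a \<le> a + real i * h" using h0 by simp
    ultimately have "F (a + real i * h + h) - F (a + real i * h) \<le> m (a + real i * h + h) - m (a + real i * h)"
      by (intro step)
    moreover have "F (a + real i * h) - F a \<le> m (a + real i * h) - m a" using Suc by simp
    ultimately show ?case unfolding eq by linarith
  qed simp
  from this[of N] show ?thesis using assms by simp
qed

text \<open>Serves both Cauchy-Schwarz inequalities, in \<open>L2\<close> and in \<open>H1\<close>.
  Evaluation at the minimizer t = -b/c needs c > 0, so c = 0 and c < 0 are settled beforehand by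
  exhibiting a negative value.\<close>

lemma quadratic_nonneg_imp_discriminant:
  fixes a b c :: real
  assumes "\<And>t. 0 \<le> a + 2 * t * b + t\<^sup>2 * c"
  shows "b\<^sup>2 \<le> a * c"
proof (cases "c = 0")
  case True
  have "b = 0"
  proof (rule ccontr)
    assume "b \<noteq> 0"
    then have "a + 2 * (- (a + 1) / (2 * b)) * b = -1" by (simp add: field_simps)
    then show False using assms[of "- (a + 1) / (2 * b)"] True by simp
  qed
  then show ?thesis using True by simp
next
  case False
  have "c \<ge> 0"
  proof (rule ccontr)
    assume c: "\<not> c \<ge> 0"
    \<comment> \<open>For this t the term of second order is -(a + 1), so the values at t and -t add
      up to -2.\<close>
    define t where "t = sqrt ((a + 1) / - c)"
    have "0 \<le> a" using assms[of 0] by simp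
    then have "t\<^sup>2 * c = - (a + 1)" using c by (simp add: t_def divide_nonneg_neg)
    then show False using assms[of t] assms[of "- t"] by simp
  qed
  then have c: "c > 0" using False by simp
  have "a + 2 * (- b / c) * b + (- b / c)\<^sup>2 * c = a - b\<^sup>2 / c"
    using c by (simp add: field_simps power2_eq_square)
  then have "b\<^sup>2 / c \<le> a" using assms[of "- b / c"] by simp
  then show ?thesis using c by (simp add: field_simps)
qed

lemma L2_inner_integrable:
  fixes f g :: "real \<Rightarrow> 'a::euclidean_space"
  assumes f: "f \<in> L2 I" and g: "g \<in> L2 I"
  shows "integrable (lebesgue_on I) (\<lambda>x. f x \<bullet> g x)"
proof (rule Bochner_Integration.integrable_bound)
  show "integrable (lebesgue_on I) (\<lambda>x. (norm (f x))\<^sup>2 + (norm (g x))\<^sup>2)"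
    using f g by (auto simp: L2_def)
  show "(\<lambda>x. f x \<bullet> g x) \<in> borel_measurable (lebesgue_on I)"
    using f g by (auto simp: L2_def)
  have "\<bar>a \<bullet> b\<bar> \<le> (norm a)\<^sup>2 + (norm b)\<^sup>2" for a b :: 'a
  proof -
    have "2 * (norm a * norm b) \<le> (norm a)\<^sup>2 + (norm b)\<^sup>2"
      using sum_squares_bound[of "norm a" "norm b"] by simp
    moreover have "0 \<le> norm a * norm b" by simp
    ultimately show ?thesis using Cauchy_Schwarz_ineq2[of a b] by linarith
  qed
  then show "AE x in lebesgue_on I. norm (f x \<bullet> g x) \<le> norm ((norm (f x))\<^sup>2 + (norm (g x))\<^sup>2)"
    by (auto intro!: AE_I2)
qed

lemma L2_mult_integrable:
  fixes f g :: "real \<Rightarrow> real"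
  assumes "f \<in> L2 I" "g \<in> L2 I"
  shows "integrable (lebesgue_on I) (\<lambda>x. f x * g x)"
  using L2_inner_integrable[OF assms] by simp

lemma L2_add:
  fixes f g :: "real \<Rightarrow> 'a::euclidean_space"
  assumes f: "f \<in> L2 I" and g: "g \<in> L2 I"
  shows "(\<lambda>x. f x + g x) \<in> L2 I"
proof -
  have eq: "(norm (a + b))\<^sup>2 = (norm a)\<^sup>2 + 2 * (a \<bullet> b) + (norm b)\<^sup>2" for a b :: 'a
    unfolding power2_norm_eq_inner by (simp add: inner_add_left inner_add_right inner_commute)
  have "integrable (lebesgue_on I) (\<lambda>x. (norm (f x + g x))\<^sup>2)"
    unfolding eq using f g
    by (intro Bochner_Integration.integrable_add integrable_mult_right L2_inner_integrable) (simp_all add: L2_def)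
  then show ?thesis using f g by (simp add: L2_def borel_measurable_add)
qed

lemma L2_scaleR:
  fixes f :: "real \<Rightarrow> 'a::euclidean_space"
  assumes "f \<in> L2 I"
  shows "(\<lambda>x. c *\<^sub>R f x) \<in> L2 I"
  using assms by (auto simp: L2_def power_mult_distrib)

lemma L2_diff:
  fixes f g :: "real \<Rightarrow> 'a::euclidean_space"
  assumes "f \<in> L2 I" "g \<in> L2 I"
  shows "(\<lambda>x. f x - g x) \<in> L2 I"
  using L2_add[OF assms(1) L2_scaleR[OF assms(2), of "-1"]] by simp

lemma L2_cmult:
  fixes f :: "real \<Rightarrow> real"
  shows "f \<in> L2 I \<Longrightarrow> (\<lambda>x. c * f x) \<in> L2 I"
  using L2_scaleR[of f I c] by simp

lemma L2_abs:
  fixes f :: "real \<Rightarrow> real"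
  shows "f \<in> L2 I \<Longrightarrow> (\<lambda>x. \<bar>f x\<bar>) \<in> L2 I"
  by (auto simp: L2_def)

lemma L2_bounded_measurable:
  fixes f :: "real \<Rightarrow> 'a::euclidean_space"
  assumes "f \<in> borel_measurable (lebesgue_on {0<..<T})"
    and "\<And>x. x \<in> {0<..<T} \<Longrightarrow> norm (f x) \<le> B"
  shows "f \<in> L2 {0<..<T}"
proof -
  have "integrable (lebesgue_on {0<..<T}) (\<lambda>x. (norm (f x))\<^sup>2)"
  proof (rule finite_measure.integrable_const_bound)
    show "finite_measure (lebesgue_on {0<..<T})"
      by (rule finite_measure_lebesgue_on) simp
    show "AE x in lebesgue_on {0<..<T}. norm ((norm (f x))\<^sup>2) \<le> B\<^sup>2"
      using assms(2) by (auto intro!: AE_I2 power_mono)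
  qed (use assms(1) in measurable)
  then show ?thesis using assms by (simp add: L2_def)
qed

lemma continuous_on_interval_bound:
  fixes f :: "real \<Rightarrow> 'a::real_normed_vector"
  assumes "continuous_on {a..b} f"
  obtains B where "0 \<le> B" "\<And>x. x \<in> {a..b} \<Longrightarrow> norm (f x) \<le> B"
proof -
  have "bounded (f ` {a..b})"
    using assms by (intro compact_imp_bounded compact_continuous_image) auto
  then obtain B where "B > 0" "\<forall>y\<in>f ` {a..b}. norm y \<le> B" unfolding bounded_pos by auto
  then show ?thesis using that[of B] by simp
qed

lemma L2_continuous:
  fixes f :: "real \<Rightarrow> 'a::euclidean_space"
  assumes "continuous_on {0..T} f"
  shows "f \<in> L2 {0<..<T}"
proof -
  obtain B where B: "\<And>x. x \<in> {0..T} \<Longrightarrow> norm (f x) \<le> B"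
    using continuous_on_interval_bound[OF assms] by blast
  have "f \<in> borel_measurable (lebesgue_on {0<..<T})"
    by (rule continuous_imp_measurable_on_sets_lebesgue[OF continuous_on_subset[OF assms]]) auto
  then show ?thesis by (rule L2_bounded_measurable[where B=B]) (use B in simp)
qed

lemma L2_const: "(\<lambda>x. c) \<in> L2 {0<..<T}"
  by (rule L2_continuous) (rule continuous_on_const)

text \<open>Bridge between the two integrals in play. The spaces are defined by the Lebesgue
  integral over the open interval, while the calculus below uses the gauge integral over closed
  subintervals; the endpoints have measure zero.\<close>

lemma integrable_interval:
  fixes f :: "real \<Rightarrow> 'a::euclidean_space"
  assumes "integrable (lebesgue_on {0<..<T}) f"
  shows "f absolutely_integrable_on {0..T}"
    and "(LINT x|lebesgue_on {0<..<T}. f x) = integral {0..T} f"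
proof -
  have "f absolutely_integrable_on {0<..<T}"
    using assms by (simp add: absolutely_integrable_on_def set_integrable_def integrable_restrict_space)
  then show "f absolutely_integrable_on {0..T}"
    using absolutely_integrable_on_open_interval[where f=f and a=0 and b=T] by simp
  show "(LINT x|lebesgue_on {0<..<T}. f x) = integral {0..T} f"
    using assms by (simp add: lebesgue_integral_eq_integral integral_open_interval_real)
qed

lemma L2_mult_abs_integrable:
  fixes f g :: "real \<Rightarrow> real"
  assumes "f \<in> L2 {0<..<T}" "g \<in> L2 {0<..<T}"
  shows "(\<lambda>x. f x * g x) absolutely_integrable_on {0..T}"
  by (rule integrable_interval(1)[OF L2_mult_integrable[OF assms]])

lemma L2_abs_integrable:
  fixes f :: "real \<Rightarrow> 'a::euclidean_space"
  assumes "f \<in> L2 {0<..<T}"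
  shows "f absolutely_integrable_on {0..T}"
proof -
  have "integrable (lebesgue_on {0<..<T}) f"
  proof (rule Bochner_Integration.integrable_bound)
    have "integrable (lebesgue_on {0<..<T}) (\<lambda>x. (norm (f x))\<^sup>2)"
      using assms by (simp add: L2_def)
    moreover have "integrable (lebesgue_on {0<..<T}) (\<lambda>x. 1 :: real)"
      using L2_const[of "1 :: real" T] by (simp add: L2_def)
    ultimately show "integrable (lebesgue_on {0<..<T}) (\<lambda>x. (norm (f x))\<^sup>2 + 1)"
      by (rule Bochner_Integration.integrable_add)
    have "norm a \<le> (norm a)\<^sup>2 + 1" for a :: 'a
    proof -
      have "2 * norm a \<le> (norm a)\<^sup>2 + 1"
        using zero_le_power2[of "norm a - 1"] by (simp add: power2_diff)
      then show ?thesis using norm_ge_zero[of a] by linarith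
    qed
    then show "AE x in lebesgue_on {0<..<T}. norm (f x) \<le> norm ((norm (f x))\<^sup>2 + 1)"
      by (intro AE_I2) (metis abs_ge_self order_trans real_norm_def)
  qed (use assms in \<open>simp add: L2_def\<close>)
  then show ?thesis by (rule integrable_interval)
qed

lemma L2_integrable_sub:
  fixes f :: "real \<Rightarrow> 'a::euclidean_space"
  assumes "f \<in> L2 {0<..<T}" "0 \<le> s" "t \<le> T"
  shows "f integrable_on {s..t}"
proof -
  have "f integrable_on {0..T}" using L2_abs_integrable[OF assms(1)] absolutely_integrable_on_def by blast
  then show ?thesis by (rule integrable_on_subinterval) (use assms in auto)
qed

lemma L2_mult_integrable_sub:
  fixes f g :: "real \<Rightarrow> real"
  assumes "f \<in> L2 {0<..<T}" "g \<in> L2 {0<..<T}" "0 \<le> s" "t \<le> T"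
  shows "(\<lambda>x. f x * g x) integrable_on {s..t}"
proof -
  have "(\<lambda>x. f x * g x) integrable_on {0..T}"
    using L2_mult_abs_integrable[OF assms(1,2)] absolutely_integrable_on_def by blast
  then show ?thesis by (rule integrable_on_subinterval) (use assms in auto)
qed

lemma integral_diff_eq:
  fixes f :: "real \<Rightarrow> 'a::euclidean_space"
  assumes "f integrable_on {a..b}" "a \<le> s" "s \<le> t" "t \<le> b"
  shows "integral {a..t} f - integral {a..s} f = integral {s..t} f"
proof -
  have "f integrable_on {a..t}" by (rule integrable_on_subinterval[OF assms(1)]) (use assms in auto)
  from Henstock_Kurzweil_Integration.integral_combine[OF assms(2,3) this] show ?thesis by (simp add: algebra_simps)
qed

section \<open>The scalar L2 norm, Cauchy-Schwarz and density of continuous functions\<close>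

definition L2_norm :: "real \<Rightarrow> (real \<Rightarrow> real) \<Rightarrow> real" where
  "L2_norm T f = sqrt (integral {0..T} (\<lambda>x. (f x)\<^sup>2))"

lemma L2_square_integrable_on:
  fixes f :: "real \<Rightarrow> real"
  assumes "f \<in> L2 {0<..<T}" "0 \<le> s" "t \<le> T"
  shows "(\<lambda>x. (f x)\<^sup>2) integrable_on {s..t}"
  using L2_mult_integrable_sub[OF assms(1) assms(1) assms(2,3)] by (simp add: power2_eq_square)

text \<open>Holds for every f, since a square that is not integrable has integral 0 by convention;
  this spares side conditions in later estimates.\<close>

lemma L2_norm_nonneg [simp]: "0 \<le> L2_norm T f"
  unfolding L2_norm_def
  by (cases "(\<lambda>x. (f x)\<^sup>2) integrable_on {0..T}")
    (simp_all add: Henstock_Kurzweil_Integration.integral_nonneg not_integrable_integral)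

lemma L2_norm_square:
  assumes "f \<in> L2 {0<..<T}"
  shows "(L2_norm T f)\<^sup>2 = integral {0..T} (\<lambda>x. (f x)\<^sup>2)"
  using L2_square_integrable_on[OF assms, of 0 T]
  by (simp add: L2_norm_def Henstock_Kurzweil_Integration.integral_nonneg)

lemma L2_square_lincomb:
  fixes f g :: "real \<Rightarrow> real"
  assumes f: "f \<in> L2 {0<..<T}" and g: "g \<in> L2 {0<..<T}" and st: "0 \<le> s" "t \<le> T"
  shows "integral {s..t} (\<lambda>x. (f x + c * g x)\<^sup>2) = integral {s..t} (\<lambda>x. (f x)\<^sup>2)
      + 2 * c * integral {s..t} (\<lambda>x. f x * g x) + c\<^sup>2 * integral {s..t} (\<lambda>x. (g x)\<^sup>2)"
proof -
  have "((\<lambda>x. (f x)\<^sup>2 + 2 * c * (f x * g x) + c\<^sup>2 * (g x)\<^sup>2) has_integral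
      integral {s..t} (\<lambda>x. (f x)\<^sup>2) + 2 * c * integral {s..t} (\<lambda>x. f x * g x)
          + c\<^sup>2 * integral {s..t} (\<lambda>x. (g x)\<^sup>2)) {s..t}"
    by (intro has_integral_add has_integral_mult_right integrable_integral
          L2_square_integrable_on[OF f st] L2_square_integrable_on[OF g st] L2_mult_integrable_sub[OF f g st])
  moreover have "(\<lambda>x. (f x)\<^sup>2 + 2 * c * (f x * g x) + c\<^sup>2 * (g x)\<^sup>2) = (\<lambda>x. (f x + c * g x)\<^sup>2)"
    by (simp add: power2_eq_square algebra_simps)
  ultimately show ?thesis by (simp add: integral_unique)
qed

lemma L2_Cauchy_Schwarz_sub:
  fixes f g :: "real \<Rightarrow> real"
  assumes f: "f \<in> L2 {0<..<T}" and g: "g \<in> L2 {0<..<T}" and st: "0 \<le> s" "t \<le> T"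
  shows "(integral {s..t} (\<lambda>x. f x * g x))\<^sup>2
      \<le> integral {s..t} (\<lambda>x. (f x)\<^sup>2) * integral {s..t} (\<lambda>x. (g x)\<^sup>2)"
proof (rule quadratic_nonneg_imp_discriminant)
  show "0 \<le> integral {s..t} (\<lambda>x. (f x)\<^sup>2) + 2 * c * integral {s..t} (\<lambda>x. f x * g x)
      + c\<^sup>2 * integral {s..t} (\<lambda>x. (g x)\<^sup>2)" for c
    unfolding L2_square_lincomb[OF f g st, symmetric]
    by (intro Henstock_Kurzweil_Integration.integral_nonneg
        L2_square_integrable_on[OF L2_add[OF f L2_cmult[OF g]] st]) simp
qed

lemma L2_Cauchy_Schwarz:
  assumes f: "f \<in> L2 {0<..<T}" and g: "g \<in> L2 {0<..<T}"
  shows "\<bar>integral {0..T} (\<lambda>x. f x * g x)\<bar> \<le> L2_norm T f * L2_norm T g"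
proof -
  have "(integral {0..T} (\<lambda>x. f x * g x))\<^sup>2 \<le> (L2_norm T f * L2_norm T g)\<^sup>2"
    using L2_Cauchy_Schwarz_sub[OF f g, of 0 T]
    by (simp add: L2_norm_square[OF f] L2_norm_square[OF g] power_mult_distrib)
  then show ?thesis using abs_le_square_iff[of _ "L2_norm T f * L2_norm T g"] by simp
qed

lemma L2_norm_diff_square:
  assumes f: "f \<in> L2 {0<..<T}" and g: "g \<in> L2 {0<..<T}"
  shows "(L2_norm T (\<lambda>x. f x - g x))\<^sup>2 = (L2_norm T f)\<^sup>2 - 2 * integral {0..T} (\<lambda>x. f x * g x) + (L2_norm T g)\<^sup>2"
  using L2_square_lincomb[OF f g, of 0 T "-1"] by (simp add: L2_norm_square f g L2_diff)

lemma L2_norm_diff_triangle: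
  assumes f: "f \<in> L2 {0<..<T}" and g: "g \<in> L2 {0<..<T}"
  shows "L2_norm T (\<lambda>x. f x - g x) \<le> L2_norm T f + L2_norm T g"
proof (rule power2_le_imp_le)
  show "(L2_norm T (\<lambda>x. f x - g x))\<^sup>2 \<le> (L2_norm T f + L2_norm T g)\<^sup>2"
    using L2_norm_diff_square[OF f g] L2_Cauchy_Schwarz[OF f g] by (simp add: power2_sum)
qed simp

lemma L2_pairing_lincomb:
  fixes f g h :: "real \<Rightarrow> real"
  assumes "f \<in> L2 {0<..<T}" "g \<in> L2 {0<..<T}" "h \<in> L2 {0<..<T}"
  shows "integral {0..T} (\<lambda>t. (a * f t + b * g t) * h t)
      = a * integral {0..T} (\<lambda>t. f t * h t) + b * integral {0..T} (\<lambda>t. g t * h t)"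
proof -
  have "((\<lambda>t. a * (f t * h t) + b * (g t * h t)) has_integral
      a * integral {0..T} (\<lambda>t. f t * h t) + b * integral {0..T} (\<lambda>t. g t * h t)) {0..T}"
    by (intro has_integral_add has_integral_mult_right integrable_integral
        L2_mult_integrable_sub[where T=T] assms) auto
  then show ?thesis by (simp add: integral_unique distrib_right mult.assoc)
qed

lemma L2_pairing_diff:
  fixes f g h :: "real \<Rightarrow> real"
  assumes "f \<in> L2 {0<..<T}" "g \<in> L2 {0<..<T}" "h \<in> L2 {0<..<T}"
  shows "integral {0..T} (\<lambda>t. (f t - g t) * h t) = integral {0..T} (\<lambda>t. f t * h t) - integral {0..T} (\<lambda>t. g t * h t)"
    and "integral {0..T} (\<lambda>t. h t * (f t - g t)) = integral {0..T} (\<lambda>t. h t * f t) - integral {0..T} (\<lambda>t. h t * g t)"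
  using L2_pairing_lincomb[OF assms, of 1 "-1"] by (simp_all add: mult.commute)

lemma L2_norm_mono:
  assumes f: "f \<in> L2 {0<..<T}" and g: "g \<in> L2 {0<..<T}"
    and le: "\<And>t. t \<in> {0..T} \<Longrightarrow> \<bar>f t\<bar> \<le> g t"
  shows "L2_norm T f \<le> L2_norm T g"
proof -
  have "(f t)\<^sup>2 \<le> (g t)\<^sup>2" if "t \<in> {0..T}" for t
    unfolding abs_le_square_iff[symmetric] using le[OF that] by linarith
  then show ?thesis
    unfolding L2_norm_def
    by (intro real_sqrt_le_mono integral_le L2_square_integrable_on[where T=T] f g) auto
qed

lemma L2_norm_const: "0 \<le> T \<Longrightarrow> 0 \<le> c \<Longrightarrow> L2_norm T (\<lambda>_. c) = c * sqrt T"
  by (simp add: L2_norm_def real_sqrt_mult)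

lemma integral_abs_le_L2:
  assumes f: "f \<in> L2 {0<..<T}" and "0 \<le> T"
  shows "integral {0..T} (\<lambda>x. \<bar>f x\<bar>) \<le> sqrt T * L2_norm T f"
proof -
  have "integral {0..T} (\<lambda>x. 1 * \<bar>f x\<bar>) \<le> L2_norm T (\<lambda>_. 1) * L2_norm T (\<lambda>x. \<bar>f x\<bar>)"
    using L2_Cauchy_Schwarz[OF L2_const L2_abs[OF f], of 1] by linarith
  then show ?thesis using assms by (simp add: L2_norm_const) (simp add: L2_norm_def)
qed

lemma L2_norm_dominated_tendsto_0:
  fixes f :: "nat \<Rightarrow> real \<Rightarrow> real"
  assumes f: "\<And>n. f n \<in> L2 {0<..<T}" and h: "h \<in> L2 {0<..<T}" and N: "negligible N"
    and le: "\<And>n x. \<bar>f n x\<bar> \<le> \<bar>h x\<bar>" and lim: "\<And>x. x \<in> {0..T} - N \<Longrightarrow> (\<lambda>n. f n x) \<longlonglongrightarrow> 0"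
  shows "(\<lambda>n. L2_norm T (f n)) \<longlonglongrightarrow> 0"
proof -
  \<comment> \<open>The dominated convergence theorem applied here asks for convergence at every
    point, so the squares are reset to 0 on the null set, which leaves their integrals
    unchanged.\<close>
  let ?d = "\<lambda>n x. if x \<in> N then 0 else (f n x)\<^sup>2"
  have "(\<lambda>n. integral {0..T} (?d n)) \<longlonglongrightarrow> integral {0..T} (\<lambda>x. 0)"
  proof (rule dominated_convergence(2))
    show "?d n integrable_on {0..T}" for n
      by (rule integrable_spike[OF L2_square_integrable_on[OF f] N]) auto
    show "(\<lambda>x. (h x)\<^sup>2) integrable_on {0..T}" by (rule L2_square_integrable_on[OF h]) auto
    show "norm (?d n x) \<le> (h x)\<^sup>2" for n x using le[of n x] by (simp add: abs_le_square_iff)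
    show "(\<lambda>n. ?d n x) \<longlonglongrightarrow> 0" if "x \<in> {0..T}" for x
      using tendsto_power[OF lim, of x 2] that by (cases "x \<in> N") simp_all
  qed
  moreover have "integral {0..T} (?d n) = integral {0..T} (\<lambda>x. (f n x)\<^sup>2)" for n
    by (rule integral_spike[OF N]) simp
  ultimately show ?thesis unfolding L2_norm_def using tendsto_real_sqrt[of _ 0] by fastforce
qed

text \<open>Measurability provides continuous \<open>g n\<close> converging to v almost everywhere,
  but without a common bound. Truncation at a level K, chosen first so that v changes by less than
  \<eta>/2, makes dominated convergence applicable to the truncated \<open>g n\<close>.\<close>

lemma L2_approx_continuous:
  fixes v :: "real \<Rightarrow> real"
  assumes v: "v \<in> L2 {0<..<T}" and "\<eta> > 0"
  obtains w where "continuous_on UNIV w" "L2_norm T (\<lambda>x. v x - w x) \<le> \<eta>"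
proof -
  let ?I = "{0<..<T}"
  have "v measurable_on ?I"
    using v measurable_on_iff_borel_measurable[of ?I v] by (auto simp: L2_def)
  then obtain S g where S: "negligible S" and g: "\<And>n. continuous_on UNIV (g n)"
    and lim: "\<And>x. x \<notin> S \<Longrightarrow> (\<lambda>n. g n x) \<longlonglongrightarrow> (if x \<in> ?I then v x else 0)"
    unfolding measurable_on_def by metis
  define clip where "clip n x = max (- real n) (min (real n) x)" for n x
  have clip_cont: "continuous_on UNIV (clip n)" for n
    unfolding clip_def by (intro continuous_intros)
  have clip_le: "\<bar>clip n x\<bar> \<le> real n" and clip_diff: "\<bar>x - clip n x\<bar> \<le> \<bar>x\<bar>" for n x 
    by (auto simp: clip_def)
  have clipv: "(\<lambda>x. clip n (v x)) \<in> L2 ?I" for n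
  proof (rule L2_bounded_measurable[where B="real n"])
    show "(\<lambda>x. clip n (v x)) \<in> borel_measurable (lebesgue_on {0<..<T})"
      using v unfolding clip_def L2_def by (intro borel_measurable_max borel_measurable_min borel_measurable_const) auto
  qed (simp add: clip_le)
  have half: "0 < \<eta> / 2" using \<open>\<eta> > 0\<close> by simp
  have "(\<lambda>n. L2_norm T (\<lambda>x. v x - clip n (v x))) \<longlonglongrightarrow> 0"
  proof (rule L2_norm_dominated_tendsto_0[OF L2_diff[OF v clipv] v negligible_empty clip_diff])
    fix x
    obtain n0 where "\<bar>v x\<bar> \<le> real n0" using real_arch_simple by blast
    then have "v x - clip n (v x) = 0" if "n \<ge> n0" for n
      using that by (auto simp: clip_def)
    then have "\<forall>\<^sub>F n in sequentially. v x - clip n (v x) = 0" unfolding eventually_sequentially by blast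
    then show "(\<lambda>n. v x - clip n (v x)) \<longlonglongrightarrow> 0" by (rule tendsto_eventually)
  qed
  from eventually_happens[OF order_tendstoD(2)[OF this half]]
  obtain K where K: "L2_norm T (\<lambda>x. v x - clip K (v x)) < \<eta> / 2" by auto
  have clipg: "(\<lambda>x. clip K (g n x)) \<in> L2 ?I" for n
    by (intro L2_continuous continuous_on_subset[OF continuous_on_compose2[OF clip_cont g]]) auto
  let ?f = "\<lambda>n x. clip K (v x) - clip K (g n x)"
  have "(\<lambda>n. L2_norm T (?f n)) \<longlonglongrightarrow> 0"
  proof (rule L2_norm_dominated_tendsto_0[OF L2_diff[OF clipv clipg] L2_const[of "2 * real K"]])
    show "negligible (S \<union> {0, T})" using S by (simp add: negligible_Un_eq)
    show "\<bar>?f n x\<bar> \<le> \<bar>2 * real K\<bar>" for n x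
      using clip_le[of K "v x"] clip_le[of K "g n x"] by linarith
    fix x assume "x \<in> {0..T} - (S \<union> {0, T})"
    then have "(\<lambda>n. g n x) \<longlonglongrightarrow> v x" using lim[of x] by simp
    moreover have "isCont (clip K) (v x)" using clip_cont by (simp add: continuous_on_eq_continuous_at)
    ultimately have "(\<lambda>n. clip K (g n x)) \<longlonglongrightarrow> clip K (v x)" by (rule isCont_tendsto_compose[rotated])
    from tendsto_diff[OF tendsto_const this, of "clip K (v x)"] show "(\<lambda>n. ?f n x) \<longlonglongrightarrow> 0" by simp
  qed
  from eventually_happens[OF order_tendstoD(2)[OF this half]]
  obtain n where n: "L2_norm T (?f n) < \<eta> / 2" by auto
  have "L2_norm T (\<lambda>x. (v x - clip K (v x)) - (clip K (g n x) - clip K (v x)))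
      \<le> L2_norm T (\<lambda>x. v x - clip K (v x)) + L2_norm T (\<lambda>x. clip K (g n x) - clip K (v x))"
    by (intro L2_norm_diff_triangle L2_diff v clipv clipg)
  also have "L2_norm T (\<lambda>x. clip K (g n x) - clip K (v x)) = L2_norm T (\<lambda>x. clip K (v x) - clip K (g n x))"
    by (simp add: L2_norm_def power2_commute)
  finally have "L2_norm T (\<lambda>x. v x - clip K (g n x)) \<le> \<eta>" using n K by simp
  moreover have "continuous_on UNIV (\<lambda>x. clip K (g n x))"
    by (rule continuous_on_compose2[OF clip_cont g]) auto
  ultimately show ?thesis by (rule that[rotated])
qed

text \<open>Lets almost-everywhere statements on the open interval enter gauge integrals over closed
  intervals; the two endpoints join the exceptional set.\<close>

lemma AE_interval_negligible:
  assumes "AE x in lebesgue_on {0<..<T}. P x"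
  shows "negligible {x \<in> {0..T::real}. \<not> P x}"
proof -
  have "AE x in lebesgue. x \<in> {0<..<T} \<longrightarrow> P x"
    using assms by (simp add: AE_restrict_space_iff)
  then obtain N where N: "N \<in> null_sets lebesgue" "{x. \<not> (x \<in> {0<..<T} \<longrightarrow> P x)} \<subseteq> N"
    by (auto simp: eventually_ae_filter)
  then have "negligible (N \<union> {0, T})"
    by (simp add: negligible_iff_null_sets[symmetric] negligible_Un_eq)
  moreover have "x \<in> N \<union> {0, T}" if "x \<in> {x \<in> {0..T}. \<not> P x}" for x
  proof (cases "x = 0 \<or> x = T")
    case False
    then have "x \<in> {0<..<T}" using that by simp
    then show ?thesis using N(2) that by blast
  qed auto
  ultimately show ?thesis by (meson negligible_subset subsetI)
qed

lemma integral_AE_cong: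
  fixes f g :: "real \<Rightarrow> 'a::euclidean_space"
  assumes "AE x in lebesgue_on {0<..<T}. f x = g x" "0 \<le> s" "t \<le> T"
  shows "integral {s..t} f = integral {s..t} g"
  by (rule integral_spike[OF AE_interval_negligible[OF assms(1)]]) (use assms in auto)

lemma integral_AE_mono:
  fixes f g :: "real \<Rightarrow> real"
  assumes "AE x in lebesgue_on {0<..<T}. f x \<le> g x" "0 \<le> s" "t \<le> T"
    and "f integrable_on {s..t}" "g integrable_on {s..t}"
  shows "integral {s..t} f \<le> integral {s..t} g"
proof -
  let ?N = "{x \<in> {0..T::real}. \<not> f x \<le> g x}"
  let ?g = "\<lambda>x. if x \<in> ?N then f x else g x"
  have N: "negligible ?N" using assms(1) by (rule AE_interval_negligible)
  have "integral {s..t} f \<le> integral {s..t} ?g"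
  proof (rule integral_le)
    show "?g integrable_on {s..t}" by (rule integrable_spike[OF assms(5) N]) auto
  qed (use assms in auto)
  also have "\<dots> = integral {s..t} g" by (rule integral_spike[OF N]) auto
  finally show ?thesis .
qed

section \<open>Primitives of square-integrable functions\<close>

text \<open>Scalar \<open>H1\<close> functions in integrated form. The calculus below is carried out
  on pairs of a function and its rate, so that no pointwise derivative of u is needed; continuity of
  u on the closed interval is a consequence.\<close>

definition L2_primitive :: "real \<Rightarrow> (real \<Rightarrow> real) \<Rightarrow> (real \<Rightarrow> real) \<Rightarrow> bool" where
  "L2_primitive T u g \<longleftrightarrow> g \<in> L2 {0<..<T} \<and> (\<forall>t\<in>{0..T}. u t - u 0 = integral {0..t} g)"

lemma L2_primitive_L2: "L2_primitive T u g \<Longrightarrow> g \<in> L2 {0<..<T}"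
  by (simp add: L2_primitive_def)

lemma L2_primitive_increment:
  assumes "L2_primitive T u g" "0 \<le> s" "s \<le> t" "t \<le> T"
  shows "u t - u s = integral {s..t} g"
proof -
  have "integral {0..t} g - integral {0..s} g = integral {s..t} g"
    using assms by (intro integral_diff_eq[where b=T] L2_integrable_sub[where T=T] L2_primitive_L2[where u=u]) auto
  moreover have "u t - u 0 = integral {0..t} g" "u s - u 0 = integral {0..s} g"
    using assms unfolding L2_primitive_def by auto
  ultimately show ?thesis by simp
qed

lemma L2_primitive_continuous:
  assumes "L2_primitive T u g"
  shows "continuous_on {0..T} u"
proof -
  have "g integrable_on {0..T}"
    using assms by (intro L2_integrable_sub[where T=T] L2_primitive_L2[where u=u]) auto
  then have "continuous_on {0..T} (\<lambda>t. u 0 + integral {0..t} g)"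
    by (intro continuous_intros indefinite_integral_continuous_1)
  then show ?thesis
  proof (rule continuous_on_eq)
    fix t assume "t \<in> {0..T}"
    then have "u t - u 0 = integral {0..t} g" using assms by (simp add: L2_primitive_def)
    then show "u 0 + integral {0..t} g = u t" by simp
  qed
qed

lemma L2_primitive_lincomb:
  assumes u: "L2_primitive T u g" and v: "L2_primitive T v h"
  shows "L2_primitive T (\<lambda>t. a * u t + b * v t) (\<lambda>t. a * g t + b * h t)"
  unfolding L2_primitive_def
proof (intro conjI ballI)
  have g: "g \<in> L2 {0<..<T}" and h: "h \<in> L2 {0<..<T}" using u v by (auto simp: L2_primitive_def)
  then show "(\<lambda>t. a * g t + b * h t) \<in> L2 {0<..<T}" by (intro L2_add L2_cmult)
  fix t assume t: "t \<in> {0..T}"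
  have "integral {0..t} (\<lambda>t. a * g t + b * h t) = a * integral {0..t} g + b * integral {0..t} h"
    using t by (subst integral_add) (auto intro!: L2_integrable_sub[where T=T] L2_cmult g h)
  moreover have "u t - u 0 = integral {0..t} g" "v t - v 0 = integral {0..t} h"
    using u v t unfolding L2_primitive_def by auto
  ultimately show "a * u t + b * v t - (a * u 0 + b * v 0) = integral {0..t} (\<lambda>t. a * g t + b * h t)"
    by (metis add_diff_add right_diff_distrib)
qed

lemma L2_primitive_diff:
  assumes "L2_primitive T u g" "L2_primitive T v h"
  shows "L2_primitive T (\<lambda>t. u t - v t) (\<lambda>t. g t - h t)"
  using L2_primitive_lincomb[OF assms, of 1 "-1"] by simp

lemma mean_value_segment:
  fixes \<Phi> :: "real \<Rightarrow> real"
  assumes "\<And>x. (\<Phi> has_real_derivative \<Phi>' x) (at x)"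
  shows "\<exists>\<xi>\<in>closed_segment a b. \<Phi> b - \<Phi> a = \<Phi>' \<xi> * (b - a)"
proof (cases a b rule: linorder_cases)
  case less
  obtain z where "a < z" "z < b" "\<Phi> b - \<Phi> a = (b - a) * \<Phi>' z"
    using MVT2[OF less, of \<Phi> \<Phi>'] assms by blast
  then show ?thesis using less by (intro bexI[of _ z]) (auto simp: closed_segment_eq_real_ivl)
next
  case greater
  obtain z where "b < z" "z < a" "\<Phi> a - \<Phi> b = (a - b) * \<Phi>' z"
    using MVT2[OF greater, of \<Phi> \<Phi>'] assms by blast
  then show ?thesis using greater
    by (intro bexI[of _ z]) (auto simp: closed_segment_eq_real_ivl algebra_simps)
qed auto

text \<open>Over a short step the mean value theorem writes the increment of \<Phi> as \<Phi>'(u r)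
  times the increment of u. By uniform continuity of \<Phi>' along u, the defect of the formula on
  that step is at most \<eta> times the integral of |g|. These bounds add up over the steps, and
  \<eta> is arbitrary.\<close>

lemma L2_primitive_chain_rule:
  assumes u: "L2_primitive T u g" and t: "t \<in> {0..T}"
    and \<Phi>: "\<And>x. (\<Phi> has_real_derivative \<Phi>' x) (at x)" and \<Phi>': "continuous_on UNIV \<Phi>'"
  shows "\<Phi> (u t) - \<Phi> (u 0) = integral {0..t} (\<lambda>x. \<Phi>' (u x) * g x)"
proof -
  have g: "g \<in> L2 {0<..<T}" using u by (rule L2_primitive_L2)
  have ga: "(\<lambda>x. \<bar>g x\<bar>) \<in> L2 {0<..<T}" using g by (rule L2_abs)
  have uc: "continuous_on {0..T} u" using u by (rule L2_primitive_continuous)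
  have \<psi>c: "continuous_on {0..T} (\<lambda>x. \<Phi>' (u x))"
    by (rule continuous_on_compose2[OF \<Phi>' uc]) auto
  then have \<psi>: "(\<lambda>x. \<Phi>' (u x)) \<in> L2 {0<..<T}" by (rule L2_continuous)
  define F where "F r = \<Phi> (u r) - integral {0..r} (\<lambda>x. \<Phi>' (u x) * g x)" for r
  have bound: "\<bar>F t - F 0\<bar> \<le> \<eta> * integral {0..t} (\<lambda>x. \<bar>g x\<bar>)" if \<eta>: "\<eta> > 0" for \<eta>
  proof -
    have "uniformly_continuous_on {0..T} (\<lambda>x. \<Phi>' (u x))"
      using \<psi>c by (intro compact_uniformly_continuous) auto
    then obtain \<delta> where \<delta>: "\<delta> > 0"
      "\<And>x y. x \<in> {0..T} \<Longrightarrow> y \<in> {0..T} \<Longrightarrow> dist x y < \<delta> \<Longrightarrow> dist (\<Phi>' (u x)) (\<Phi>' (u y)) < \<eta>"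
      unfolding uniformly_continuous_on_def using \<eta> by metis
    obtain N :: nat where N: "N > 0" "t / real N < \<delta>"
    proof -
      obtain N :: nat where N: "real N > t / \<delta>" using reals_Archimedean2 by blast
      have "t < real (Suc N) * \<delta>" using N \<delta>(1) by (simp add: field_simps)
      then have "t / real (Suc N) < \<delta>" by (simp add: divide_less_eq mult.commute)
      then show ?thesis using that[of "Suc N"] by blast
    qed
    define h where "h = (t - 0) / real N"
    have h: "h \<ge> 0" "h < \<delta>" using N t by (auto simp: h_def)
    let ?m = "\<lambda>r. \<eta> * integral {0..r} (\<lambda>x. \<bar>g x\<bar>)"
    have step: "\<bar>F (s + h) - F s\<bar> \<le> ?m (s + h) - ?m s" if s: "0 \<le> s" "s + h \<le> t" for s
    proof -
      have sT: "s + h \<le> T" "s \<le> T" using s t h by auto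
      obtain \<xi> where \<xi>: "\<xi> \<in> closed_segment (u s) (u (s + h))"
        "\<Phi> (u (s + h)) - \<Phi> (u s) = \<Phi>' \<xi> * (u (s + h) - u s)"
        using mean_value_segment[of \<Phi> \<Phi>', OF \<Phi>] by blast
      \<comment> \<open>The intermediate value \<xi> has to be a value of u inside the step, because
        the modulus of continuity \<delta> is one in the time variable.\<close>
      have "connected (u ` {s..s+h})"
        using s sT by (intro connected_continuous_image continuous_on_subset[OF uc]) auto
      then have "convex (u ` {s..s+h})"
        by (simp add: is_interval_connected_1[symmetric] is_interval_convex_1)
      then have "closed_segment (u s) (u (s + h)) \<subseteq> u ` {s..s+h}"
        using h by (intro closed_segment_subset) auto
      then obtain r where r: "r \<in> {s..s+h}" "\<xi> = u r" using \<xi>(1) by blast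
      have inc: "u (s + h) - u s = integral {s..s+h} g"
        using s sT h by (intro L2_primitive_increment[OF u]) auto
      have int1: "g integrable_on {s..s+h}"
        using s sT by (intro L2_integrable_sub[OF g]) auto
      have int2: "(\<lambda>x. \<Phi>' (u x) * g x) integrable_on {s..s+h}"
        using s sT by (intro L2_mult_integrable_sub[OF \<psi> g]) auto
      have int3: "(\<lambda>x. \<bar>g x\<bar>) integrable_on {s..s+h}"
        using s sT by (intro L2_integrable_sub[OF ga]) auto
      have "F (s + h) - F s = \<Phi>' (u r) * integral {s..s+h} g - integral {s..s+h} (\<lambda>x. \<Phi>' (u x) * g x)"
        using \<xi>(2) inc r(2) integral_diff_eq[of "\<lambda>x. \<Phi>' (u x) * g x" 0 T s "s + h"] s sT h
          L2_mult_integrable_sub[OF \<psi> g, of 0 T] by (simp add: F_def)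
      also have "\<dots> = integral {s..s+h} (\<lambda>x. \<Phi>' (u r) * g x - \<Phi>' (u x) * g x)"
        using integral_diff[OF integrable_on_cmult_left[OF int1] int2, of "\<Phi>' (u r)"] by simp
      finally have "\<bar>F (s + h) - F s\<bar> = norm (integral {s..s+h} (\<lambda>x. \<Phi>' (u r) * g x - \<Phi>' (u x) * g x))"
        by simp
      also have "\<dots> \<le> integral {s..s+h} (\<lambda>x. \<eta> * \<bar>g x\<bar>)"
      proof (rule integral_norm_bound_integral)
        show "(\<lambda>x. \<Phi>' (u r) * g x - \<Phi>' (u x) * g x) integrable_on {s..s+h}"
          using integrable_diff[OF integrable_on_cmult_left[OF int1] int2, of "\<Phi>' (u r)"] by simp
        show "(\<lambda>x. \<eta> * \<bar>g x\<bar>) integrable_on {s..s+h}"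
          using integrable_on_cmult_left[OF int3, of \<eta>] by simp
        fix x assume x: "x \<in> {s..s+h}"
        have "dist (\<Phi>' (u r)) (\<Phi>' (u x)) < \<eta>"
          using x r s sT h by (intro \<delta>(2)) (auto simp: dist_real_def)
        then have "\<bar>\<Phi>' (u r) - \<Phi>' (u x)\<bar> * \<bar>g x\<bar> \<le> \<eta> * \<bar>g x\<bar>"
          by (intro mult_right_mono) (auto simp: dist_real_def)
        then show "norm (\<Phi>' (u r) * g x - \<Phi>' (u x) * g x) \<le> \<eta> * \<bar>g x\<bar>"
          by (simp add: abs_mult[symmetric] left_diff_distrib[symmetric])
      qed
      also have "\<dots> = \<eta> * integral {s..s+h} (\<lambda>x. \<bar>g x\<bar>)" by simp
      also have "integral {s..s+h} (\<lambda>x. \<bar>g x\<bar>) = integral {0..s+h} (\<lambda>x. \<bar>g x\<bar>) - integral {0..s} (\<lambda>x. \<bar>g x\<bar>)"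
        using s h sT by (intro integral_diff_eq[where b=T, symmetric] L2_integrable_sub[OF ga]) auto
      finally show ?thesis by (simp add: algebra_simps)
    qed
    \<comment> \<open>The step bound is telescoped for F and for -F, which yields the two sides of
      the absolute value.\<close>
    have "F t - F 0 \<le> ?m t - ?m 0"
      by (rule step_monotone[OF _ N(1) h_def]) (use step t in \<open>auto intro: order_trans[OF abs_ge_self]\<close>)
    moreover have "(- F t) - (- F 0) \<le> ?m t - ?m 0"
    proof (rule step_monotone[OF _ N(1) h_def])
      show "0 \<le> t" using t by simp
      show "- F (s + h) - - F s \<le> ?m (s + h) - ?m s" if "0 \<le> s" "s + h \<le> t" for s
        using step[OF that] by linarith
    qed
    ultimately show ?thesis by (simp add: abs_le_iff)
  qed
  have "\<bar>F t - F 0\<bar> \<le> 0 + e" if "e > 0" for e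
  proof -
    define J where "J = integral {0..t} (\<lambda>x. \<bar>g x\<bar>)"
    have J: "J \<ge> 0" unfolding J_def
      using t by (intro Henstock_Kurzweil_Integration.integral_nonneg L2_integrable_sub[OF ga]) auto
    \<comment> \<open>Dividing by J + 1 keeps the choice of \<eta> valid when J = 0.\<close>
    have "\<bar>F t - F 0\<bar> \<le> e / (J + 1) * J" unfolding J_def
      using J that by (intro bound) (simp add: J_def)
    also have "\<dots> \<le> e" using J that by (simp add: divide_le_eq mult_left_mono)
    finally show ?thesis by simp
  qed
  then have "\<bar>F t - F 0\<bar> \<le> 0" by (rule field_le_epsilon)
  then show ?thesis by (simp add: F_def)
qed

text \<open>Polarization: 4uv is the difference of the squares of u + v and u - v, and the chain
  rule applies to each square.\<close>

lemma L2_primitive_product: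
  assumes u: "L2_primitive T u g" and v: "L2_primitive T v h" and t: "t \<in> {0..T}"
  shows "((\<lambda>x. u x * h x + v x * g x) has_integral u t * v t - u 0 * v 0) {0..t}"
proof -
  have sq: "((\<lambda>x. 2 * w x * k x) has_integral (w t)\<^sup>2 - (w 0)\<^sup>2) {0..t}" if w: "L2_primitive T w k" for w k
  proof -
    have "(w t)\<^sup>2 - (w 0)\<^sup>2 = integral {0..t} (\<lambda>x. 2 * w x * k x)"
      by (rule L2_primitive_chain_rule[OF w t]) (auto intro!: derivative_eq_intros continuous_intros)
    moreover have "(\<lambda>x. 2 * w x) \<in> L2 {0<..<T}"
      by (intro L2_continuous continuous_intros L2_primitive_continuous[OF w])
    then have "(\<lambda>x. 2 * w x * k x) integrable_on {0..t}"
      using t by (intro L2_mult_integrable_sub[where T=T] L2_primitive_L2[OF w]) auto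
    ultimately show ?thesis by (simp add: has_integral_iff)
  qed
  from has_integral_diff[OF sq[OF L2_primitive_lincomb[OF u v, of 1 1]] sq[OF L2_primitive_lincomb[OF u v, of 1 "-1"]]]
  have "((\<lambda>x. 4 * (u x * h x + v x * g x)) has_integral 4 * (u t * v t - u 0 * v 0)) {0..t}"
    by (simp add: power2_eq_square algebra_simps)
  from has_integral_mult_right[OF this, of "1/4"] show ?thesis
    by (simp add: add_divide_distrib diff_divide_distrib)
qed

lemma L2_primitive_C1:
  assumes D: "\<And>x. x \<in> {0..T} \<Longrightarrow> (u has_real_derivative g x) (at x within {0..T})"
    and g: "continuous_on {0..T} g"
  shows "L2_primitive T u g"
  unfolding L2_primitive_def
proof (intro conjI ballI L2_continuous g)
  fix t assume t: "t \<in> {0..T}"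
  have "(g has_integral u t - u 0) {0..t}"
    by (rule fundamental_theorem_of_calculus)
      (use t in \<open>auto simp: has_real_derivative_iff_has_vector_derivative[symmetric] intro!: DERIV_subset[OF D]\<close>)
  then show "u t - u 0 = integral {0..t} g" by (simp add: integral_unique)
qed

text \<open>Approximate \<open>v\<close> by a polynomial and integrate by parts.\<close>

lemma L2_pairing_le:
  fixes v :: "real \<Rightarrow> real"
  assumes v: "v \<in> L2 {0<..<T}" and "\<eta> > 0" "T > 0"
  obtains C where "C \<ge> 0"
    "\<And>f K. f \<in> L2 {0<..<T} \<Longrightarrow> (\<forall>t\<in>{0..T}. \<bar>integral {0..t} f\<bar> \<le> K)
        \<Longrightarrow> \<bar>integral {0..T} (\<lambda>x. f x * v x)\<bar> \<le> \<eta> * L2_norm T f + C * K"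
proof -
  obtain w where w: "continuous_on UNIV w" "L2_norm T (\<lambda>x. v x - w x) \<le> \<eta> / 2"
    using L2_approx_continuous[OF v, of "\<eta> / 2"] \<open>\<eta> > 0\<close> by auto
  have wc: "continuous_on {0..T} w" using w(1) continuous_on_subset by blast
  \<comment> \<open>A uniform error \<delta> costs at most \<delta> sqrt T = \<eta>/2 in the L2
    norm; the other half of \<eta> is spent on replacing v by w.\<close>
  define \<delta> where "\<delta> = \<eta> / (2 * sqrt T)"
  have \<delta>: "\<delta> > 0" using assms by (simp add: \<delta>_def)
  obtain p where p: "real_polynomial_function p" "\<And>x. x \<in> {0..T} \<Longrightarrow> \<bar>w x - p x\<bar> < \<delta>"
    using Stone_Weierstrass_real_polynomial_function[OF _ wc \<delta>] by auto
  obtain p' where p': "real_polynomial_function p'" "\<And>x. (p has_real_derivative p' x) (at x)"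
    using has_real_derivative_polynomial_function[OF p(1)] by blast
  have cont: "continuous_on {0..T} p" "continuous_on {0..T} p'"
    using p(1) p'(1) by (auto intro: continuous_on_polymonial_function simp: real_polynomial_function_eq)
  have L: "p \<in> L2 {0<..<T}" "w \<in> L2 {0<..<T}" "p' \<in> L2 {0<..<T}" using cont wc by (auto intro: L2_continuous)
  have pp: "L2_primitive T p p'" by (rule L2_primitive_C1[OF has_field_derivative_at_within[OF p'(2)] cont(2)])
  obtain D where D: "0 \<le> D" "\<And>x. x \<in> {0..T} \<Longrightarrow> norm (p' x) \<le> D"
    using continuous_on_interval_bound[OF cont(2)] by blast
  have "L2_norm T (\<lambda>x. w x - p x) \<le> L2_norm T (\<lambda>_. \<delta>)"
    by (intro L2_norm_mono L2_diff L L2_const) (use p(2) in \<open>auto intro: less_imp_le\<close>)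
  also have "\<dots> = \<eta> / 2" using \<open>T > 0\<close> \<delta> by (subst L2_norm_const) (auto simp: \<delta>_def)
  finally have "L2_norm T (\<lambda>x. (v x - w x) - (p x - w x)) \<le> \<eta>"
    using L2_norm_diff_triangle[OF L2_diff[OF v L(2)] L2_diff[OF L(1,2)]] w(2)
    by (simp add: L2_norm_def power2_commute)
  then have close: "L2_norm T (\<lambda>x. v x - p x) \<le> \<eta>" by simp
  \<comment> \<open>The two summands of the constant bound the boundary term and the integral of F
    p' in the integration by parts. They depend on v and \<eta> only, so the estimate is uniform in
    f and K.\<close>
  show ?thesis
  proof (rule that[of "\<bar>p T\<bar> + T * D"])
    show "0 \<le> \<bar>p T\<bar> + T * D" using D \<open>T > 0\<close> by simp
    fix f :: "real \<Rightarrow> real" and K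
    assume f: "f \<in> L2 {0<..<T}" and K: "\<forall>t\<in>{0..T}. \<bar>integral {0..t} f\<bar> \<le> K"
    let ?F = "\<lambda>t. integral {0..t} f"
    have F: "L2_primitive T ?F f" using f by (simp add: L2_primitive_def)
    have FL: "?F \<in> L2 {0<..<T}" by (rule L2_continuous[OF L2_primitive_continuous[OF F]])
    have Fp: "(\<lambda>x. ?F x * p' x) integrable_on {0..T}" by (rule L2_mult_integrable_sub[OF FL L(3)]) auto
    have "?F T * p T = integral {0..T} (\<lambda>x. ?F x * p' x + p x * f x)"
      using integral_unique[OF L2_primitive_product[OF F pp, of T]] \<open>T > 0\<close> by simp
    also have "\<dots> = integral {0..T} (\<lambda>x. ?F x * p' x) + integral {0..T} (\<lambda>x. p x * f x)"
      by (rule integral_add[OF Fp L2_mult_integrable_sub[OF L(1) f]]) auto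
    also have "(\<lambda>x. p x * f x) = (\<lambda>x. f x * p x)" by (simp add: mult.commute)
    finally have parts: "?F T * p T = integral {0..T} (\<lambda>x. ?F x * p' x) + integral {0..T} (\<lambda>x. f x * p x)" .
    have "norm (integral {0..T} (\<lambda>x. ?F x * p' x)) \<le> integral {0..T} (\<lambda>x. K * D)"
    proof (rule integral_norm_bound_integral[OF Fp integrable_const_ivl])
      show "norm (?F x * p' x) \<le> K * D" if x: "x \<in> {0..T}" for x
        unfolding norm_mult using K[rule_format, OF x] D x by (intro mult_mono) auto
    qed
    then have 1: "\<bar>integral {0..T} (\<lambda>x. ?F x * p' x)\<bar> \<le> T * D * K" using \<open>T > 0\<close> by (simp add: mult_ac)
    have 2: "\<bar>?F T * p T\<bar> \<le> K * \<bar>p T\<bar>"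
      unfolding abs_mult using K \<open>T > 0\<close> by (intro mult_right_mono) auto
    have 3: "\<bar>integral {0..T} (\<lambda>x. f x * (v x - p x))\<bar> \<le> L2_norm T f * \<eta>"
      using L2_Cauchy_Schwarz[OF f L2_diff[OF v L(1)]] mult_left_mono[OF close L2_norm_nonneg[of T f]]
      by linarith
    show "\<bar>integral {0..T} (\<lambda>x. f x * v x)\<bar> \<le> \<eta> * L2_norm T f + (\<bar>p T\<bar> + T * D) * K"
      using parts 1 2 3 L2_pairing_diff(2)[OF v L(1) f] by (simp add: distrib_right mult.commute[of K] mult.commute[of _ \<eta>])
  qed
qed

text \<open>The pairing estimate with v = f and K = 0 makes the integral of the square of f
  arbitrarily small.\<close>

lemma L2_AE_zero:
  fixes f :: "real \<Rightarrow> real"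
  assumes f: "f \<in> L2 {0<..<T}" and "T > 0"
    and zero: "\<And>t. t \<in> {0..T} \<Longrightarrow> integral {0..t} f = 0"
  shows "AE t in lebesgue_on {0<..<T}. f t = 0"
proof -
  have "\<bar>integral {0..T} (\<lambda>x. f x * f x)\<bar> \<le> 0 + \<eta>" if "\<eta> > 0" for \<eta>
  proof -
    define \<eta>' where "\<eta>' = \<eta> / (L2_norm T f + 1)"
    have "\<eta>' > 0" using that L2_norm_nonneg[of T f] by (simp add: \<eta>'_def add_nonneg_pos)
    then have "\<bar>integral {0..T} (\<lambda>x. f x * f x)\<bar> \<le> \<eta>' * L2_norm T f"
      by (rule L2_pairing_le[OF f _ \<open>T > 0\<close>]) (use f zero in force)
    also have "\<dots> \<le> \<eta>"
      unfolding \<eta>'_def using that L2_norm_nonneg[of T f]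
      by (simp add: divide_le_eq mult_left_mono add_nonneg_pos)
    finally show ?thesis by simp
  qed
  then have "\<bar>integral {0..T} (\<lambda>x. f x * f x)\<bar> \<le> 0" by (rule field_le_epsilon)
  then have "(LINT x|lebesgue_on {0<..<T}. f x * f x) = 0"
    using integrable_interval(2)[OF L2_mult_integrable[OF f f]] by simp
  then have "AE x in lebesgue_on {0<..<T}. f x * f x = 0"
    using integral_nonneg_eq_0_iff_AE[OF L2_mult_integrable[OF f f]] by simp
  then show ?thesis by simp
qed

text \<open>Apply the chain rule to \<open>arctan (k u) / k\<close>, which tends to 0 uniformly while its derivative
  tends to the indicator of the zero set of \<open>u\<close>.\<close>

lemma L2_primitive_deriv_zero_on_level:
  assumes u: "L2_primitive T u g" and "T > 0"
  shows "AE x in lebesgue_on {0<..<T}. u x = 0 \<longrightarrow> g x = 0"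
proof -
  have g: "g \<in> L2 {0<..<T}" using u by (rule L2_primitive_L2)
  have uc: "continuous_on {0..T} u" using u by (rule L2_primitive_continuous)
  define k where "k n = real (Suc n)" for n
  have k: "k n > 0" for n by (simp add: k_def)
  define f where "f n x = inverse (1 + (k n * u x)\<^sup>2) * g x" for n x
  define f0 where "f0 x = (if u x = 0 then g x else 0)" for x
  have \<psi>: "(\<lambda>x. inverse (1 + (k n * u x)\<^sup>2)) \<in> L2 {0<..<T}" for n
    by (intro L2_continuous continuous_intros uc) (auto simp: add_nonneg_eq_0_iff)
  have lim: "(\<lambda>n. f n x) \<longlonglongrightarrow> f0 x" for x
  proof (cases "u x = 0")
    case True
    then show ?thesis by (simp add: f_def f0_def)
  next
    case False
    have "filterlim k at_top sequentially"
      unfolding k_def using filterlim_real_sequentially filterlim_sequentially_Suc by blast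
    then have "filterlim (\<lambda>n. (k n)\<^sup>2) at_top sequentially"
      by (intro filterlim_pow_at_top) auto
    then have "filterlim (\<lambda>n. (u x)\<^sup>2 * (k n)\<^sup>2) at_top sequentially"
      using False by (intro filterlim_tendsto_pos_mult_at_top[OF tendsto_const]) auto
    then have "filterlim (\<lambda>n. 1 + (u x)\<^sup>2 * (k n)\<^sup>2) at_top sequentially"
      by (intro filterlim_tendsto_add_at_top[OF tendsto_const])
    then have "(\<lambda>n. inverse (1 + (u x)\<^sup>2 * (k n)\<^sup>2)) \<longlonglongrightarrow> 0"
      by (rule tendsto_inverse_0_at_top)
    from tendsto_mult_right[OF this, of "g x"] show ?thesis
      using False by (simp add: f_def f0_def power_mult_distrib mult.commute)
  qed
  have f_bound: "\<bar>f n x\<bar> \<le> \<bar>g x\<bar>" for n x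
  proof -
    have "inverse (1 + (k n * u x)\<^sup>2) \<le> 1" by (simp add: inverse_le_1_iff)
    then have "inverse (1 + (k n * u x)\<^sup>2) * \<bar>g x\<bar> \<le> 1 * \<bar>g x\<bar>" by (intro mult_right_mono) auto
    then show ?thesis by (simp add: f_def abs_mult)
  qed
  have f0: "f0 \<in> L2 {0<..<T}"
  proof -
    have meas: "f0 \<in> borel_measurable (lebesgue_on {0<..<T})"
    proof (rule borel_measurable_LIMSEQ_real[OF lim])
      show "f n \<in> borel_measurable (lebesgue_on {0<..<T})" for n
        using \<psi>[of n] g unfolding f_def L2_def by (intro borel_measurable_times) auto
    qed
    moreover have "integrable (lebesgue_on {0<..<T}) (\<lambda>x. (norm (f0 x))\<^sup>2)"
    proof (rule Bochner_Integration.integrable_bound)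
      show "integrable (lebesgue_on {0<..<T}) (\<lambda>x. (norm (g x))\<^sup>2)" using g by (simp add: L2_def)
      show "(\<lambda>x. (norm (f0 x))\<^sup>2) \<in> borel_measurable (lebesgue_on {0<..<T})"
        using meas by simp
      show "AE x in lebesgue_on {0<..<T}. norm ((norm (f0 x))\<^sup>2) \<le> norm ((norm (g x))\<^sup>2)"
        by (intro AE_I2) (simp add: f0_def)
    qed
    ultimately show ?thesis by (simp add: L2_def)
  qed
  have "integral {0..t} f0 = 0" if t: "t \<in> {0..T}" for t
  proof -
    have "(\<lambda>n. integral {0..t} (f n)) \<longlonglongrightarrow> integral {0..t} f0"
    proof (rule dominated_convergence(2))
      show "f n integrable_on {0..t}" for n
        unfolding f_def using t by (intro L2_mult_integrable_sub[OF \<psi> g]) auto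
      show "(\<lambda>x. \<bar>g x\<bar>) integrable_on {0..t}"
        using t by (intro L2_integrable_sub[OF L2_abs[OF g]]) auto
    qed (use lim f_bound in auto)
    moreover have "(\<lambda>n. integral {0..t} (f n)) \<longlonglongrightarrow> 0"
    proof (rule Lim_null_comparison)
      have "integral {0..t} (f n) = arctan (k n * u t) / k n - arctan (k n * u 0) / k n" for n
        unfolding f_def
      proof (rule L2_primitive_chain_rule[OF u t, symmetric])
        show "((\<lambda>y. arctan (k n * y) / k n) has_real_derivative inverse (1 + (k n * y)\<^sup>2)) (at y)" for y
        proof -
          have "((\<lambda>y. arctan (k n * y) / k n) has_real_derivative inverse (1 + (k n * y)\<^sup>2) * k n / k n) (at y)"
            by (auto intro!: derivative_eq_intros)
          then show ?thesis using k[of n] by simp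
        qed
        show "continuous_on UNIV (\<lambda>y. inverse (1 + (k n * y)\<^sup>2))"
          by (intro continuous_intros) (auto simp: add_nonneg_eq_0_iff)
      qed
      moreover have "\<bar>arctan y / k n - arctan z / k n\<bar> \<le> pi * inverse (k n)" for n y z
      proof -
        have "\<bar>arctan y - arctan z\<bar> \<le> pi"
          using arctan_lbound[of y] arctan_ubound[of y] arctan_lbound[of z] arctan_ubound[of z]
          by (simp add: abs_le_iff)
        then have "\<bar>arctan y - arctan z\<bar> / k n \<le> pi / k n"
          using k[of n] by (intro divide_right_mono) auto
        moreover have "\<bar>arctan y / k n - arctan z / k n\<bar> = \<bar>arctan y - arctan z\<bar> / k n"
          using k[of n] by (simp add: diff_divide_distrib[symmetric] abs_divide)
        ultimately show ?thesis by (simp add: divide_inverse)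
      qed
      ultimately show "\<forall>\<^sub>F n in sequentially. norm (integral {0..t} (f n)) \<le> pi * inverse (k n)"
        by simp
      show "(\<lambda>n. pi * inverse (k n)) \<longlonglongrightarrow> 0"
        unfolding k_def using tendsto_mult_right_zero[OF LIMSEQ_inverse_real_of_nat] by simp
    qed
    ultimately show ?thesis by (rule LIMSEQ_unique)
  qed
  from L2_AE_zero[OF f0 \<open>T > 0\<close> this] show ?thesis
    by (rule AE_mp) (auto simp: f0_def intro!: AE_I2)
qed

text \<open>Consider the last time s with a \<le> b. After s the function a lies above b, hence does
  not move, while b can only grow; so a cannot end above b. The barrier b need only be continuous
  and nondecreasing, which allows shifted solutions and constants.\<close>

lemma L2_primitive_comparison:
  assumes a: "L2_primitive T a g" and \<tau>: "\<tau> \<in> {0..T}"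
    and "a 0 \<le> b 0" and b: "continuous_on {0..\<tau>} b"
    and mono: "\<And>s t. 0 \<le> s \<Longrightarrow> s \<le> t \<Longrightarrow> t \<le> \<tau> \<Longrightarrow> b s \<le> b t"
    and ae: "AE x in lebesgue_on {0<..<T}. x \<le> \<tau> \<and> b x < a x \<longrightarrow> g x = 0"
  shows "a \<tau> \<le> b \<tau>"
proof (rule ccontr)
  assume contra: "\<not> a \<tau> \<le> b \<tau>"
  define S where "S = {r \<in> {0..\<tau>}. a r \<le> b r}"
  have ac: "continuous_on {0..\<tau>} a"
    using L2_primitive_continuous[OF a] \<tau> by (auto intro: continuous_on_subset)
  have "closed S" unfolding S_def
    by (rule continuous_on_closed_Collect_le[OF ac b]) simp
  moreover have "0 \<in> S" using assms(3) \<tau> by (simp add: S_def)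
  moreover have bdd: "bdd_above S" by (auto simp: S_def intro!: bdd_aboveI[of _ \<tau>])
  ultimately have "Sup S \<in> S" by (intro closed_contains_Sup) auto
  define s where "s = Sup S"
  have s: "0 \<le> s" "s \<le> \<tau>" "a s \<le> b s" using \<open>Sup S \<in> S\<close> by (auto simp: S_def s_def)
  have gt: "b r < a r" if "s < r" "r \<le> \<tau>" for r
  proof (rule ccontr)
    assume "\<not> b r < a r"
    then have "r \<in> S" using that s by (simp add: S_def)
    then have "r \<le> s" unfolding s_def by (rule cSup_upper[OF _ bdd])
    then show False using that by simp
  qed
  have neg: "negligible ({x \<in> {0..T}. \<not> (x \<le> \<tau> \<and> b x < a x \<longrightarrow> g x = 0)} \<union> {s})"
    using AE_interval_negligible[OF ae] by (simp add: negligible_insert)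
  have "integral {s..\<tau>} g = integral {s..\<tau>} (\<lambda>x. 0)"
  proof (rule integral_spike[OF neg])
    fix x assume x: "x \<in> {s..\<tau>} - ({x \<in> {0..T}. \<not> (x \<le> \<tau> \<and> b x < a x \<longrightarrow> g x = 0)} \<union> {s})"
    then have "b x < a x" by (intro gt) auto
    then show "0 = g x" using x s \<tau> by auto
  qed
  then have "a \<tau> = a s" using L2_primitive_increment[OF a, of s \<tau>] s \<tau> by simp
  also have "\<dots> \<le> b \<tau>" using s mono[of s \<tau>] by linarith
  finally show False using contra by simp
qed

text \<open>The auxiliary E is the right-hand side of the integral inequality damped by exp(-k r),
  and the inequality says precisely that the derivative of E is nonpositive.\<close>

lemma Gronwall:
  fixes d :: "real \<Rightarrow> real"
  assumes d: "continuous_on {0..T} d" and "A \<ge> 0" "k \<ge> 0"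
    and le: "\<And>t. t \<in> {0..T} \<Longrightarrow> d t \<le> A + k * integral {0..t} d"
    and t: "t \<in> {0..T}"
  shows "d t \<le> A * exp (k * t)"
proof -
  define E where "E r = (A + k * integral {0..r} d) * exp (- k * r)" for r
  have "E t \<le> E 0"
  proof (rule DERIV_nonpos_imp_decreasing_open[where f=E and a=0 and b=t])
    show "0 \<le> t" using t by simp
    have "continuous_on {0..T} E" unfolding E_def
      by (intro continuous_intros indefinite_integral_continuous_1 integrable_continuous_interval d)
    then show "continuous_on {0..t} E" using t by (auto intro: continuous_on_subset)
    fix x assume x: "0 < x" "x < t"
    have "((\<lambda>r. integral {0..r} d) has_real_derivative d x) (at x within {0..T})"
      using x t by (intro integral_has_real_derivative d) auto
    then have D: "((\<lambda>r. integral {0..r} d) has_real_derivative d x) (at x)"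
      using x t by (simp add: at_within_Icc_at)
    have "(E has_real_derivative (k * (d x - (A + k * integral {0..x} d)) * exp (- k * x))) (at x)"
      unfolding E_def by (auto intro!: derivative_eq_intros D simp: algebra_simps)
    moreover have "k * (d x - (A + k * integral {0..x} d)) * exp (- k * x) \<le> 0"
      using le[of x] x t \<open>k \<ge> 0\<close> by (intro mult_nonpos_nonneg[OF mult_nonneg_nonpos]) auto
    ultimately show "\<exists>y. DERIV E x :> y \<and> y \<le> 0" by blast
  qed
  then have "A + k * integral {0..t} d \<le> A * exp (k * t)"
    by (simp add: E_def exp_minus field_simps)
  then show ?thesis using le[OF t] by simp
qed

section \<open>Weak derivatives on intervals\<close>

text \<open>Squaring makes the positive part continuously differentiable, as the chain rule
  requires; needed for the spline below and for the energy identity.\<close>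

lemma has_real_derivative_pos_part_square:
  "((\<lambda>x. (max 0 x)\<^sup>2) has_real_derivative 2 * max 0 x) (at x)" for x :: real
proof (cases x "0 :: real" rule: linorder_cases)
  case less
  have "((\<lambda>x. 0) has_real_derivative 2 * max 0 x) (at x)" using less by simp
  then show ?thesis
    by (rule has_field_derivative_transform_within_open[where S="{..<0}"]) (use less in auto)
next
  case greater
  have "((\<lambda>x. x\<^sup>2) has_real_derivative 2 * max 0 x) (at x)"
    using greater by (auto intro!: derivative_eq_intros)
  then show ?thesis
    by (rule has_field_derivative_transform_within_open[where S="{0<..}"]) (use greater in auto)
next
  case equal
  have "((\<lambda>h. ((max 0 (0 + h))\<^sup>2 - (max 0 0)\<^sup>2) / h) \<longlongrightarrow> 0) (at (0::real))"
  proof (rule Lim_null_comparison)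
    show "\<forall>\<^sub>F h in at 0. norm (((max 0 (0 + h))\<^sup>2 - (max 0 0)\<^sup>2) / h) \<le> \<bar>h\<bar>" for h :: real
      by (intro always_eventually) (auto simp: max_def power2_eq_square)
    show "((\<lambda>h::real. \<bar>h\<bar>) \<longlongrightarrow> 0) (at 0)"
      using tendsto_rabs[OF tendsto_ident_at, of "0::real" UNIV] by simp
  qed
  then show ?thesis using equal by (simp add: DERIV_def)
qed

text \<open>\<open>ramp\<close> is the quadratic spline rising from 0 to 1 on the unit interval and \<open>hat\<close> its derivative.
  Differences of rescaled ramps are test functions approximating the indicator of an interval.\<close>

definition hat :: "real \<Rightarrow> real" where
  "hat x = 4 * (max 0 x - 2 * max 0 (x - 1/2) + max 0 (x - 1))"

definition ramp :: "real \<Rightarrow> real" where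
  "ramp x = 2 * ((max 0 x)\<^sup>2 - 2 * (max 0 (x - 1/2))\<^sup>2 + (max 0 (x - 1))\<^sup>2)"

lemma ramp_deriv: "(ramp has_real_derivative hat x) (at x)"
proof -
  have shift: "((\<lambda>x. (max 0 (x - c))\<^sup>2) has_real_derivative 2 * max 0 (x - c)) (at x)" for c :: real
    using DERIV_chain2[OF has_real_derivative_pos_part_square DERIV_diff[OF DERIV_ident DERIV_const], of c x UNIV]
    by simp
  show ?thesis unfolding ramp_def hat_def
    by (rule derivative_eq_intros shift has_real_derivative_pos_part_square refl)+ simp
qed

lemma hat_continuous [continuous_intros]:
  "continuous_on S f \<Longrightarrow> continuous_on S (\<lambda>x. hat (f x))"
  unfolding hat_def by (intro continuous_intros)

lemma hat_nonneg: "0 \<le> hat x" by (auto simp: hat_def max_def)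

lemma hat_eq_0: "x \<le> 0 \<or> 1 \<le> x \<Longrightarrow> hat x = 0" by (auto simp: hat_def max_def)

lemma ramp_eq_0: "x \<le> 0 \<Longrightarrow> ramp x = 0" by (simp add: ramp_def max_def)

lemma ramp_eq_1: "1 \<le> x \<Longrightarrow> ramp x = 1"
  by (simp add: ramp_def max_def power2_eq_square algebra_simps)

lemma ramp_mono: "x \<le> y \<Longrightarrow> ramp x \<le> ramp y"
  by (rule DERIV_nonneg_imp_nondecreasing) (use ramp_deriv hat_nonneg in blast)+

lemma ramp_bounds: "0 \<le> ramp x" "ramp x \<le> 1"
  using ramp_mono[of "min x 0" x] ramp_mono[of x "max x 1"] ramp_eq_0[of "min x 0"] ramp_eq_1[of "max x 1"]
  by auto

lemma ramp_scaled_deriv: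
  assumes "e > 0"
  shows "((\<lambda>x. ramp ((x - r) / e)) has_real_derivative hat ((x - r) / e) / e) (at x)"
proof -
  have "((\<lambda>x. (x - r) / e) has_real_derivative 1 / e) (at x)"
    using assms by (auto intro!: derivative_eq_intros)
  from DERIV_chain2[OF ramp_deriv this] show ?thesis by simp
qed

lemma hat_scaled_has_integral:
  assumes "e > 0"
  shows "((\<lambda>x. hat ((x - r) / e) / e) has_integral 1) {r..r + e}"
proof -
  have "((\<lambda>x. hat ((x - r) / e) / e) has_integral ramp ((r + e - r) / e) - ramp ((r - r) / e)) {r..r + e}"
    using assms ramp_scaled_deriv[OF assms]
    by (intro fundamental_theorem_of_calculus)
      (auto simp: has_real_derivative_iff_has_vector_derivative[symmetric] intro: has_field_derivative_at_within)
  then show ?thesis using assms by (simp add: ramp_eq_0 ramp_eq_1)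
qed

text \<open>A derivative need not be continuous, but its hat averages still converge at every point:
  integrate by parts on the two linear pieces of the hat.\<close>

lemma hat_mean_derivative:
  fixes k u :: "real \<Rightarrow> real"
  assumes k: "\<And>x. x \<in> {r..b} \<Longrightarrow> (k has_real_derivative u x) (at x within {r..b})" and "r < b"
  shows "((\<lambda>e. integral {r..r + e} (\<lambda>x. hat ((x - r) / e) / e * u x)) \<longlongrightarrow> u r) (at_right 0)"
proof (rule tendstoI)
  fix \<eta> :: real assume "\<eta> > 0"
  \<comment> \<open>Each \<open>J a\<close> is at most 2 \<eta>' times the square of e, the hat
    combines them with weights 4 and 8 over that square, so the total error is 24 \<eta>'; the
    number 25 leaves a strict inequality.\<close>
  define \<eta>' where "\<eta>' = \<eta> / 25"
  have \<eta>': "\<eta>' > 0" using \<open>\<eta> > 0\<close> by (simp add: \<eta>'_def)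
  \<comment> \<open>First-order remainder of k at r. Its derivative is u - u r, while
    differentiability at r alone makes R x small compared with x - r; integration by parts exchanges
    the former for the latter.\<close>
  define R where "R x = k x - k r - u r * (x - r)" for x
  have R': "(R has_real_derivative (u x - u r)) (at x within {r..b})" if "x \<in> {r..b}" for x
    unfolding R_def by (auto intro!: derivative_eq_intros k that)
  have Rc: "continuous_on {r..b} R" by (rule DERIV_continuous_on) (rule R')
  obtain d where d: "d > 0" "\<And>x. x \<in> {r..b} \<Longrightarrow> \<bar>x - r\<bar> < d \<Longrightarrow> \<bar>R x\<bar> \<le> \<eta>' * \<bar>x - r\<bar>"
  proof -
    have "(k has_derivative (\<lambda>h. u r * h)) (at r within {r..b})"
      using k[of r] \<open>r < b\<close> by (simp add: has_field_derivative_def)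
    then have "\<exists>d>0. \<forall>y\<in>{r..b}. norm (y - r) < d \<longrightarrow> norm (k y - k r - u r * (y - r)) \<le> \<eta>' * norm (y - r)"
      using \<eta>' unfolding has_derivative_within_alt by blast
    then show ?thesis using that by (auto simp: R_def)
  qed
  show "\<forall>\<^sub>F e in at_right 0. dist (integral {r..r + e} (\<lambda>x. hat ((x - r) / e) / e * u x)) (u r) < \<eta>"
    unfolding eventually_at_right_field
  proof (intro exI conjI allI impI)
    show "0 < min d (b - r)" using d \<open>r < b\<close> by simp
    fix e assume "0 < e" "e < min d (b - r)"
    then have e: "0 < e" "e < d" and e_b: "e < b - r" by auto
    have small: "\<bar>R x\<bar> \<le> \<eta>' * e" if "x \<in> {r..r + e}" for x
    proof -
      have "\<bar>R x\<bar> \<le> \<eta>' * \<bar>x - r\<bar>" using that e e_b by (intro d) auto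
      also have "\<dots> \<le> \<eta>' * e" using that \<eta>' by (intro mult_left_mono) auto
      finally show ?thesis .
    qed
    \<comment> \<open>Boundary term minus remaining integral when u - u r is integrated against the
      ramp starting at a.\<close>
    define J where "J a = (r + e - a) * R (r + e) - integral {a..r + e} R" for a
    have J: "((\<lambda>x. max 0 (x - a) * (u x - u r)) has_integral J a) {r..r + e}"
      and J_le: "\<bar>J a\<bar> \<le> 2 * \<eta>' * e\<^sup>2" if a: "a \<in> {r..r + e}" for a
    proof -
      have Rint: "R integrable_on {a..r + e}"
        by (rule integrable_continuous_interval[OF continuous_on_subset[OF Rc]]) (use a e_b in auto)
      have "((\<lambda>x. R x + (x - a) * (u x - u r)) has_integral (r + e - a) * R (r + e) - (a - a) * R a) {a..r + e}"
      proof (rule fundamental_theorem_of_calculus)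
        show "((\<lambda>x. (x - a) * R x) has_vector_derivative R x + (x - a) * (u x - u r)) (at x within {a..r + e})"
          if x: "x \<in> {a..r + e}" for x
        proof -
          have "(R has_real_derivative (u x - u r)) (at x within {a..r + e})"
            by (rule DERIV_subset[OF R']) (use x a e_b in auto)
          then show ?thesis unfolding has_real_derivative_iff_has_vector_derivative[symmetric]
            by (auto intro!: derivative_eq_intros)
        qed
      qed (use a in auto)
      moreover have "(R has_integral integral {a..r + e} R) {a..r + e}"
        by (rule integrable_integral[OF Rint])
      ultimately have "((\<lambda>x. R x + (x - a) * (u x - u r) - R x) has_integral
          ((r + e - a) * R (r + e) - (a - a) * R a) - integral {a..r + e} R) {a..r + e}"
        by (rule has_integral_diff)
      then have "((\<lambda>x. (x - a) * (u x - u r)) has_integral J a) {a..r + e}" by (simp add: J_def)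
      then have 1: "((\<lambda>x. max 0 (x - a) * (u x - u r)) has_integral J a) {a..r + e}"
        by (rule has_integral_eq[rotated]) auto
      have 2: "((\<lambda>x. max 0 (x - a) * (u x - u r)) has_integral 0) {r..a}"
        by (rule has_integral_eq[OF _ has_integral_0]) auto
      show "((\<lambda>x. max 0 (x - a) * (u x - u r)) has_integral J a) {r..r + e}"
        using has_integral_combine[OF _ _ 2 1] a by simp
      have "norm (integral {a..r + e} R) \<le> integral {a..r + e} (\<lambda>x. \<eta>' * e)"
        by (rule integral_norm_bound_integral)
          (use a small Rint in auto)
      also have "\<dots> = (r + e - a) * (\<eta>' * e)" using a by simp
      also have "\<dots> \<le> e * (\<eta>' * e)" using a \<eta>' e by (intro mult_right_mono) auto
      finally have "\<bar>integral {a..r + e} R\<bar> \<le> e * (\<eta>' * e)" by simp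
      moreover have "\<bar>(r + e - a) * R (r + e)\<bar> \<le> e * (\<eta>' * e)"
        unfolding abs_mult using a e small[of "r + e"] by (intro mult_mono) auto
      moreover have "2 * \<eta>' * e\<^sup>2 = e * (\<eta>' * e) + e * (\<eta>' * e)" by (simp add: power2_eq_square)
      ultimately show "\<bar>J a\<bar> \<le> 2 * \<eta>' * e\<^sup>2" unfolding J_def by linarith
    qed
    let ?w = "\<lambda>x. hat ((x - r) / e) / e"
    \<comment> \<open>On the support of the kernel the third piece of the hat vanishes; what is left
      are ramps starting at r and at the midpoint.\<close>
    have w_eq: "?w x = 4 / e\<^sup>2 * (max 0 (x - r) - 2 * max 0 (x - (r + e / 2)))" if "x \<in> {r..r + e}" for x
    proof -
      have "max 0 ((x - r) / e) = max 0 (x - r) / e"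
        using e that by (simp add: max_def)
      moreover have "max 0 ((x - r) / e - 1/2) = max 0 (x - (r + e / 2)) / e"
        using e by (auto simp: max_def field_simps)
      moreover have "max 0 ((x - r) / e - 1) = 0"
        using e that by (auto simp: max_def field_simps)
      ultimately have "hat ((x - r) / e) = 4 * (max 0 (x - r) / e - 2 * (max 0 (x - (r + e / 2)) / e) + 0)"
        unfolding hat_def by simp
      then show ?thesis using e by (simp only:) (simp add: power2_eq_square diff_divide_distrib)
    qed
    have "((\<lambda>x. 4 / e\<^sup>2 * (max 0 (x - r) * (u x - u r) - 2 * (max 0 (x - (r + e / 2)) * (u x - u r))))
        has_integral 4 / e\<^sup>2 * (J r - 2 * J (r + e / 2))) {r..r + e}"
      using e by (intro has_integral_mult_right has_integral_diff J) auto
    then have "((\<lambda>x. ?w x * (u x - u r)) has_integral 4 / e\<^sup>2 * (J r - 2 * J (r + e / 2))) {r..r + e}"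
    proof (rule has_integral_eq[rotated])
      show "4 / e\<^sup>2 * (max 0 (x - r) * (u x - u r) - 2 * (max 0 (x - (r + e / 2)) * (u x - u r)))
          = ?w x * (u x - u r)" if "x \<in> {r..r + e}" for x
        unfolding w_eq[OF that] by (simp only: left_diff_distrib mult.assoc)
    qed
    from has_integral_add[OF this has_integral_mult_left[OF hat_scaled_has_integral[OF e(1)], of r "u r"]]
    have "((\<lambda>x. ?w x * u x) has_integral 4 / e\<^sup>2 * (J r - 2 * J (r + e / 2)) + u r) {r..r + e}"
      unfolding right_diff_distrib[of "hat _ / _"] by simp
    from integral_unique[OF this] have "integral {r..r + e} (\<lambda>x. ?w x * u x) - u r = 4 / e\<^sup>2 * (J r - 2 * J (r + e / 2))"
      by linarith
    moreover have "\<bar>4 / e\<^sup>2 * (J r - 2 * J (r + e / 2))\<bar> \<le> 24 * \<eta>'"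
    proof -
      have "\<bar>J r - 2 * J (r + e / 2)\<bar> \<le> 6 * \<eta>' * e\<^sup>2"
        using J_le[of r] J_le[of "r + e / 2"] e by (auto simp: abs_le_iff)
      then have "4 / e\<^sup>2 * \<bar>J r - 2 * J (r + e / 2)\<bar> \<le> 4 / e\<^sup>2 * (6 * \<eta>' * e\<^sup>2)"
        by (intro mult_left_mono) auto
      moreover have "4 / e\<^sup>2 * (6 * \<eta>' * e\<^sup>2) = 24 * \<eta>'" using e by simp
      moreover have "\<bar>4 / e\<^sup>2\<bar> = 4 / e\<^sup>2" by simp
      ultimately show ?thesis unfolding abs_mult by linarith
    qed
    ultimately show "dist (integral {r..r + e} (\<lambda>x. ?w x * u x)) (u r) < \<eta>"
      using \<open>\<eta> > 0\<close> by (simp add: dist_real_def \<eta>'_def)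
  qed
qed

lemma hat_mean_continuous:
  fixes u :: "real \<Rightarrow> real"
  assumes "continuous_on {r..b} u" "r < b"
  shows "((\<lambda>e. integral {r..r + e} (\<lambda>x. hat ((x - r) / e) / e * u x)) \<longlongrightarrow> u r) (at_right 0)"
  by (rule hat_mean_derivative[OF integral_has_real_derivative[OF assms(1)] assms(2)])

lemma lebesgue_integral_supported:
  fixes f :: "real \<Rightarrow> real"
  assumes "f absolutely_integrable_on J" "J \<subseteq> I" "I \<in> sets lebesgue" "\<And>x. x \<notin> J \<Longrightarrow> f x = 0"
  shows "(LINT x|lebesgue_on I. f x) = integral J f"
proof -
  have "(LINT x|lebesgue_on I. f x) = (LINT x|lebesgue. indicator I x *\<^sub>R f x)"
    using assms by (intro integral_restrict_space) auto
  also have "\<dots> = (LINT x|lebesgue. indicator J x *\<^sub>R f x)"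
    using assms by (intro Bochner_Integration.integral_cong) (auto simp: indicator_def)
  also have "\<dots> = integral J f"
    using set_lebesgue_integral_eq_integral(2)[OF assms(1)] by (simp add: set_lebesgue_integral_def)
  finally show ?thesis .
qed

lemma continuous_times_absolutely_integrable:
  fixes f g :: "real \<Rightarrow> real"
  assumes "continuous_on {a..b} f" "g absolutely_integrable_on {a..b}"
  shows "(\<lambda>x. f x * g x) absolutely_integrable_on {a..b}"
  using assms
  by (intro absolutely_integrable_bounded_measurable_product_real continuous_imp_measurable_on_sets_lebesgue
      compact_imp_bounded compact_continuous_image) auto

lemma integral_supported:
  fixes f :: "real \<Rightarrow> real"
  assumes "B \<subseteq> A" "\<And>x. x \<in> A - B \<Longrightarrow> f x = 0"
  shows "integral A f = integral B f"
proof (rule integral_spike_set)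
  have "{x \<in> A - B. f x \<noteq> 0} = {}" "{x \<in> B - A. f x \<noteq> 0} = {}" using assms by auto
  then show "negligible {x \<in> A - B. f x \<noteq> 0}" "negligible {x \<in> B - A. f x \<noteq> 0}" by (simp_all only: negligible_empty)
qed

text \<open>The test function is a ramp rising just after s minus one rising just after t. Its
  derivative averages u immediately to the right of s and of t, and the function itself tends to the
  indicator of the interval between them. Only convergence of these averages is asked of u, which
  covers continuous functions as well as functions that are derivatives everywhere. The space
  between t and t1 accommodates the second ramp.\<close>

lemma weak_deriv_increment:
  fixes u g :: "real \<Rightarrow> real"
  assumes weak: "has_weak_deriv I u g" and I: "I \<in> sets lebesgue" "{s..t1} \<subseteq> I"
    and st: "s < t" "t < t1"
    and u: "u absolutely_integrable_on {s..t1}" and g: "g absolutely_integrable_on {s..t1}"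
    and lim: "\<And>r. r \<in> {s, t} \<Longrightarrow>
      ((\<lambda>e. integral {r..r + e} (\<lambda>x. hat ((x - r) / e) / e * u x)) \<longlongrightarrow> u r) (at_right 0)"
  shows "u t - u s = integral {s..t} g"
proof -
  \<comment> \<open>Widths at most t1 - t keep the support of the test functions within
    \<open>{s..t1}\<close>.\<close>
  define e where "e n = (t1 - t) / real (Suc n)" for n
  have e: "e n > 0" "e n \<le> t1 - t" for n
  proof -
    show "e n > 0" using st by (simp add: e_def)
    show "e n \<le> t1 - t" unfolding e_def using st by (subst divide_le_eq) (simp add: mult_le_cancel_left1)
  qed
  have e_lim: "e \<longlonglongrightarrow> 0"
    unfolding e_def using tendsto_mult_right_zero[OF LIMSEQ_inverse_real_of_nat, of "t1 - t"]
    by (simp add: divide_inverse)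
  have e_filter: "filterlim e (at_right 0) sequentially"
    unfolding filterlim_at using e(1) e_lim by (simp add: less_imp_neq[symmetric] always_eventually)
  let ?w = "\<lambda>n r x. hat ((x - r) / e n) / e n"
  let ?\<phi> = "\<lambda>n x. ramp ((x - s) / e n) - ramp ((x - t) / e n)"
  have \<phi>': "(?\<phi> n has_real_derivative ?w n s x - ?w n t x) (at x)" for n x
    by (intro DERIV_diff ramp_scaled_deriv e)
  have wc: "continuous_on A (?w n r)" for A n r
    using e(1)[of n] by (intro continuous_intros) auto
  have \<phi>c: "continuous_on A (?\<phi> n)" for A n
    by (rule DERIV_continuous_on) (rule has_field_derivative_at_within[OF \<phi>'])
  have out: "?\<phi> n x = 0" "?w n s x = 0" "?w n t x = 0" if "x \<notin> {s..t1}" for n x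
  proof -
    consider "x < s" | "x > t1" using \<open>x \<notin> {s..t1}\<close> by fastforce
    then have "?\<phi> n x = 0 \<and> ?w n s x = 0 \<and> ?w n t x = 0"
    proof cases
      case 1
      then have "(x - s) / e n \<le> 0" "(x - t) / e n \<le> 0"
        using st e(1)[of n] by (auto simp: divide_le_0_iff)
      then show ?thesis by (simp add: ramp_eq_0 hat_eq_0)
    next
      case 2
      then have "1 \<le> (x - s) / e n" "1 \<le> (x - t) / e n"
        using st e[of n] by (auto simp: le_divide_eq)
      then show ?thesis by (simp add: ramp_eq_1 hat_eq_0)
    qed
    then show "?\<phi> n x = 0" "?w n s x = 0" "?w n t x = 0" by auto
  qed
  have test: "?\<phi> n \<in> test_functions I" for n
    unfolding test_functions_def
  proof (intro CollectI conjI exI[of _ "{s..t1}"] allI impI)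
    show "?\<phi> n C1_differentiable_on UNIV"
      unfolding C1_differentiable_on_def
      using \<phi>' by (intro exI[of _ "\<lambda>x. ?w n s x - ?w n t x"] conjI continuous_on_diff wc)
        (simp add: has_real_derivative_iff_has_vector_derivative)
  qed (use I out in auto)
  have wu: "(\<lambda>x. ?w n r x * u x) absolutely_integrable_on {s..t1}" for n r
    by (intro continuous_times_absolutely_integrable wc u)
  have loc: "integral {s..t1} (\<lambda>x. ?w n r x * u x) = integral {r..r + e n} (\<lambda>x. ?w n r x * u x)"
    if "r \<in> {s, t}" for n r
  proof (rule integral_supported)
    show "{r..r + e n} \<subseteq> {s..t1}" using that st e[of n] by auto
    fix x assume "x \<in> {s..t1} - {r..r + e n}"
    then have "x \<le> r \<or> r + e n \<le> x" by auto
    then have "(x - r) / e n \<le> 0 \<or> 1 \<le> (x - r) / e n"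
      using e(1)[of n] by (auto simp: divide_le_0_iff le_divide_eq)
    then show "?w n r x * u x = 0" by (simp add: hat_eq_0)
  qed
  have parts: "integral {s..s + e n} (\<lambda>x. ?w n s x * u x) - integral {t..t + e n} (\<lambda>x. ?w n t x * u x)
      = - integral {s..t1} (\<lambda>x. ?\<phi> n x * g x)" for n
  proof -
    have "deriv (?\<phi> n) x = ?w n s x - ?w n t x" for x
      using \<phi>' by (rule DERIV_imp_deriv)
    then have "(LINT x|lebesgue_on I. (?w n s x - ?w n t x) * u x) = - (LINT x|lebesgue_on I. ?\<phi> n x * g x)"
      using weak test[of n] unfolding has_weak_deriv_def by (metis (no_types, lifting) Bochner_Integration.integral_cong real_scaleR_def)
    moreover have "(LINT x|lebesgue_on I. (?w n s x - ?w n t x) * u x) = integral {s..t1} (\<lambda>x. (?w n s x - ?w n t x) * u x)"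
      by (rule lebesgue_integral_supported)
        (auto simp: out I intro!: continuous_times_absolutely_integrable continuous_on_diff wc u)
    moreover have "(LINT x|lebesgue_on I. ?\<phi> n x * g x) = integral {s..t1} (\<lambda>x. ?\<phi> n x * g x)"
      by (rule lebesgue_integral_supported)
        (auto simp: out I intro!: continuous_times_absolutely_integrable \<phi>c g)
    moreover have "integral {s..t1} (\<lambda>x. (?w n s x - ?w n t x) * u x)
        = integral {s..t1} (\<lambda>x. ?w n s x * u x) - integral {s..t1} (\<lambda>x. ?w n t x * u x)"
      unfolding left_diff_distrib using wu by (intro integral_diff) (auto simp: absolutely_integrable_on_def)
    ultimately show ?thesis unfolding loc[of s, OF insertI1, symmetric] loc[of t, OF insertI2[OF singletonI], symmetric] by linarith
  qed
  have "(\<lambda>n. integral {s..s + e n} (\<lambda>x. ?w n s x * u x) - integral {t..t + e n} (\<lambda>x. ?w n t x * u x))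
      \<longlonglongrightarrow> u s - u t"
    by (intro tendsto_diff filterlim_compose[OF lim e_filter]) auto
  \<comment> \<open>Both ramps vanish at their own starting point, so the limit is the indicator of
    the half-open interval at every x; the point s is discarded later as a null set.\<close>
  moreover have "(\<lambda>n. integral {s..t1} (\<lambda>x. ?\<phi> n x * g x))
      \<longlonglongrightarrow> integral {s..t1} (\<lambda>x. if x \<in> {s<..t} then g x else 0)"
  proof (rule dominated_convergence(2))
    show "(\<lambda>x. ?\<phi> n x * g x) integrable_on {s..t1}" for n
      using continuous_times_absolutely_integrable[OF \<phi>c g] absolutely_integrable_on_def by blast
    show "(\<lambda>x. \<bar>g x\<bar>) integrable_on {s..t1}" using g by (simp add: absolutely_integrable_on_def)
    show "norm (?\<phi> n x * g x) \<le> \<bar>g x\<bar>" for n x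
    proof -
      have "\<bar>?\<phi> n x\<bar> \<le> 1"
        using ramp_bounds[of "(x - s) / e n"] ramp_bounds[of "(x - t) / e n"] by linarith
      then have "\<bar>?\<phi> n x\<bar> * \<bar>g x\<bar> \<le> 1 * \<bar>g x\<bar>" by (rule mult_right_mono) simp
      then show ?thesis by (simp add: abs_mult)
    qed
    have step: "(\<lambda>n. ramp ((x - r) / e n)) \<longlonglongrightarrow> (if r < x then 1 else 0)" for x r
    proof (cases "r < x")
      case True
      then have "\<forall>\<^sub>F n in sequentially. e n < x - r" using e_lim by (intro order_tendstoD(2)) auto
      then have "\<forall>\<^sub>F n in sequentially. ramp ((x - r) / e n) = 1"
        by (rule eventually_mono) (use e in \<open>auto intro!: ramp_eq_1 simp: le_divide_eq less_imp_le\<close>)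
      then show ?thesis using True by (simp add: tendsto_eventually)
    next
      case False
      then have "(x - r) / e n \<le> 0" for n using e(1)[of n] by (simp add: divide_le_0_iff)
      then show ?thesis using False by (simp add: ramp_eq_0)
    qed
    show "(\<lambda>n. ?\<phi> n x * g x) \<longlonglongrightarrow> (if x \<in> {s<..t} then g x else 0)" for x
      using tendsto_mult_right[OF tendsto_diff[OF step[of x s] step[of x t]], of "g x"] st
      by (auto split: if_splits)
  qed
  then have "(\<lambda>n. - integral {s..t1} (\<lambda>x. ?\<phi> n x * g x))
      \<longlonglongrightarrow> - integral {s..t1} (\<lambda>x. if x \<in> {s<..t} then g x else 0)" by (rule tendsto_minus)
  ultimately have "u s - u t = - integral {s..t1} (\<lambda>x. if x \<in> {s<..t} then g x else 0)"
    unfolding parts by (rule LIMSEQ_unique)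
  also have "integral {s..t1} (\<lambda>x. if x \<in> {s<..t} then g x else 0) = integral {s..t} (\<lambda>x. if x \<in> {s<..t} then g x else 0)"
    using st by (intro integral_supported) auto
  also have "\<dots> = integral {s..t} g"
    by (rule integral_spike[of "{s}"]) auto
  finally show ?thesis by simp
qed

lemma L2_UNIV_absolutely_integrable:
  fixes f :: "real \<Rightarrow> real"
  assumes "f \<in> L2 UNIV"
  shows "f absolutely_integrable_on {a..b}"
  unfolding set_integrable_def
proof (rule Bochner_Integration.integrable_bound)
  have "integrable lebesgue (indicator {a..b} :: real \<Rightarrow> real)"
    by (simp add: emeasure_lborel_Icc_eq less_top[symmetric])
  then show "integrable lebesgue (\<lambda>x. (norm (f x))\<^sup>2 + indicator {a..b} x)"
    using assms by (intro Bochner_Integration.integrable_add) (simp_all add: L2_def lebesgue_on_UNIV_eq)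
  show "(\<lambda>x. indicator {a..b} x *\<^sub>R f x) \<in> borel_measurable lebesgue"
    using assms by (intro borel_measurable_scaleR borel_measurable_indicator) (simp_all add: L2_def lebesgue_on_UNIV_eq)
  have le: "\<bar>y\<bar> \<le> y\<^sup>2 + 1" for y :: real
    using zero_le_power2[of "\<bar>y\<bar> - 1"] by (simp add: power2_diff)
  show "AE x in lebesgue. norm (indicator {a..b} x *\<^sub>R f x) \<le> norm ((norm (f x))\<^sup>2 + indicator {a..b} x)"
    using le by (intro AE_I2) (simp add: indicator_def)
qed

text \<open>A Sobolev function is continuous only after modification on a null set. Here the
  function is a derivative at every point, so its hat averages converge to its own value at every
  point; hence the increment formula holds without modification.\<close>

lemma W12_deriv_continuous:
  fixes \<kappa> :: "real \<Rightarrow> real"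
  assumes \<kappa>: "\<kappa> differentiable_on UNIV" and W: "deriv \<kappa> \<in> W12 UNIV"
  shows "continuous_on UNIV (deriv \<kappa>)"
proof -
  have D: "(\<kappa> has_real_derivative deriv \<kappa> x) (at x)" for x
    using \<kappa> by (simp add: differentiable_on_def DERIV_deriv_iff_real_differentiable)
  obtain g where g: "g \<in> L2 UNIV" "has_weak_deriv UNIV (deriv \<kappa>) g" and u: "deriv \<kappa> \<in> L2 UNIV"
    using W by (auto simp: W12_def)
  have mean: "((\<lambda>e. integral {r..r + e} (\<lambda>x. hat ((x - r) / e) / e * deriv \<kappa> x)) \<longlongrightarrow> deriv \<kappa> r) (at_right 0)" for r
    by (rule hat_mean_derivative[where b="r + 1", OF has_field_derivative_at_within[OF D]]) simp
  have inc: "deriv \<kappa> t - deriv \<kappa> s = integral {s..t} g" if "s < t" for s t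
    by (rule weak_deriv_increment[OF g(2), where ?t1.0="t + 1"])
      (use that in \<open>simp_all only: mean L2_UNIV_absolutely_integrable g u\<close>, simp_all)
  have "isCont (deriv \<kappa>) x" for x
  proof -
    have "continuous_on {x - 1..x + 1} (\<lambda>t. deriv \<kappa> (x - 1) + integral {x - 1..t} g)"
      using L2_UNIV_absolutely_integrable[OF g(1)] absolutely_integrable_on_def
      by (intro continuous_intros indefinite_integral_continuous_1) blast
    then have "continuous_on {x - 1..x + 1} (deriv \<kappa>)"
    proof (rule continuous_on_eq)
      fix t assume "t \<in> {x - 1..x + 1}"
      then show "deriv \<kappa> (x - 1) + integral {x - 1..t} g = deriv \<kappa> t"
        using inc[of "x - 1" t] by (cases "t = x - 1") auto
    qed
    then show ?thesis by (rule continuous_on_interior) simp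
  qed
  then show ?thesis by (simp add: continuous_on_eq_continuous_at)
qed

section \<open>The space \<open>H1\<close>\<close>

lemma L2_component:
  fixes f :: "real \<Rightarrow> real ^ 'n"
  assumes "f \<in> L2 I"
  shows "(\<lambda>t. f t $ i) \<in> L2 I"
proof -
  have m: "(\<lambda>t. f t $ i) \<in> borel_measurable (lebesgue_on I)"
    using assms by (intro borel_measurable_continuous_on[of "\<lambda>v. v $ i"] continuous_intros) (simp add: L2_def)
  moreover have "integrable (lebesgue_on I) (\<lambda>t. (norm (f t $ i))\<^sup>2)"
  proof (rule Bochner_Integration.integrable_bound)
    show "integrable (lebesgue_on I) (\<lambda>t. (norm (f t))\<^sup>2)" using assms by (simp add: L2_def)
    show "(\<lambda>t. (norm (f t $ i))\<^sup>2) \<in> borel_measurable (lebesgue_on I)" using m by simp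
    show "AE t in lebesgue_on I. norm ((norm (f t $ i))\<^sup>2) \<le> norm ((norm (f t))\<^sup>2)"
      by (intro AE_I2) (simp add: abs_le_square_iff[symmetric] component_le_norm_cart)
  qed
  ultimately show ?thesis by (simp add: L2_def)
qed

lemma L2_scaleR_integrable:
  fixes f :: "real \<Rightarrow> real ^ 'n"
  assumes "f \<in> L2 I" "\<phi> \<in> L2 I"
  shows "integrable (lebesgue_on I) (\<lambda>t. \<phi> t *\<^sub>R f t)"
proof (rule Bochner_Integration.integrable_bound)
  show "integrable (lebesgue_on I) (\<lambda>t. (norm (\<phi> t))\<^sup>2 + (norm (f t))\<^sup>2)"
    using assms by (simp add: L2_def)
  show "(\<lambda>t. \<phi> t *\<^sub>R f t) \<in> borel_measurable (lebesgue_on I)"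
    using assms by (intro borel_measurable_scaleR) (simp_all add: L2_def)
  have "a * b \<le> a\<^sup>2 + b\<^sup>2" if "0 \<le> a" "0 \<le> b" for a b :: real
    using sum_squares_bound[of a b] mult_nonneg_nonneg[OF that] by linarith
  then show "AE t in lebesgue_on I. norm (\<phi> t *\<^sub>R f t) \<le> norm ((norm (\<phi> t))\<^sup>2 + (norm (f t))\<^sup>2)"
    by (intro AE_I2) (metis abs_ge_self norm_ge_zero norm_scaleR order_trans real_norm_def)
qed

lemma test_function_continuous:
  assumes "\<phi> \<in> test_functions I"
  shows "continuous_on UNIV \<phi>" "continuous_on UNIV (deriv \<phi>)"
proof -
  obtain D where D: "\<And>x. (\<phi> has_vector_derivative D x) (at x)" "continuous_on UNIV D"
    using assms by (auto simp: test_functions_def C1_differentiable_on_def)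
  then have D': "(\<phi> has_real_derivative D x) (at x)" for x
    by (simp add: has_real_derivative_iff_has_vector_derivative)
  then have "deriv \<phi> = D" by (auto intro: DERIV_imp_deriv)
  then show "continuous_on UNIV (deriv \<phi>)" using D by simp
  show "continuous_on UNIV \<phi>"
    by (rule DERIV_continuous_on) (rule has_field_derivative_at_within[OF D'])
qed

lemma test_function_L2:
  assumes "\<phi> \<in> test_functions {0<..<T}"
  shows "\<phi> \<in> L2 {0<..<T}" "deriv \<phi> \<in> L2 {0<..<T}"
  using test_function_continuous[OF assms] by (auto intro!: L2_continuous intro: continuous_on_subset)

lemma has_weak_deriv_component:
  fixes u g :: "real \<Rightarrow> real ^ 'n"
  assumes "has_weak_deriv {0<..<T} u g" "u \<in> L2 {0<..<T}" "g \<in> L2 {0<..<T}"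
  shows "has_weak_deriv {0<..<T} (\<lambda>t. u t $ i) (\<lambda>t. g t $ i)"
  unfolding has_weak_deriv_def
proof
  fix \<phi> assume \<phi>: "\<phi> \<in> test_functions {0<..<T}"
  let ?M = "lebesgue_on {0<..<T}"
  have c: "(LINT x|?M. f x) $ i = (LINT x|?M. f x $ i)" if "integrable ?M f" for f :: "real \<Rightarrow> real ^ 'n"
    using integral_bounded_linear[OF bounded_linear_vec_nth that, of i] by simp
  have "(LINT x|?M. deriv \<phi> x *\<^sub>R u x) $ i = (- (LINT x|?M. \<phi> x *\<^sub>R g x)) $ i"
    using assms(1) \<phi> by (simp add: has_weak_deriv_def)
  then show "(LINT x|?M. deriv \<phi> x *\<^sub>R u x $ i) = - (LINT x|?M. \<phi> x *\<^sub>R g x $ i)"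
    using c[OF L2_scaleR_integrable[OF assms(2) test_function_L2(2)[OF \<phi>]]]
      c[OF L2_scaleR_integrable[OF assms(3) test_function_L2(1)[OF \<phi>]]] by simp
qed

lemma has_weak_deriv_lincomb:
  fixes u v g h :: "real \<Rightarrow> real ^ 'n"
  assumes "has_weak_deriv {0<..<T} u g" "u \<in> L2 {0<..<T}" "g \<in> L2 {0<..<T}"
    and "has_weak_deriv {0<..<T} v h" "v \<in> L2 {0<..<T}" "h \<in> L2 {0<..<T}"
  shows "has_weak_deriv {0<..<T} (\<lambda>t. a *\<^sub>R u t + b *\<^sub>R v t) (\<lambda>t. a *\<^sub>R g t + b *\<^sub>R h t)"
  unfolding has_weak_deriv_def
proof
  fix \<phi> assume \<phi>: "\<phi> \<in> test_functions {0<..<T}"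
  let ?M = "lebesgue_on {0<..<T}"
  have lin: "(LINT x|?M. \<psi> x *\<^sub>R (a *\<^sub>R f x + b *\<^sub>R k x)) = a *\<^sub>R (LINT x|?M. \<psi> x *\<^sub>R f x) + b *\<^sub>R (LINT x|?M. \<psi> x *\<^sub>R k x)"
    if "f \<in> L2 {0<..<T}" "k \<in> L2 {0<..<T}" "\<psi> \<in> L2 {0<..<T}" for f k :: "real \<Rightarrow> real ^ 'n" and \<psi>
  proof -
    have "(LINT x|?M. \<psi> x *\<^sub>R (a *\<^sub>R f x + b *\<^sub>R k x)) = (LINT x|?M. a *\<^sub>R (\<psi> x *\<^sub>R f x) + b *\<^sub>R (\<psi> x *\<^sub>R k x))"
      by (simp add: scaleR_add_right mult.commute)
    also have "\<dots> = a *\<^sub>R (LINT x|?M. \<psi> x *\<^sub>R f x) + b *\<^sub>R (LINT x|?M. \<psi> x *\<^sub>R k x)"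
      using Bochner_Integration.integral_add[OF integrable_scaleR_right[OF L2_scaleR_integrable[OF that(1,3)]]
          integrable_scaleR_right[OF L2_scaleR_integrable[OF that(2,3)]], of a b]
      by (simp only: integral_scaleR_right)
    finally show ?thesis .
  qed
  show "(LINT x|?M. deriv \<phi> x *\<^sub>R (a *\<^sub>R u x + b *\<^sub>R v x)) = - (LINT x|?M. \<phi> x *\<^sub>R (a *\<^sub>R g x + b *\<^sub>R h x))"
    using assms(1,4) \<phi> lin[OF assms(2,5) test_function_L2(2)[OF \<phi>]] lin[OF assms(3,6) test_function_L2(1)[OF \<phi>]]
    by (simp add: has_weak_deriv_def)
qed

lemma H1_D:
  fixes u :: "real \<Rightarrow> real ^ 'n"
  assumes "u \<in> H1 T"
  shows "u \<in> L2 {0<..<T}" "weak_deriv {0<..<T} u \<in> L2 {0<..<T}"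
    "has_weak_deriv {0<..<T} u (weak_deriv {0<..<T} u)" "continuous_on {0..T} u"
proof -
  show "u \<in> L2 {0<..<T}" "continuous_on {0..T} u" using assms by (auto simp: H1_def W12_def)
  have "\<exists>g. g \<in> L2 {0<..<T} \<and> has_weak_deriv {0<..<T} u g"
    using assms by (auto simp: H1_def W12_def)
  from someI_ex[OF this] show "weak_deriv {0<..<T} u \<in> L2 {0<..<T}"
    "has_weak_deriv {0<..<T} u (weak_deriv {0<..<T} u)"
    unfolding weak_deriv_def by auto
qed

text \<open>Test functions see only the interior, so the increment formula is first obtained there.
  It says that D is constant on the open interval, and continuity up to the endpoints extends this
  to the closed one.\<close>

lemma weak_deriv_L2_primitive:
  fixes u :: "real \<Rightarrow> real"
  assumes weak: "has_weak_deriv {0<..<T} u g" and g: "g \<in> L2 {0<..<T}"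
    and u: "continuous_on {0..T} u" and "T > 0"
  shows "L2_primitive T u g"
proof -
  define D where "D t = u t - integral {0..t} g" for t
  have Dc: "continuous_on {0..T} D" unfolding D_def
    by (intro continuous_intros u indefinite_integral_continuous_1 L2_integrable_sub[OF g]) auto
  \<comment> \<open>The midpoint of t and T leaves space for the test functions to the right of t
    inside the open interval.\<close>
  have inc: "u t - u s = integral {s..t} g" if "0 < s" "s < t" "t < T" for s t
  proof (rule weak_deriv_increment[OF weak, where ?t1.0="(t + T) / 2"])
    show "u absolutely_integrable_on {s..(t + T) / 2}"
      by (intro absolutely_integrable_continuous_real continuous_on_subset[OF u]) (use that in auto)
    show "g absolutely_integrable_on {s..(t + T) / 2}"
      by (rule absolutely_integrable_on_subinterval[OF L2_abs_integrable[OF g]]) (use that in auto)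
    show "((\<lambda>\<epsilon>. integral {r..r + \<epsilon>} (\<lambda>x. hat ((x - r) / \<epsilon>) / \<epsilon> * u x)) \<longlongrightarrow> u r) (at_right 0)"
      if r: "r \<in> {s, t}" for r
      by (rule hat_mean_continuous[where b=T, OF continuous_on_subset[OF u]])
        (use r \<open>0 < s\<close> \<open>s < t\<close> \<open>t < T\<close> in auto)
  qed (use that in auto)
  have const: "D t = D (T / 2)" if "t \<in> {0<..<T}" for t
  proof -
    have "D t = D s" if "0 < s" "s < t" "t < T" for s t
      using inc[OF that] integral_diff_eq[OF L2_integrable_sub[OF g, of 0 T], of s t] that
      by (simp add: D_def)
    from this[of t "T / 2"] this[of "T / 2" t] that \<open>T > 0\<close> show ?thesis
      by (cases t "T / 2" rule: linorder_cases) auto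
  qed
  have cl: "closure {0<..<T} = {0..T}" using \<open>T > 0\<close> by simp
  have D: "D t = D (T / 2)" if "t \<in> {0..T}" for t
  proof (rule continuous_constant_on_closure[where f=D and S="{0<..<T}"])
    show "continuous_on (closure {0<..<T}) D" unfolding cl by (rule Dc)
    show "t \<in> closure {0<..<T}" unfolding cl by (rule that)
  qed (rule const)
  have "u t - u 0 = integral {0..t} g" if "t \<in> {0..T}" for t
    using D[OF that] D[of 0] \<open>T > 0\<close> by (simp add: D_def)
  then show ?thesis using g by (simp add: L2_primitive_def)
qed

lemma H1_component_primitive:
  fixes u :: "real \<Rightarrow> real ^ 'n"
  assumes "u \<in> H1 T" "T > 0"
  shows "L2_primitive T (\<lambda>t. u t $ i) (\<lambda>t. weak_deriv {0<..<T} u t $ i)"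
  using H1_D[OF assms(1)] assms(2)
  by (intro weak_deriv_L2_primitive has_weak_deriv_component L2_component continuous_intros) auto

lemma L2_primitive_unique:
  assumes "L2_primitive T u g" "L2_primitive T u h" "T > 0"
  shows "AE t in lebesgue_on {0<..<T}. g t = h t"
proof -
  have "AE t in lebesgue_on {0<..<T}. g t - h t = 0"
  proof (rule L2_AE_zero)
    show "(\<lambda>t. g t - h t) \<in> L2 {0<..<T}" using assms by (intro L2_diff) (auto simp: L2_primitive_def)
    show "integral {0..t} (\<lambda>t. g t - h t) = 0" if "t \<in> {0..T}" for t
      using L2_primitive_diff[OF assms(1,2)] that by (simp add: L2_primitive_def)
  qed fact
  then show ?thesis by simp
qed

lemma H1_lincomb:
  fixes u v :: "real \<Rightarrow> real ^ 'n"
  assumes "u \<in> H1 T" "v \<in> H1 T"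
  shows "(\<lambda>t. a *\<^sub>R u t + b *\<^sub>R v t) \<in> H1 T"
proof -
  note u = H1_D[OF assms(1)] and v = H1_D[OF assms(2)]
  have "(\<lambda>t. a *\<^sub>R u t + b *\<^sub>R v t) \<in> W12 {0<..<T}"
    unfolding W12_def
    using has_weak_deriv_lincomb[OF u(3,1,2) v(3,1,2), of a b] L2_add[OF L2_scaleR[OF u(2), of a] L2_scaleR[OF v(2), of b]]
      L2_add[OF L2_scaleR[OF u(1), of a] L2_scaleR[OF v(1), of b]] by blast
  moreover have "continuous_on {0..T} (\<lambda>t. a *\<^sub>R u t + b *\<^sub>R v t)"
    by (intro continuous_intros u v)
  ultimately show ?thesis using assms by (auto simp: H1_def)
qed

text \<open>\<open>weak_deriv\<close> is a choice, so linearity can be expected almost everywhere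
  only: both sides are rates of the same function.\<close>

lemma H1_weak_deriv_lincomb:
  fixes u v :: "real \<Rightarrow> real ^ 'n"
  assumes "u \<in> H1 T" "v \<in> H1 T" "T > 0"
  shows "AE t in lebesgue_on {0<..<T}. weak_deriv {0<..<T} (\<lambda>t. a *\<^sub>R u t + b *\<^sub>R v t) t $ i
      = a * weak_deriv {0<..<T} u t $ i + b * weak_deriv {0<..<T} v t $ i"
proof (rule L2_primitive_unique[OF _ _ \<open>T > 0\<close>])
  show "L2_primitive T (\<lambda>t. a * u t $ i + b * v t $ i)
      (\<lambda>t. weak_deriv {0<..<T} (\<lambda>t. a *\<^sub>R u t + b *\<^sub>R v t) t $ i)"
    using H1_component_primitive[OF H1_lincomb[OF assms(1,2), of a b] assms(3), of i] by simp
  show "L2_primitive T (\<lambda>t. a * u t $ i + b * v t $ i)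
      (\<lambda>t. a * weak_deriv {0<..<T} u t $ i + b * weak_deriv {0<..<T} v t $ i)"
    by (intro L2_primitive_lincomb H1_component_primitive assms)
qed

lemma H10_lincomb:
  fixes u v :: "real \<Rightarrow> real ^ 'n"
  assumes "u \<in> H10 T" "v \<in> H10 T"
  shows "(\<lambda>t. a *\<^sub>R u t + b *\<^sub>R v t) \<in> H10 T"
  using assms H1_lincomb[of u T v a b] by (simp add: H10_def)

text \<open>The inner product inducing \<open>H1_norm\<close>, written by components so that the
  scalar L2 lemmas apply to each summand.\<close>

definition H1_inner :: "real \<Rightarrow> (real \<Rightarrow> real ^ 'n) \<Rightarrow> (real \<Rightarrow> real ^ 'n) \<Rightarrow> real" where
  "H1_inner T u v = (\<Sum>i\<in>UNIV. integral {0..T} (\<lambda>t. u t $ i * v t $ i)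
      + integral {0..T} (\<lambda>t. weak_deriv {0<..<T} u t $ i * weak_deriv {0<..<T} v t $ i))"

lemma H1_component_L2:
  fixes u :: "real \<Rightarrow> real ^ 'n"
  assumes "u \<in> H1 T"
  shows "(\<lambda>t. u t $ i) \<in> L2 {0<..<T}" "(\<lambda>t. weak_deriv {0<..<T} u t $ i) \<in> L2 {0<..<T}"
  using H1_D[OF assms] by (auto intro: L2_component)

lemma H1_inner_commute: "H1_inner T u v = H1_inner T v u"
  by (simp add: H1_inner_def mult.commute)

lemma H1_inner_lincomb:
  fixes u v w :: "real \<Rightarrow> real ^ 'n"
  assumes u: "u \<in> H1 T" and v: "v \<in> H1 T" and w: "w \<in> H1 T" and "T > 0"
  shows "H1_inner T (\<lambda>t. a *\<^sub>R u t + b *\<^sub>R v t) w = a * H1_inner T u w + b * H1_inner T v w"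
proof -
  have "integral {0..T} (\<lambda>t. weak_deriv {0<..<T} (\<lambda>t. a *\<^sub>R u t + b *\<^sub>R v t) t $ i * weak_deriv {0<..<T} w t $ i)
      = integral {0..T} (\<lambda>t. (a * weak_deriv {0<..<T} u t $ i + b * weak_deriv {0<..<T} v t $ i) * weak_deriv {0<..<T} w t $ i)" for i
    by (rule integral_AE_cong[where T=T])
      (use H1_weak_deriv_lincomb[OF u v \<open>T > 0\<close>, of a b i] in \<open>auto elim: eventually_mono\<close>)
  then show ?thesis unfolding H1_inner_def
    by (simp add: L2_pairing_lincomb H1_component_L2 u v w sum.distrib sum_distrib_left distrib_left)
qed

lemma H1_norm_square:
  fixes u :: "real \<Rightarrow> real ^ 'n"
  assumes "u \<in> H1 T"
  shows "(H1_norm T u)\<^sup>2 = (\<Sum>i\<in>UNIV. (L2_norm T (\<lambda>t. u t $ i))\<^sup>2 + (L2_norm T (\<lambda>t. weak_deriv {0<..<T} u t $ i))\<^sup>2)"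
proof -
  have norm: "(LINT t|lebesgue_on {0<..<T}. (norm (f t))\<^sup>2) = (\<Sum>i\<in>UNIV. (L2_norm T (\<lambda>t. f t $ i))\<^sup>2)"
    if f: "f \<in> L2 {0<..<T}" for f :: "real \<Rightarrow> real ^ 'n"
  proof -
    have "(LINT t|lebesgue_on {0<..<T}. (norm (f t))\<^sup>2) = integral {0..T} (\<lambda>t. (norm (f t))\<^sup>2)"
      using f by (intro integrable_interval) (simp add: L2_def)
    also have "\<dots> = integral {0..T} (\<lambda>t. \<Sum>i\<in>UNIV. (f t $ i)\<^sup>2)"
      by (simp add: norm_vec_def L2_set_def sum_nonneg)
    also have "\<dots> = (\<Sum>i\<in>UNIV. integral {0..T} (\<lambda>t. (f t $ i)\<^sup>2))"
      by (intro integral_sum L2_square_integrable_on[where T=T] L2_component f) auto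
    finally show ?thesis by (simp add: L2_norm_square L2_component f)
  qed
  have nn: "0 \<le> (LINT t|lebesgue_on {0<..<T}. (norm (f t))\<^sup>2)" for f :: "real \<Rightarrow> real ^ 'n"
    by (rule Bochner_Integration.integral_nonneg) simp
  show ?thesis
    using nn[of u] nn[of "weak_deriv {0<..<T} u"] H1_D[OF assms]
    by (simp add: H1_norm_def norm sum.distrib)
qed

lemma H1_norm_nonneg: "0 \<le> H1_norm T u"
  by (simp add: H1_norm_def Bochner_Integration.integral_nonneg)

lemma H1_inner_self:
  fixes u :: "real \<Rightarrow> real ^ 'n"
  assumes "u \<in> H1 T"
  shows "H1_inner T u u = (H1_norm T u)\<^sup>2"
  unfolding H1_norm_square[OF assms] H1_inner_def power2_eq_square[symmetric]
  by (simp only: L2_norm_square[OF H1_component_L2(1)[OF assms]] L2_norm_square[OF H1_component_L2(2)[OF assms]])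

lemma H1_component_norm_le:
  fixes u :: "real \<Rightarrow> real ^ 'n"
  assumes "u \<in> H1 T"
  shows "L2_norm T (\<lambda>t. u t $ i) \<le> H1_norm T u"
    "L2_norm T (\<lambda>t. weak_deriv {0<..<T} u t $ i) \<le> H1_norm T u"
proof -
  have "(L2_norm T (\<lambda>t. u t $ i))\<^sup>2 + (L2_norm T (\<lambda>t. weak_deriv {0<..<T} u t $ i))\<^sup>2 \<le> (H1_norm T u)\<^sup>2"
    unfolding H1_norm_square[OF assms] by (intro member_le_sum) auto
  then have "(L2_norm T (\<lambda>t. u t $ i))\<^sup>2 \<le> (H1_norm T u)\<^sup>2"
    "(L2_norm T (\<lambda>t. weak_deriv {0<..<T} u t $ i))\<^sup>2 \<le> (H1_norm T u)\<^sup>2"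
    using zero_le_power2[of "L2_norm T (\<lambda>t. u t $ i)"]
      zero_le_power2[of "L2_norm T (\<lambda>t. weak_deriv {0<..<T} u t $ i)"] by linarith+
  then show "L2_norm T (\<lambda>t. u t $ i) \<le> H1_norm T u"
    "L2_norm T (\<lambda>t. weak_deriv {0<..<T} u t $ i) \<le> H1_norm T u"
    by (auto intro: power2_le_imp_le H1_norm_nonneg)
qed

lemma H1_norm_add_square:
  fixes u v :: "real \<Rightarrow> real ^ 'n"
  assumes u: "u \<in> H1 T" and v: "v \<in> H1 T" and "T > 0"
  shows "(H1_norm T (\<lambda>x. 1 *\<^sub>R u x + c *\<^sub>R v x))\<^sup>2
      = (H1_norm T u)\<^sup>2 + 2 * c * H1_inner T u v + c\<^sup>2 * (H1_norm T v)\<^sup>2"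
proof -
  let ?w = "\<lambda>x. 1 *\<^sub>R u x + c *\<^sub>R v x"
  have w: "?w \<in> H1 T" by (rule H1_lincomb[OF u v])
  have "(H1_norm T ?w)\<^sup>2 = 1 * H1_inner T u ?w + c * H1_inner T v ?w"
    unfolding H1_inner_self[OF w, symmetric] by (rule H1_inner_lincomb[OF u v w \<open>T > 0\<close>])
  also have "H1_inner T u ?w = 1 * H1_inner T u u + c * H1_inner T v u"
    unfolding H1_inner_commute[of T u ?w] by (rule H1_inner_lincomb[OF u v u \<open>T > 0\<close>])
  also have "H1_inner T v ?w = 1 * H1_inner T u v + c * H1_inner T v v"
    unfolding H1_inner_commute[of T v ?w] by (rule H1_inner_lincomb[OF u v v \<open>T > 0\<close>])
  finally show ?thesis
    unfolding H1_inner_commute[of T v u] H1_inner_self[OF u] H1_inner_self[OF v]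
    by (simp add: power2_eq_square algebra_simps)
qed

lemma H1_inner_Cauchy_Schwarz:
  fixes u v :: "real \<Rightarrow> real ^ 'n"
  assumes u: "u \<in> H1 T" and v: "v \<in> H1 T" and "T > 0"
  shows "\<bar>H1_inner T u v\<bar> \<le> H1_norm T u * H1_norm T v"
proof -
  have "0 \<le> (H1_norm T u)\<^sup>2 + 2 * t * H1_inner T u v + t\<^sup>2 * (H1_norm T v)\<^sup>2" for t
    unfolding H1_norm_add_square[OF assms, symmetric] by simp
  from quadratic_nonneg_imp_discriminant[OF this]
  have "(H1_inner T u v)\<^sup>2 \<le> (H1_norm T u * H1_norm T v)\<^sup>2"
    by (simp add: power_mult_distrib)
  then show ?thesis
    unfolding abs_le_square_iff[symmetric] by (simp add: H1_norm_nonneg)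
qed

text \<open>Cauchy-Schwarz against the constant 1 on the interval between s and t. The modulus
  depends on u only through the norm of its rate, which gives equicontinuity of bounded
  families.\<close>

lemma L2_primitive_Hoelder:
  assumes u: "L2_primitive T u g" and "s \<in> {0..T}" "t \<in> {0..T}"
  shows "\<bar>u t - u s\<bar> \<le> sqrt \<bar>t - s\<bar> * L2_norm T g"
proof -
  have *: "\<bar>u t - u s\<bar> \<le> sqrt \<bar>t - s\<bar> * L2_norm T g" if st: "0 \<le> s" "s \<le> t" "t \<le> T" for s t
  proof -
    have g: "g \<in> L2 {0<..<T}" using u by (rule L2_primitive_L2)
    have "(u t - u s)\<^sup>2 \<le> (t - s) * integral {s..t} (\<lambda>x. (g x)\<^sup>2)"
      using L2_Cauchy_Schwarz_sub[OF L2_const[of 1] g, of s t] L2_primitive_increment[OF u st] st by simp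
    also have "integral {s..t} (\<lambda>x. (g x)\<^sup>2) \<le> integral {0..T} (\<lambda>x. (g x)\<^sup>2)"
      using st by (intro integral_subset_le L2_square_integrable_on[OF g]) auto
    also have "\<dots> = (L2_norm T g)\<^sup>2" by (simp add: L2_norm_square[OF g])
    finally have "(u t - u s)\<^sup>2 \<le> (sqrt \<bar>t - s\<bar> * L2_norm T g)\<^sup>2"
      using st by (simp add: power_mult_distrib mult_left_mono)
    then show ?thesis unfolding abs_le_square_iff[symmetric] by simp
  qed
  show ?thesis
    using *[of s t] *[of t s] assms by (cases "s \<le> t") (auto simp: abs_minus_commute)
qed

text \<open>No value of u is prescribed, so the bound of u t by a value u s plus the oscillation is
  averaged over s. The average contributes 1 / sqrt T, the oscillation sqrt T.\<close>

lemma H1_eval_le: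
  fixes u :: "real \<Rightarrow> real ^ 'n"
  assumes u: "u \<in> H1 T" and "T > 0" "t \<in> {0..T}"
  shows "\<bar>u t $ i\<bar> \<le> (1 / sqrt T + sqrt T) * H1_norm T u"
proof -
  let ?g = "\<lambda>t. weak_deriv {0<..<T} u t $ i"
  have p: "L2_primitive T (\<lambda>t. u t $ i) ?g" by (rule H1_component_primitive[OF u \<open>T > 0\<close>])
  have L: "(\<lambda>t. u t $ i) \<in> L2 {0<..<T}" by (rule H1_component_L2[OF u])
  have "\<bar>u t $ i\<bar> \<le> \<bar>u s $ i\<bar> + sqrt T * L2_norm T ?g" if s: "s \<in> {0..T}" for s
  proof -
    have "sqrt \<bar>t - s\<bar> * L2_norm T ?g \<le> sqrt T * L2_norm T ?g"
      using s assms(3) by (intro mult_right_mono) auto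
    then show ?thesis using L2_primitive_Hoelder[OF p s assms(3)] by linarith
  qed
  then have "integral {0..T} (\<lambda>s. \<bar>u t $ i\<bar>) \<le> integral {0..T} (\<lambda>s. \<bar>u s $ i\<bar> + sqrt T * L2_norm T ?g)"
    by (intro integral_le integrable_add integrable_const_ivl L2_integrable_sub[OF L2_abs[OF L]]) auto
  also have "\<dots> = integral {0..T} (\<lambda>s. \<bar>u s $ i\<bar>) + integral {0..T} (\<lambda>s. sqrt T * L2_norm T ?g)"
    by (intro integral_add integrable_const_ivl L2_integrable_sub[OF L2_abs[OF L]]) auto
  also have "\<dots> \<le> sqrt T * L2_norm T (\<lambda>s. u s $ i) + T * (sqrt T * L2_norm T ?g)"
    using integral_abs_le_L2[OF L] \<open>T > 0\<close> by simp
  also have "\<dots> \<le> sqrt T * H1_norm T u + T * (sqrt T * H1_norm T u)"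
    using H1_component_norm_le[OF u, of i] \<open>T > 0\<close> by (intro add_mono mult_left_mono) auto
  finally have "T * \<bar>u t $ i\<bar> \<le> sqrt T * H1_norm T u + T * (sqrt T * H1_norm T u)"
    using \<open>T > 0\<close> by simp
  also have "\<dots> = T * ((1 / sqrt T + sqrt T) * H1_norm T u)"
  proof -
    have "T * (1 / sqrt T) * H1_norm T u = sqrt T * H1_norm T u"
      using \<open>T > 0\<close> real_div_sqrt[of T] by simp
    then show ?thesis by (simp only: distrib_left distrib_right mult.assoc)
  qed
  finally show ?thesis using \<open>T > 0\<close> by simp
qed

section \<open>The scalar problems\<close>

text \<open>\<open>c\<close> is one component of the starting value of the history. That \<kappa>'
  is continuous is what \<open>W12_deriv_continuous\<close> supplies.\<close>

locale history_problem =
  fixes T \<alpha> c L :: real and \<kappa> \<kappa>' :: "real \<Rightarrow> real"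
  assumes T_pos: "T > 0" and alpha_pos: "\<alpha> > 0"
    and kappa_nonneg: "\<And>x. 0 \<le> \<kappa> x"
    and kappa_Lipschitz: "\<And>x y. \<bar>\<kappa> x - \<kappa> y\<bar> \<le> L * \<bar>x - y\<bar>"
    and kappa_deriv: "\<And>x. (\<kappa> has_real_derivative \<kappa>' x) (at x)"
    and kappa'_continuous: "continuous_on UNIV \<kappa>'"
begin

definition hist :: "(real \<Rightarrow> real) \<Rightarrow> real \<Rightarrow> real" where
  "hist q t = integral {0..t} q + c"

definition residual :: "(real \<Rightarrow> real) \<Rightarrow> (real \<Rightarrow> real) \<Rightarrow> real \<Rightarrow> real" where
  "residual l q t = l t - \<alpha> * q t - \<kappa> (hist q t)"

definition reg_solution ::
  "real \<Rightarrow> (real \<Rightarrow> real) \<Rightarrow> (real \<Rightarrow> real) \<Rightarrow> (real \<Rightarrow> real) \<Rightarrow> bool" where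
  "reg_solution e l q p \<longleftrightarrow> L2_primitive T q p \<and> q 0 = 0 \<and>
     (AE t in lebesgue_on {0<..<T}. e * p t = max 0 (residual l q t))"

text \<open>Complementarity form of the inclusion: the solution moves only where the residual is
  zero. As in the regularized problem, the rate is an argument because it is determined only up to
  null sets.\<close>

definition lim_solution :: "(real \<Rightarrow> real) \<Rightarrow> (real \<Rightarrow> real) \<Rightarrow> (real \<Rightarrow> real) \<Rightarrow> bool" where
  "lim_solution l q p \<longleftrightarrow> L2_primitive T q p \<and> q 0 = 0 \<and>
     (AE t in lebesgue_on {0<..<T}. 0 \<le> p t \<and> residual l q t \<le> 0 \<and> p t * residual l q t = 0)"

lemma L_nonneg: "0 \<le> L"
  using kappa_Lipschitz[of 1 0] abs_ge_zero[of "\<kappa> 1 - \<kappa> 0"] by simp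

lemma kappa'_bound: "\<bar>\<kappa>' x\<bar> \<le> L"
proof -
  have "((\<lambda>y. (\<kappa> y - \<kappa> x) / (y - x)) \<longlongrightarrow> \<kappa>' x) (at x)"
    using kappa_deriv[of x] by (simp add: has_field_derivative_iff)
  then have "((\<lambda>y. \<bar>(\<kappa> y - \<kappa> x) / (y - x)\<bar>) \<longlongrightarrow> \<bar>\<kappa>' x\<bar>) (at x)" by (rule tendsto_rabs)
  moreover have "\<forall>\<^sub>F y in at x. \<bar>(\<kappa> y - \<kappa> x) / (y - x)\<bar> \<le> L"
    unfolding eventually_at_filter
    by (intro always_eventually) (use kappa_Lipschitz in \<open>simp add: abs_divide divide_le_eq\<close>)
  ultimately show ?thesis by (rule tendsto_upperbound) simp
qed

text \<open>The derivative of \<kappa> along the history. The history is an integral of q, so q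
  appears and its rate does not, and the expression is continuous in time.\<close>

definition hist_rate :: "(real \<Rightarrow> real) \<Rightarrow> real \<Rightarrow> real" where
  "hist_rate q t = \<kappa>' (hist q t) * q t"

lemma hist_continuous: "continuous_on {0..T} q \<Longrightarrow> continuous_on {0..T} (hist q)"
  unfolding hist_def by (intro continuous_intros indefinite_integral_continuous_1 integrable_continuous_interval)

lemma hist_rate_continuous:
  assumes "continuous_on {0..T} q"
  shows "continuous_on {0..T} (hist_rate q)"
  unfolding hist_rate_def
  by (intro continuous_intros assms continuous_on_compose2[OF kappa'_continuous hist_continuous]) auto

lemma kappa_hist_primitive:
  assumes q: "continuous_on {0..T} q"
  shows "L2_primitive T (\<lambda>t. \<kappa> (hist q t)) (hist_rate q)"
proof (rule L2_primitive_C1[OF _ hist_rate_continuous[OF q]])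
  fix x assume "x \<in> {0..T}"
  then have "(hist q has_real_derivative q x) (at x within {0..T})"
    unfolding hist_def by (auto intro!: derivative_eq_intros integral_has_real_derivative q)
  from DERIV_chain2[OF kappa_deriv this]
  show "((\<lambda>t. \<kappa> (hist q t)) has_real_derivative hist_rate q x) (at x within {0..T})"
    by (simp add: hist_rate_def)
qed

lemma residual_primitive:
  assumes "L2_primitive T l l'" "L2_primitive T q p"
  shows "L2_primitive T (residual l q) (\<lambda>t. l' t - hist_rate q t - \<alpha> * p t)"
proof -
  have "L2_primitive T (\<lambda>t. 1 * (l t - \<kappa> (hist q t)) + - \<alpha> * q t)
      (\<lambda>t. 1 * (l' t - hist_rate q t) + - \<alpha> * p t)"
    using assms by (intro L2_primitive_lincomb L2_primitive_diff kappa_hist_primitive L2_primitive_continuous)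
  then show ?thesis by (simp add: residual_def[abs_def] algebra_simps)
qed

lemma primitive_mono:
  assumes q: "L2_primitive T q p" and p: "AE t in lebesgue_on {0<..<T}. 0 \<le> p t"
    and st: "0 \<le> s" "s \<le> t" "t \<le> T"
  shows "q s \<le> q t"
proof -
  have "integral {s..t} (\<lambda>x. 0) \<le> integral {s..t} p"
    by (rule integral_AE_mono[OF p]) (use st L2_integrable_sub[OF L2_primitive_L2[OF q]] in auto)
  then show ?thesis using L2_primitive_increment[OF q st] by simp
qed

lemma reg_solution_nonneg:
  assumes "reg_solution e l q p" "e > 0"
  shows "AE t in lebesgue_on {0<..<T}. 0 \<le> p t"
proof -
  have "AE t in lebesgue_on {0<..<T}. e * p t = max 0 (residual l q t)"
    using assms by (simp add: reg_solution_def)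
  then show ?thesis
  proof (rule eventually_mono)
    fix t assume "e * p t = max 0 (residual l q t)"
    then have "0 \<le> e * p t" by simp
    then show "0 \<le> p t" using \<open>e > 0\<close> by (simp add: zero_le_mult_iff)
  qed
qed

text \<open>Above the constant barrier M / \<alpha> the residual is nonpositive, since \<kappa> is
  nonnegative, and the solution stops moving. The bounds do not involve e.\<close>

lemma reg_solution_bounds:
  assumes q: "reg_solution e l q p" and "e > 0" and l: "\<And>t. t \<in> {0..T} \<Longrightarrow> l t \<le> M" and "0 \<le> M"
    and t: "t \<in> {0..T}"
  shows "0 \<le> q t" "q t \<le> M / \<alpha>"
proof -
  have qp: "L2_primitive T q p" "q 0 = 0" using q by (auto simp: reg_solution_def)
  show "0 \<le> q t" using primitive_mono[OF qp(1) reg_solution_nonneg[OF q \<open>e > 0\<close>], of 0 t] qp t by simp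
  have ae: "AE x in lebesgue_on {0<..<T}. e * p x = max 0 (residual l q x)"
    using q by (simp add: reg_solution_def)
  show "q t \<le> M / \<alpha>"
  proof (rule L2_primitive_comparison[OF qp(1) t, where b="\<lambda>_. M / \<alpha>"])
    show "q 0 \<le> M / \<alpha>" using qp \<open>0 \<le> M\<close> alpha_pos by simp
    have "AE x in lebesgue_on {0<..<T}. x \<in> {0<..<T}" by (rule AE_I2) simp
    with ae show "AE x in lebesgue_on {0<..<T}. x \<le> t \<and> M / \<alpha> < q x \<longrightarrow> p x = 0"
    proof (rule eventually_elim2, intro impI)
      fix x assume x: "e * p x = max 0 (residual l q x)" "x \<in> {0<..<T}" "x \<le> t \<and> M / \<alpha> < q x"
      have "M < \<alpha> * q x" using x(3) alpha_pos by (simp add: divide_less_eq mult.commute)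
      then have "residual l q x \<le> 0"
        using l[of x] x(2) kappa_nonneg[of "hist q x"] by (simp add: residual_def)
      then have "e * p x = 0" using x(1) by simp
      then show "p x = 0" using \<open>e > 0\<close> by simp
    qed
  qed auto
qed

text \<open>The equation identifies max 0 of the residual with e p. As an identity at every t it is
  used in two ways: nonnegativity of the left side bounds the rate, and dropping the quadratic term
  on the right bounds the residual.\<close>

lemma reg_solution_energy:
  assumes q: "reg_solution e l q p" and l: "L2_primitive T l l'" "l 0 = 0" and t: "t \<in> {0..T}"
  shows "(max 0 (residual l q t))\<^sup>2 / 2
      = e * (integral {0..t} (\<lambda>x. p x * (l' x - hist_rate q x)) - \<alpha> * integral {0..t} (\<lambda>x. (p x)\<^sup>2))"
proof -
  have qp: "L2_primitive T q p" "q 0 = 0" using q by (auto simp: reg_solution_def)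
  have p: "p \<in> L2 {0<..<T}" and l': "l' \<in> L2 {0<..<T}" using qp l by (auto simp: L2_primitive_def)
  have k': "hist_rate q \<in> L2 {0<..<T}"
    by (intro L2_continuous hist_rate_continuous L2_primitive_continuous[OF qp(1)])
  let ?G' = "\<lambda>t. l' t - hist_rate q t - \<alpha> * p t"
  have "(max 0 (residual l q t))\<^sup>2 / 2 - (max 0 (residual l q 0))\<^sup>2 / 2
      = integral {0..t} (\<lambda>x. max 0 (residual l q x) * ?G' x)"
  proof (rule L2_primitive_chain_rule[OF residual_primitive[OF l(1) qp(1)] t])
    show "((\<lambda>x. (max 0 x)\<^sup>2 / 2) has_real_derivative max 0 x) (at x)" for x :: real
      using DERIV_cdivide[OF has_real_derivative_pos_part_square[of x], of 2] by simp
  qed (intro continuous_intros)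
  also have "\<dots> = integral {0..t} (\<lambda>x. e * p x * ?G' x)"
  proof (rule integral_AE_cong[where T=T])
    have "AE x in lebesgue_on {0<..<T}. e * p x = max 0 (residual l q x)"
      using q by (simp add: reg_solution_def)
    then show "AE x in lebesgue_on {0<..<T}. max 0 (residual l q x) * ?G' x = e * p x * ?G' x"
      by (rule eventually_mono) simp
  qed (use t in auto)
  also have "\<dots> = integral {0..t} (\<lambda>x. e * (p x * (l' x - hist_rate q x) - \<alpha> * (p x)\<^sup>2))"
    by (simp add: power2_eq_square algebra_simps)
  also have "\<dots> = e * (integral {0..t} (\<lambda>x. p x * (l' x - hist_rate q x)) - \<alpha> * integral {0..t} (\<lambda>x. (p x)\<^sup>2))"
  proof -
    have "((\<lambda>x. e * (p x * (l' x - hist_rate q x) - \<alpha> * (p x)\<^sup>2)) has_integral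
      e * (integral {0..t} (\<lambda>x. p x * (l' x - hist_rate q x)) - \<alpha> * integral {0..t} (\<lambda>x. (p x)\<^sup>2))) {0..t}"
      using t by (intro has_integral_mult_right has_integral_diff integrable_integral
          L2_mult_integrable_sub[OF p L2_diff[OF l' k']] L2_square_integrable_on[OF p]) auto
    then show ?thesis by (rule integral_unique)
  qed
  \<comment> \<open>The residual at time 0 equals - \<kappa> c, so its positive part contributes
    nothing.\<close>
  finally show ?thesis using l(2) qp(2) kappa_nonneg by (simp add: residual_def)
qed

text \<open>The load is at most sqrt T * P, so q lies between 0 and sqrt T * P / \<alpha>; the
  history rate is at most L times this bound, and its L2 norm costs another sqrt T. Adding the norm
  P of l' and dividing by \<alpha> gives a bound on the rate that is independent of e.\<close>

definition rate_bound :: "real \<Rightarrow> real" where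
  "rate_bound P = (P + L * (sqrt T * P / \<alpha>) * sqrt T) / \<alpha>"

lemma
  assumes q: "reg_solution e l q p" and e: "e > 0"
    and l: "L2_primitive T l l'" "l 0 = 0" and P: "L2_norm T l' \<le> P"
  shows reg_solution_rate: "L2_norm T p \<le> rate_bound P"
    and reg_solution_residual: "\<And>t. t \<in> {0..T} \<Longrightarrow> residual l q t \<le> sqrt (2 * e * \<alpha>) * rate_bound P"
proof -
  have qp: "L2_primitive T q p" "q 0 = 0" using q by (auto simp: reg_solution_def)
  have p: "p \<in> L2 {0<..<T}" and l': "l' \<in> L2 {0<..<T}" using qp l by (auto simp: L2_primitive_def)
  have qc: "continuous_on {0..T} q" by (rule L2_primitive_continuous[OF qp(1)])
  have k': "hist_rate q \<in> L2 {0<..<T}"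
    by (intro L2_continuous hist_rate_continuous qc)
  let ?h = "\<lambda>x. l' x - hist_rate q x"
  have h: "?h \<in> L2 {0<..<T}" by (rule L2_diff[OF l' k'])
  have P0: "0 \<le> P" using P L2_norm_nonneg[of T l'] by linarith
  let ?B = "sqrt T * P / \<alpha>"
  have B: "0 \<le> ?B" using P0 T_pos alpha_pos by simp
  have l_le: "l t \<le> sqrt T * P" if "t \<in> {0..T}" for t
  proof -
    have "\<bar>l t - l 0\<bar> \<le> sqrt \<bar>t - 0\<bar> * L2_norm T l'"
      using that T_pos by (intro L2_primitive_Hoelder[OF l(1)]) auto
    also have "\<dots> \<le> sqrt T * P" using that P T_pos by (intro mult_mono) auto
    finally show ?thesis using l(2) by simp
  qed
  have q_bd: "0 \<le> q t" "q t \<le> ?B" if "t \<in> {0..T}" for t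
    using reg_solution_bounds[OF q e l_le _ that] P0 T_pos by auto
  have "L2_norm T (hist_rate q) \<le> L2_norm T (\<lambda>_. L * ?B)"
  proof (rule L2_norm_mono[OF k' L2_const])
    fix t assume "t \<in> {0..T}"
    then show "\<bar>hist_rate q t\<bar> \<le> L * ?B"
      unfolding hist_rate_def abs_mult using q_bd[of t] kappa'_bound L_nonneg
      by (intro mult_mono) auto
  qed
  also have "\<dots> = L * ?B * sqrt T"
    using mult_nonneg_nonneg[OF L_nonneg B] T_pos by (intro L2_norm_const) simp_all
  finally have "L2_norm T ?h \<le> P + L * ?B * sqrt T"
    using L2_norm_diff_triangle[OF l' k'] P by linarith
  then have h_le: "L2_norm T ?h \<le> \<alpha> * rate_bound P"
    using alpha_pos by (simp add: rate_bound_def)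
  have en: "(max 0 (residual l q t))\<^sup>2 / 2
      = e * (integral {0..t} (\<lambda>x. p x * ?h x) - \<alpha> * integral {0..t} (\<lambda>x. (p x)\<^sup>2))" if "t \<in> {0..T}" for t
    by (rule reg_solution_energy[OF q l that])
  have "0 \<le> e * (integral {0..T} (\<lambda>x. p x * ?h x) - \<alpha> * integral {0..T} (\<lambda>x. (p x)\<^sup>2))"
    using en[of T] T_pos zero_le_power2[of "max 0 (residual l q T)"] by simp
  then have "\<alpha> * (L2_norm T p)\<^sup>2 \<le> integral {0..T} (\<lambda>x. p x * ?h x)"
    using e by (simp add: zero_le_mult_iff L2_norm_square[OF p])
  also have "\<dots> \<le> L2_norm T p * L2_norm T ?h" using L2_Cauchy_Schwarz[OF p h] by linarith
  also have "\<dots> \<le> L2_norm T p * (\<alpha> * rate_bound P)" using h_le by (intro mult_left_mono) auto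
  \<comment> \<open>The common factor is cancelled afterwards; if the norm of p vanishes, the claim
    is the nonnegativity of \<open>rate_bound P\<close>.\<close>
  finally have "(\<alpha> * L2_norm T p) * L2_norm T p \<le> (\<alpha> * L2_norm T p) * rate_bound P"
    by (simp add: power2_eq_square algebra_simps)
  moreover have rb: "0 \<le> rate_bound P" using h_le L2_norm_nonneg[of T ?h] alpha_pos
    by (meson order_trans zero_le_mult_iff not_less_iff_gr_or_eq linorder_not_less)
  ultimately show rate: "L2_norm T p \<le> rate_bound P"
    using alpha_pos L2_norm_nonneg[of T p]
    by (cases "L2_norm T p = 0") (auto simp: mult_le_cancel_left)
  fix t assume t: "t \<in> {0..T}"
  have ph: "(\<lambda>x. \<bar>p x\<bar> * \<bar>?h x\<bar>) integrable_on {s..r}" if "0 \<le> s" "r \<le> T" for s r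
    by (rule L2_mult_integrable_sub[OF L2_abs[OF p] L2_abs[OF h] that])
  \<comment> \<open>The integrand has no sign, so absolute values are taken before the interval is
    enlarged to the whole of \<open>{0..T}\<close>.\<close>
  have "integral {0..t} (\<lambda>x. p x * ?h x) \<le> integral {0..t} (\<lambda>x. \<bar>p x\<bar> * \<bar>?h x\<bar>)"
    using t by (intro integral_le ph L2_mult_integrable_sub[OF p h]) (auto simp: abs_mult[symmetric])
  also have "\<dots> \<le> integral {0..T} (\<lambda>x. \<bar>p x\<bar> * \<bar>?h x\<bar>)"
    using t by (intro integral_subset_le ph) auto
  also have "\<dots> \<le> L2_norm T (\<lambda>x. \<bar>p x\<bar>) * L2_norm T (\<lambda>x. \<bar>?h x\<bar>)"
    using L2_Cauchy_Schwarz[OF L2_abs[OF p] L2_abs[OF h]] by linarith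
  also have "\<dots> = L2_norm T p * L2_norm T ?h" by (simp add: L2_norm_def)
  also have "\<dots> \<le> rate_bound P * (\<alpha> * rate_bound P)"
    using rate h_le rb by (intro mult_mono) auto
  finally have *: "integral {0..t} (\<lambda>x. p x * ?h x) \<le> \<alpha> * (rate_bound P)\<^sup>2"
    by (simp add: power2_eq_square algebra_simps)
  have sq: "0 \<le> integral {0..t} (\<lambda>x. (p x)\<^sup>2)"
    using t by (intro Henstock_Kurzweil_Integration.integral_nonneg L2_square_integrable_on[OF p]) auto
  have "0 \<le> \<alpha> * integral {0..t} (\<lambda>x. (p x)\<^sup>2)" using sq alpha_pos by simp
  then have "(max 0 (residual l q t))\<^sup>2 / 2 \<le> e * (\<alpha> * (rate_bound P)\<^sup>2)"
    unfolding en[OF t] using * e by (intro mult_left_mono) linarith+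
  then have "(max 0 (residual l q t))\<^sup>2 \<le> (sqrt (2 * e * \<alpha>) * rate_bound P)\<^sup>2"
    using e alpha_pos by (simp add: power_mult_distrib)
  then have "max 0 (residual l q t) \<le> sqrt (2 * e * \<alpha>) * rate_bound P"
    by (rule power2_le_imp_le) (use rb e alpha_pos in simp)
  then show "residual l q t \<le> sqrt (2 * e * \<alpha>) * rate_bound P" by simp
qed

text \<open>Comparison in the maximum norm: both problems are order preserving and commute with adding
  constants, so only the difference of the data and of the history terms, and the positive part of
  the regularized residual, enter.\<close>

lemma reg_solution_distance:
  assumes qe: "reg_solution e le qe pe" and e: "e > 0" and q: "lim_solution l q p"
    and l: "\<And>t. t \<in> {0..T} \<Longrightarrow> \<bar>le t - l t\<bar> \<le> \<delta>" and "0 \<le> \<delta>" "0 \<le> \<mu>"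
    and res: "\<And>t. t \<in> {0..T} \<Longrightarrow> residual le qe t \<le> \<mu>"
    and t: "t \<in> {0..T}"
  shows "\<bar>qe t - q t\<bar> \<le> (\<delta> + \<mu>) / \<alpha> * exp (L / \<alpha> * t)"
proof (rule Gronwall[OF _ _ _ _ t])
  have qp: "L2_primitive T q p" "q 0 = 0" and qep: "L2_primitive T qe pe" "qe 0 = 0"
    using q qe by (auto simp: lim_solution_def reg_solution_def)
  have qc: "continuous_on {0..T} q" "continuous_on {0..T} qe"
    using qp qep by (auto intro: L2_primitive_continuous)
  show dc: "continuous_on {0..T} (\<lambda>t. \<bar>qe t - q t\<bar>)" by (intro continuous_intros qc)
  show "0 \<le> (\<delta> + \<mu>) / \<alpha>" "0 \<le> L / \<alpha>" using assms alpha_pos L_nonneg by auto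
  have p0: "AE t in lebesgue_on {0<..<T}. 0 \<le> p t"
    using q unfolding lim_solution_def by (auto elim: eventually_mono)
  have qmono: "q s \<le> q r" if "0 \<le> s" "s \<le> r" "r \<le> T" for s r
    by (rule primitive_mono[OF qp(1) p0 that])
  have qemono: "qe s \<le> qe r" if "0 \<le> s" "s \<le> r" "r \<le> T" for s r
    by (rule primitive_mono[OF qep(1) reg_solution_nonneg[OF qe e] that])
  fix \<tau> assume \<tau>: "\<tau> \<in> {0..T}"
  define J where "J = integral {0..\<tau>} (\<lambda>t. \<bar>qe t - q t\<bar>)"
  have dint: "(\<lambda>t. \<bar>qe t - q t\<bar>) integrable_on {s..r}" if "0 \<le> s" "r \<le> T" for s r
    by (rule integrable_continuous_interval[OF continuous_on_subset[OF dc]]) (use that in auto)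
  have hist: "\<bar>\<kappa> (hist qe s) - \<kappa> (hist q s)\<bar> \<le> L * J" if s: "0 \<le> s" "s \<le> \<tau>" for s
  proof -
    have cs: "continuous_on {0..s} qe" "continuous_on {0..s} q"
      using qc s \<tau> by (auto intro: continuous_on_subset)
    have "hist qe s - hist q s = integral {0..s} (\<lambda>t. qe t - q t)"
      unfolding hist_def using cs by (simp add: integral_diff integrable_continuous_interval)
    also have "norm \<dots> \<le> integral {0..s} (\<lambda>t. \<bar>qe t - q t\<bar>)"
      using cs s \<tau> by (intro integral_norm_bound_integral dint integrable_continuous_interval continuous_intros) auto
    also have "\<dots> \<le> J" unfolding J_def using s \<tau> by (intro integral_subset_le dint) auto
    finally have "L * \<bar>hist qe s - hist q s\<bar> \<le> L * J" using L_nonneg by (intro mult_left_mono) auto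
    then show ?thesis using kappa_Lipschitz[of "hist qe s" "hist q s"] by linarith
  qed
  have J: "0 \<le> J" unfolding J_def using \<tau> by (intro Henstock_Kurzweil_Integration.integral_nonneg dint) auto
  \<comment> \<open>Shifting a solution up by C lowers its residual by \<alpha> C, which exactly
    compensates the load error \<delta> and the history error L J up to time \<tau>.\<close>
  define C where "C = (\<delta> + L * J) / \<alpha>"
  have C: "0 \<le> C" "\<alpha> * C = \<delta> + L * J" using J L_nonneg alpha_pos \<open>0 \<le> \<delta>\<close> by (auto simp: C_def)
  have ae: "AE x in lebesgue_on {0<..<T}. x \<in> {0<..<T}
      \<and> e * pe x = max 0 (residual le qe x)
      \<and> residual l q x \<le> 0 \<and> p x * residual l q x = 0"
    using q qe AE_I2[of "lebesgue_on {0<..<T}" "\<lambda>x. x \<in> {0<..<T}"]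
    unfolding lim_solution_def reg_solution_def by simp
  have "qe \<tau> \<le> q \<tau> + C"
  proof (rule L2_primitive_comparison[OF qep(1) \<tau>])
    show "qe 0 \<le> q 0 + C" using qp qep C by simp
    show "continuous_on {0..\<tau>} (\<lambda>t. q t + C)"
      using qc \<tau> by (intro continuous_intros) (auto intro: continuous_on_subset)
    show "q s + C \<le> q r + C" if "0 \<le> s" "s \<le> r" "r \<le> \<tau>" for s r
      using qmono[of s r] that \<tau> by simp
    from ae show "AE x in lebesgue_on {0<..<T}. x \<le> \<tau> \<and> q x + C < qe x \<longrightarrow> pe x = 0"
    proof (rule eventually_mono, intro impI)
      fix x assume x: "x \<in> {0<..<T} \<and> e * pe x = max 0 (residual le qe x)
          \<and> residual l q x \<le> 0 \<and> p x * residual l q x = 0" "x \<le> \<tau> \<and> q x + C < qe x"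
      have "\<alpha> * (q x + C) < \<alpha> * qe x" using x alpha_pos by (intro mult_strict_left_mono) auto
      then have "residual le qe x \<le> residual l q x"
        using l[of x] hist[of x] x C(2) by (simp add: residual_def abs_le_iff distrib_left)
      then have "e * pe x = 0" using x by simp
      then show "pe x = 0" using e by simp
    qed
  qed
  \<comment> \<open>Complementarity forces p to vanish only where the residual of q is strictly
    negative. The residual of qe can be as large as \<mu>, hence the additional shift by \<mu> /
    \<alpha>.\<close>
  moreover have "q \<tau> \<le> qe \<tau> + (C + \<mu> / \<alpha>)"
  proof (rule L2_primitive_comparison[OF qp(1) \<tau>])
    show "q 0 \<le> qe 0 + (C + \<mu> / \<alpha>)" using qp qep C \<open>0 \<le> \<mu>\<close> alpha_pos by simp
    show "continuous_on {0..\<tau>} (\<lambda>t. qe t + (C + \<mu> / \<alpha>))"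
      using qc \<tau> by (intro continuous_intros) (auto intro: continuous_on_subset)
    show "qe s + (C + \<mu> / \<alpha>) \<le> qe r + (C + \<mu> / \<alpha>)" if "0 \<le> s" "s \<le> r" "r \<le> \<tau>" for s r
      using qemono[of s r] that \<tau> by simp
    from ae show "AE x in lebesgue_on {0<..<T}. x \<le> \<tau> \<and> qe x + (C + \<mu> / \<alpha>) < q x \<longrightarrow> p x = 0"
    proof (rule eventually_mono, intro impI)
      fix x assume x: "x \<in> {0<..<T} \<and> e * pe x = max 0 (residual le qe x)
          \<and> residual l q x \<le> 0 \<and> p x * residual l q x = 0" "x \<le> \<tau> \<and> qe x + (C + \<mu> / \<alpha>) < q x"
      have "\<alpha> * (qe x + (C + \<mu> / \<alpha>)) < \<alpha> * q x" using x alpha_pos by (intro mult_strict_left_mono) auto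
      moreover have "\<alpha> * (qe x + (C + \<mu> / \<alpha>)) = \<alpha> * qe x + \<alpha> * C + \<mu>"
        using alpha_pos by (simp add: distrib_left)
      ultimately have "residual l q x < residual le qe x - \<mu>"
        using l[of x] hist[of x] x C(2) unfolding residual_def abs_le_iff by auto
      then have "residual l q x < 0" using res[of x] x by simp
      then show "p x = 0" using x by simp
    qed
  qed
  moreover have "0 \<le> \<mu> / \<alpha>" using \<open>0 \<le> \<mu>\<close> alpha_pos by simp
  ultimately have "\<bar>qe \<tau> - q \<tau>\<bar> \<le> C + \<mu> / \<alpha>" by (simp add: abs_le_iff)
  also have "\<dots> = (\<delta> + \<mu>) / \<alpha> + L / \<alpha> * J" by (simp add: C_def add_divide_distrib)
  finally show "\<bar>qe \<tau> - q \<tau>\<bar> \<le> (\<delta> + \<mu>) / \<alpha> + L / \<alpha> * integral {0..\<tau>} (\<lambda>t. \<bar>qe t - q t\<bar>)"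
    by (simp add: J_def)
qed

end

section \<open>Strong and weak limits in L2 along a filter\<close>

lemma L2_norm_uniform_tendsto_0:
  fixes f :: "'b \<Rightarrow> real \<Rightarrow> real"
  assumes f: "uniform_limit {0..T} f g F" and L2: "\<forall>\<^sub>F x in F. f x \<in> L2 {0<..<T}" and g: "g \<in> L2 {0<..<T}"
    and "T > 0"
  shows "((\<lambda>x. L2_norm T (\<lambda>t. f x t - g t)) \<longlongrightarrow> 0) F"
proof (rule tendstoI)
  fix \<eta> :: real assume "\<eta> > 0"
  define \<delta> where "\<delta> = \<eta> / (2 * sqrt T)"
  have "\<delta> > 0" using \<open>\<eta> > 0\<close> \<open>T > 0\<close> by (simp add: \<delta>_def)
  from uniform_limitD[OF f this] L2
  show "\<forall>\<^sub>F x in F. dist (L2_norm T (\<lambda>t. f x t - g t)) 0 < \<eta>"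
  proof (rule eventually_elim2)
    fix x assume x: "\<forall>t\<in>{0..T}. dist (f x t) (g t) < \<delta>" "f x \<in> L2 {0<..<T}"
    have "L2_norm T (\<lambda>t. f x t - g t) \<le> L2_norm T (\<lambda>_. \<delta>)"
      by (rule L2_norm_mono[OF L2_diff[OF x(2) g] L2_const]) (use x(1) in \<open>auto simp: dist_real_def intro: less_imp_le\<close>)
    also have "\<dots> = \<delta> * sqrt T" using \<open>\<delta> > 0\<close> \<open>T > 0\<close> by (intro L2_norm_const) auto
    also have "\<dots> < \<eta>" using \<open>\<eta> > 0\<close> \<open>T > 0\<close> by (simp add: \<delta>_def)
    finally show "dist (L2_norm T (\<lambda>t. f x t - g t)) 0 < \<eta>" by (simp add: dist_real_def)
  qed
qed

lemma L2_pairing_tendsto: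
  fixes g v :: "real \<Rightarrow> real"
  assumes f: "\<forall>\<^sub>F x in F. f x \<in> L2 {0<..<T}" and "g \<in> L2 {0<..<T}" "v \<in> L2 {0<..<T}"
    and lim: "((\<lambda>x. integral {0..T} (\<lambda>t. (f x t - g t) * v t)) \<longlongrightarrow> 0) F"
  shows "((\<lambda>x. integral {0..T} (\<lambda>t. f x t * v t)) \<longlongrightarrow> integral {0..T} (\<lambda>t. g t * v t)) F"
proof (rule LIM_zero_cancel, rule Lim_transform_eventually[OF lim])
  show "\<forall>\<^sub>F x in F. integral {0..T} (\<lambda>t. (f x t - g t) * v t)
      = integral {0..T} (\<lambda>t. f x t * v t) - integral {0..T} (\<lambda>t. g t * v t)"
    using f by (rule eventually_mono) (intro L2_pairing_diff assms)
qed

lemma L2_pairing_tendsto_strong: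
  assumes f: "\<forall>\<^sub>F x in F. f x \<in> L2 {0<..<T}" and g: "g \<in> L2 {0<..<T}" and v: "v \<in> L2 {0<..<T}"
    and lim: "((\<lambda>x. L2_norm T (\<lambda>t. f x t - g t)) \<longlongrightarrow> 0) F"
  shows "((\<lambda>x. integral {0..T} (\<lambda>t. f x t * v t)) \<longlongrightarrow> integral {0..T} (\<lambda>t. g t * v t)) F"
proof (rule L2_pairing_tendsto[OF f g v], rule Lim_null_comparison[OF _ tendsto_mult_left_zero[OF lim]])
  show "\<forall>\<^sub>F x in F. norm (integral {0..T} (\<lambda>t. (f x t - g t) * v t))
      \<le> L2_norm T (\<lambda>t. f x t - g t) * L2_norm T v"
    using f by (rule eventually_mono) (unfold real_norm_def, intro L2_Cauchy_Schwarz L2_diff g v)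
qed

text \<open>Uniformly small primitives with bounded rates have rates tending weakly to 0. The norm
  bound pays for \<eta> times the norm; the constant C, known once \<eta> is fixed, then determines
  how small the primitives must be.\<close>

lemma L2_pairing_tendsto_0:
  fixes d d' :: "'b \<Rightarrow> real \<Rightarrow> real"
  assumes v: "v \<in> L2 {0<..<T}" and "T > 0"
    and prim: "\<forall>\<^sub>F x in F. L2_primitive T (d x) (d' x) \<and> d x 0 = 0"
    and bound: "\<forall>\<^sub>F x in F. L2_norm T (d' x) \<le> P"
    and unif: "uniform_limit {0..T} d (\<lambda>_. 0) F"
  shows "((\<lambda>x. integral {0..T} (\<lambda>t. d' x t * v t)) \<longlongrightarrow> 0) F"
proof (rule tendstoI)
  fix e :: real assume "e > 0"
  \<comment> \<open>Each of the two error terms is allotted e/4; |P| + 1 keeps the denominator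
    positive for any real P.\<close>
  define \<eta> where "\<eta> = e / (4 * (\<bar>P\<bar> + 1))"
  have "\<eta> > 0" using \<open>e > 0\<close> by (simp add: \<eta>_def add_nonneg_pos)
  obtain C where C: "C \<ge> 0"
    "\<And>f K. f \<in> L2 {0<..<T} \<Longrightarrow> (\<forall>t\<in>{0..T}. \<bar>integral {0..t} f\<bar> \<le> K)
        \<Longrightarrow> \<bar>integral {0..T} (\<lambda>x. f x * v x)\<bar> \<le> \<eta> * L2_norm T f + C * K"
    by (rule L2_pairing_le[OF v \<open>\<eta> > 0\<close> \<open>T > 0\<close>]) (rule that, assumption, blast)
  define K where "K = e / (4 * (C + 1))"
  have "K > 0" using \<open>e > 0\<close> C by (simp add: K_def)
  from eventually_conj[OF prim eventually_conj[OF bound uniform_limitD[OF unif this]]]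
  show "\<forall>\<^sub>F x in F. dist (integral {0..T} (\<lambda>t. d' x t * v t)) 0 < e"
  proof (rule eventually_mono)
    fix x assume x: "(L2_primitive T (d x) (d' x) \<and> d x 0 = 0) \<and> L2_norm T (d' x) \<le> P
      \<and> (\<forall>t\<in>{0..T}. dist (d x t) 0 < K)"
    have "\<bar>integral {0..t} (d' x)\<bar> \<le> K" if "t \<in> {0..T}" for t
      using x that by (auto simp: L2_primitive_def dist_real_def intro: less_imp_le)
    then have "\<bar>integral {0..T} (\<lambda>t. d' x t * v t)\<bar> \<le> \<eta> * L2_norm T (d' x) + C * K"
      using x by (intro C) (auto simp: L2_primitive_def)
    also have "\<eta> * L2_norm T (d' x) \<le> \<eta> * (\<bar>P\<bar> + 1)"
      using x \<open>\<eta> > 0\<close> by (intro mult_left_mono) auto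
    also have "\<eta> * (\<bar>P\<bar> + 1) = e / 4" by (simp add: \<eta>_def field_simps add_nonneg_eq_0_iff)
    also have "C * K \<le> e / 4" using C \<open>e > 0\<close> by (simp add: K_def field_simps)
    finally show "dist (integral {0..T} (\<lambda>t. d' x t * v t)) 0 < e"
      using \<open>e > 0\<close> by (simp add: dist_real_def)
  qed
qed

section \<open>The limit of the scalar regularized problems\<close>

context history_problem
begin

lemma reg_solution_uniform_limit:
  fixes F :: "'b filter"
  assumes eps: "(eps \<longlongrightarrow> 0) F" and eps_pos: "\<forall>\<^sub>F x in F. eps x > 0"
    and q: "lim_solution l q p" and l: "uniform_limit {0..T} le l F"
    and reg: "\<forall>\<^sub>F x in F. reg_solution (eps x) (le x) (qe x) (pe x)"
    and le: "\<forall>\<^sub>F x in F. L2_primitive T (le x) (le' x) \<and> le x 0 = 0 \<and> L2_norm T (le' x) \<le> P"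
    and "0 \<le> P"
  shows "uniform_limit {0..T} qe q F"
proof (rule uniform_limitI)
  fix e :: real assume "e > 0"
  define E where "E = exp (L / \<alpha> * T)"
  have E: "E > 0" by (simp add: E_def)
  \<comment> \<open>The same \<delta> bounds the load error and the residual in the distance
    estimate; with the exponential bounded by E this gives 2 \<delta> E / \<alpha> = e/2.\<close>
  define \<delta> where "\<delta> = e * \<alpha> / (4 * E)"
  have \<delta>: "\<delta> > 0" using \<open>e > 0\<close> alpha_pos E by (simp add: \<delta>_def)
  have rb: "0 \<le> rate_bound P" using \<open>0 \<le> P\<close> alpha_pos T_pos L_nonneg by (simp add: rate_bound_def)
  have "((\<lambda>x. sqrt (2 * eps x * \<alpha>) * rate_bound P) \<longlongrightarrow> sqrt (2 * 0 * \<alpha>) * rate_bound P) F"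
    by (intro tendsto_intros eps)
  then have "\<forall>\<^sub>F x in F. sqrt (2 * eps x * \<alpha>) * rate_bound P < \<delta>"
    using \<delta> by (intro order_tendstoD(2)) auto
  from eventually_conj[OF this eventually_conj[OF uniform_limitD[OF l \<delta>]
        eventually_conj[OF reg eventually_conj[OF le eps_pos]]]]
  show "\<forall>\<^sub>F x in F. \<forall>t\<in>{0..T}. dist (qe x t) (q t) < e"
  proof (rule eventually_mono, intro ballI)
    fix x t
    assume x: "sqrt (2 * eps x * \<alpha>) * rate_bound P < \<delta> \<and> (\<forall>t\<in>{0..T}. dist (le x t) (l t) < \<delta>) \<and>
        reg_solution (eps x) (le x) (qe x) (pe x) \<and>
        (L2_primitive T (le x) (le' x) \<and> le x 0 = 0 \<and> L2_norm T (le' x) \<le> P) \<and> 0 < eps x"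
      and t: "t \<in> {0..T}"
    have "\<bar>qe x t - q t\<bar> \<le> (\<delta> + \<delta>) / \<alpha> * exp (L / \<alpha> * t)"
    proof (rule reg_solution_distance[where e="eps x" and pe="pe x", OF _ _ q _ _ _ _ t])
      show "\<bar>le x t - l t\<bar> \<le> \<delta>" if "t \<in> {0..T}" for t
        using x that by (auto simp: dist_real_def intro: less_imp_le)
      show "residual (le x) (qe x) t \<le> \<delta>" if "t \<in> {0..T}" for t
        using reg_solution_residual[of "eps x" "le x" "qe x" "pe x" "le' x" P t] x that by linarith
    qed (use x \<delta> in auto)
    also have "\<dots> \<le> (\<delta> + \<delta>) / \<alpha> * E"
      unfolding E_def using t alpha_pos L_nonneg \<delta> by (intro mult_left_mono) (auto intro!: divide_right_mono mult_left_mono)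
    also have "\<dots> = e / 2" using alpha_pos E by (simp add: \<delta>_def)
    finally show "dist (qe x t) (q t) < e" using \<open>e > 0\<close> by (simp add: dist_real_def)
  qed
qed

text \<open>Write h for l' minus the history rate of q, and expand \<alpha> times the squared
  distance of pe and p. The energy inequality replaces the square of pe by its pairing with the
  regularized counterpart of h, and passing to h costs an error that vanishes strongly. By the limit
  energy equality, what remains is exactly the pairing of pe - p with the fixed function h - 2
  \<alpha> p, which tends to 0 by weak convergence of the rates.\<close>

lemma reg_solution_strong_limit:
  fixes F :: "'b filter"
  assumes eps_pos: "\<forall>\<^sub>F x in F. eps x > 0"
    and q: "lim_solution l q p" and l: "L2_primitive T l l'"
    and reg: "\<forall>\<^sub>F x in F. reg_solution (eps x) (le x) (qe x) (pe x)"
    and le: "\<forall>\<^sub>F x in F. L2_primitive T (le x) (le' x) \<and> le x 0 = 0 \<and> L2_norm T (le' x) \<le> P"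
    and unif: "uniform_limit {0..T} qe q F"
    and strong: "((\<lambda>x. L2_norm T (\<lambda>t. le' x t - l' t)) \<longlongrightarrow> 0) F"
  shows "((\<lambda>x. L2_norm T (\<lambda>t. pe x t - p t)) \<longlongrightarrow> 0) F"
proof -
  have qp: "L2_primitive T q p" "q 0 = 0" using q by (auto simp: lim_solution_def)
  have p: "p \<in> L2 {0<..<T}" and l': "l' \<in> L2 {0<..<T}" using qp l by (auto simp: L2_primitive_def)
  have qc: "continuous_on {0..T} q" by (rule L2_primitive_continuous[OF qp(1)])
  have k'c: "continuous_on {0..T} (hist_rate q)" by (rule hist_rate_continuous[OF qc])
  have k': "hist_rate q \<in> L2 {0<..<T}" by (rule L2_continuous[OF k'c])
  let ?h = "\<lambda>t. l' t - hist_rate q t"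
  let ?he = "\<lambda>x t. le' x t - hist_rate (qe x) t"
  have h: "?h \<in> L2 {0<..<T}" by (rule L2_diff[OF l' k'])
  have qe_prim: "\<forall>\<^sub>F x in F. L2_primitive T (qe x) (pe x) \<and> qe x 0 = 0"
    using reg by (rule eventually_mono) (simp add: reg_solution_def)
  have pe_bound: "\<forall>\<^sub>F x in F. L2_norm T (pe x) \<le> rate_bound P"
    using eventually_conj[OF reg eventually_conj[OF le eps_pos]]
    by (rule eventually_mono) (blast intro: reg_solution_rate)

  have "uniform_limit {0..T} (\<lambda>x. hist_rate (qe x)) (hist_rate q) F"
  proof -
    obtain B where B: "\<And>t. t \<in> {0..T} \<Longrightarrow> \<bar>q t\<bar> \<le> B"
      using continuous_on_interval_bound[OF qc] by auto
    obtain R where R: "\<And>t. t \<in> {0..T} \<Longrightarrow> \<bar>hist q t\<bar> \<le> R"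
      using continuous_on_interval_bound[OF hist_continuous[OF qc]] by auto
    \<comment> \<open>Uniform continuity of \<kappa>' is available on compact sets; the margin 1
      leaves space for the histories of the approximations.\<close>
    have "uniformly_continuous_on {- (R + 1)..R + 1} \<kappa>'"
      by (intro compact_uniformly_continuous continuous_on_subset[OF kappa'_continuous]) auto
    note uc = this[unfolded uniformly_continuous_on_def]
    show ?thesis
    proof (rule uniform_limitI)
      fix e :: real assume "e > 0"
      define e1 where "e1 = e / (2 * (\<bar>B\<bar> + 1))"
      have e1: "e1 > 0" using \<open>e > 0\<close> by (simp add: e1_def add_nonneg_pos)
      then obtain d where d: "d > 0"
        "\<And>y z. y \<in> {- (R + 1)..R + 1} \<Longrightarrow> z \<in> {- (R + 1)..R + 1} \<Longrightarrow> dist y z < d \<Longrightarrow> dist (\<kappa>' y) (\<kappa>' z) < e1"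
        using uc by metis
      \<comment> \<open>The first bound moves histories by at most half of min d 1, so they stay in
        the compact interval and within d; the second controls the factor q itself, multiplied by
        \<kappa>'.\<close>
      define \<delta> where "\<delta> = min (min d 1 / (2 * T)) (e / (4 * (L + 1)))"
      have \<delta>: "\<delta> > 0" using d T_pos \<open>e > 0\<close> L_nonneg by (simp add: \<delta>_def)
      from eventually_conj[OF uniform_limitD[OF unif \<delta>] qe_prim]
      show "\<forall>\<^sub>F x in F. \<forall>t\<in>{0..T}. dist (hist_rate (qe x) t) (hist_rate q t) < e"
      proof (rule eventually_mono, intro ballI)
        fix x t assume x: "(\<forall>t\<in>{0..T}. dist (qe x t) (q t) < \<delta>) \<and> L2_primitive T (qe x) (pe x) \<and> qe x 0 = 0"
          and t: "t \<in> {0..T}"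
        have qxc: "continuous_on {0..T} (qe x)" using x by (blast intro: L2_primitive_continuous)
        have close: "\<bar>qe x s - q s\<bar> \<le> \<delta>" if "s \<in> {0..T}" for s
          using x that by (auto simp: dist_real_def intro: less_imp_le)
        have cs: "continuous_on {0..t} (qe x)" "continuous_on {0..t} q"
          using qc qxc t by (auto intro: continuous_on_subset)
        have "hist (qe x) t - hist q t = integral {0..t} (\<lambda>s. qe x s - q s)"
          unfolding hist_def using cs by (simp add: integral_diff integrable_continuous_interval)
        also have "norm \<dots> \<le> integral {0..t} (\<lambda>s. \<delta>)"
          using cs t close
          by (intro integral_norm_bound_integral integrable_continuous_interval continuous_intros) auto
        also have "\<dots> \<le> T * \<delta>" using t \<delta> by simp
        also have "\<dots> \<le> T * (min d 1 / (2 * T))" unfolding \<delta>_def using T_pos by (intro mult_left_mono) auto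
        also have "\<dots> = min d 1 / 2" using T_pos by simp
        finally have hd: "\<bar>hist (qe x) t - hist q t\<bar> \<le> min d 1 / 2" by simp
        then have "\<bar>hist (qe x) t - hist q t\<bar> < d" "\<bar>hist (qe x) t - hist q t\<bar> < 1" using d(1) by auto
        then have "dist (\<kappa>' (hist (qe x) t)) (\<kappa>' (hist q t)) < e1"
          using R[OF t] by (intro d(2)) (auto simp: dist_real_def abs_le_iff abs_less_iff)
        then have 1: "\<bar>\<kappa>' (hist (qe x) t) - \<kappa>' (hist q t)\<bar> * \<bar>q t\<bar> \<le> e1 * (\<bar>B\<bar> + 1)"
          using B[OF t] e1 by (intro mult_mono) (auto simp: dist_real_def)
        have 2: "\<bar>\<kappa>' (hist (qe x) t)\<bar> * \<bar>qe x t - q t\<bar> \<le> L * (e / (4 * (L + 1)))"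
          using close[OF t] kappa'_bound L_nonneg unfolding \<delta>_def by (intro mult_mono) auto
        have "L * (e / (4 * (L + 1))) \<le> e / 4" using L_nonneg \<open>e > 0\<close> by (simp add: field_simps)
        moreover have "e1 * (\<bar>B\<bar> + 1) = e / 2" by (simp add: e1_def field_simps add_nonneg_eq_0_iff)
        moreover have "hist_rate (qe x) t - hist_rate q t
            = \<kappa>' (hist (qe x) t) * (qe x t - q t) + (\<kappa>' (hist (qe x) t) - \<kappa>' (hist q t)) * q t"
          by (simp add: hist_rate_def algebra_simps)
        ultimately have "\<bar>hist_rate (qe x) t - hist_rate q t\<bar> \<le> e / 4 + e / 2"
          using 1 2 unfolding abs_mult[symmetric] by linarith
        then show "dist (hist_rate (qe x) t) (hist_rate q t) < e"
          using \<open>e > 0\<close> by (simp add: dist_real_def)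
      qed
    qed
  qed
  moreover have k'e: "\<forall>\<^sub>F x in F. hist_rate (qe x) \<in> L2 {0<..<T}"
    using qe_prim by (rule eventually_mono) (blast intro: L2_continuous hist_rate_continuous L2_primitive_continuous)
  ultimately have k'_lim: "((\<lambda>x. L2_norm T (\<lambda>t. hist_rate (qe x) t - hist_rate q t)) \<longlongrightarrow> 0) F"
    using k' T_pos by (intro L2_norm_uniform_tendsto_0)

  let ?v = "\<lambda>t. ?h t - 2 * \<alpha> * p t"
  have v: "?v \<in> L2 {0<..<T}" by (intro L2_diff[OF h] L2_cmult p)
  have pairing: "((\<lambda>x. integral {0..T} (\<lambda>t. (pe x t - p t) * ?v t)) \<longlongrightarrow> 0) F"
  proof (rule L2_pairing_tendsto_0[OF v T_pos])
    show "\<forall>\<^sub>F x in F. L2_primitive T (\<lambda>t. qe x t - q t) (\<lambda>t. pe x t - p t) \<and> qe x 0 - q 0 = 0"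
      using qe_prim by (rule eventually_mono) (use qp in \<open>auto intro: L2_primitive_diff\<close>)
    show "\<forall>\<^sub>F x in F. L2_norm T (\<lambda>t. pe x t - p t) \<le> rate_bound P + L2_norm T p"
      using eventually_conj[OF qe_prim pe_bound]
    proof (rule eventually_mono)
      fix x assume x: "(L2_primitive T (qe x) (pe x) \<and> qe x 0 = 0) \<and> L2_norm T (pe x) \<le> rate_bound P"
      then have "pe x \<in> L2 {0<..<T}" by (simp add: L2_primitive_def)
      from L2_norm_diff_triangle[OF this p] x
      show "L2_norm T (\<lambda>t. pe x t - p t) \<le> rate_bound P + L2_norm T p" by linarith
    qed
    show "uniform_limit {0..T} (\<lambda>x t. qe x t - q t) (\<lambda>_. 0) F"
      using unif unfolding uniform_limit_iff by (simp add: dist_real_def)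
  qed

  \<comment> \<open>On the set where the residual vanishes, so does its derivative; elsewhere \<open>p\<close> vanishes.\<close>
  have "AE t in lebesgue_on {0<..<T}. residual l q t = 0 \<longrightarrow> l' t - hist_rate q t - \<alpha> * p t = 0"
    by (rule L2_primitive_deriv_zero_on_level[OF residual_primitive[OF l qp(1)] T_pos])
  moreover have "AE t in lebesgue_on {0<..<T}. 0 \<le> p t \<and> residual l q t \<le> 0 \<and> p t * residual l q t = 0"
    using q by (simp add: lim_solution_def)
  ultimately have "AE t in lebesgue_on {0<..<T}. p t * ?h t = \<alpha> * (p t)\<^sup>2"
    by eventually_elim (auto simp: power2_eq_square algebra_simps)
  then have "integral {0..T} (\<lambda>t. p t * ?h t) = integral {0..T} (\<lambda>t. \<alpha> * (p t)\<^sup>2)"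
    by (rule integral_AE_cong) auto
  then have ph: "integral {0..T} (\<lambda>t. p t * ?h t) = \<alpha> * (L2_norm T p)\<^sup>2"
    by (simp add: L2_norm_square[OF p])

  let ?rhs = "\<lambda>x. (rate_bound P * (L2_norm T (\<lambda>t. le' x t - l' t)
      + L2_norm T (\<lambda>t. hist_rate (qe x) t - hist_rate q t))
      + integral {0..T} (\<lambda>t. (pe x t - p t) * ?v t)) / \<alpha>"
  have rhs: "(?rhs \<longlongrightarrow> (rate_bound P * (0 + 0) + 0) / \<alpha>) F"
    by (intro tendsto_intros strong k'_lim pairing) (use alpha_pos in auto)
  have upper: "\<forall>\<^sub>F x in F. (L2_norm T (\<lambda>t. pe x t - p t))\<^sup>2 \<le> ?rhs x"
    using eventually_conj[OF reg eventually_conj[OF le eventually_conj[OF eps_pos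
          eventually_conj[OF k'e pe_bound]]]]
  proof (rule eventually_mono)
    fix x assume x: "reg_solution (eps x) (le x) (qe x) (pe x) \<and>
        (L2_primitive T (le x) (le' x) \<and> le x 0 = 0 \<and> L2_norm T (le' x) \<le> P) \<and>
        0 < eps x \<and> hist_rate (qe x) \<in> L2 {0<..<T} \<and> L2_norm T (pe x) \<le> rate_bound P"
    have pe: "pe x \<in> L2 {0<..<T}" and le': "le' x \<in> L2 {0<..<T}"
      using x by (auto simp: L2_primitive_def reg_solution_def)
    have he: "?he x \<in> L2 {0<..<T}" using x le' by (intro L2_diff) auto
    have "0 \<le> (max 0 (residual (le x) (qe x) T))\<^sup>2 / 2" by simp
    also have "\<dots> = eps x * (integral {0..T} (\<lambda>t. pe x t * ?he x t) - \<alpha> * integral {0..T} (\<lambda>t. (pe x t)\<^sup>2))"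
      using x T_pos by (intro reg_solution_energy) auto
    finally have en: "\<alpha> * (L2_norm T (pe x))\<^sup>2 \<le> integral {0..T} (\<lambda>t. pe x t * ?he x t)"
      using x by (simp add: zero_le_mult_iff L2_norm_square[OF pe])
    note split1 = L2_pairing_diff(2)[OF he h pe]
    have cmult: "integral {0..T} (\<lambda>t. f t * (2 * \<alpha> * p t)) = 2 * \<alpha> * integral {0..T} (\<lambda>t. f t * p t)"
      for f :: "real \<Rightarrow> real"
      by (subst integral_mult_right[symmetric]) (simp add: mult_ac)
    have split2: "integral {0..T} (\<lambda>t. (pe x t - p t) * ?v t)
        = integral {0..T} (\<lambda>t. pe x t * ?h t) - 2 * \<alpha> * integral {0..T} (\<lambda>t. pe x t * p t)
        - \<alpha> * (L2_norm T p)\<^sup>2 + 2 * \<alpha> * (L2_norm T p)\<^sup>2"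
      unfolding L2_pairing_diff(1)[OF pe p v] L2_pairing_diff(2)[OF h L2_cmult[OF p] pe]
        L2_pairing_diff(2)[OF h L2_cmult[OF p] p] cmult
      by (simp add: ph L2_norm_square[OF p, unfolded power2_eq_square] power2_eq_square)
    have "integral {0..T} (\<lambda>t. pe x t * (?he x t - ?h t)) \<le> L2_norm T (pe x) * L2_norm T (\<lambda>t. ?he x t - ?h t)"
      using L2_Cauchy_Schwarz[OF pe L2_diff[OF he h]] by linarith
    also have "L2_norm T (\<lambda>t. ?he x t - ?h t)
        = L2_norm T (\<lambda>t. (le' x t - l' t) - (hist_rate (qe x) t - hist_rate q t))"
      by (simp add: algebra_simps)
    also have "L2_norm T (pe x) * \<dots> \<le> rate_bound P * (L2_norm T (\<lambda>t. le' x t - l' t)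
      + L2_norm T (\<lambda>t. hist_rate (qe x) t - hist_rate q t))"
      using x order_trans[OF L2_norm_nonneg[of T "pe x"]] by (intro mult_mono L2_norm_diff_triangle L2_diff le' l' k') auto
    finally have cs: "integral {0..T} (\<lambda>t. pe x t * (?he x t - ?h t)) \<le> \<dots>" .
    have "\<alpha> * (L2_norm T (\<lambda>t. pe x t - p t))\<^sup>2
      = \<alpha> * (L2_norm T (pe x))\<^sup>2 - 2 * \<alpha> * integral {0..T} (\<lambda>t. pe x t * p t) + \<alpha> * (L2_norm T p)\<^sup>2"
      unfolding L2_norm_diff_square[OF pe p] by (simp add: algebra_simps)
    also have "\<dots> \<le> rate_bound P * (L2_norm T (\<lambda>t. le' x t - l' t)
      + L2_norm T (\<lambda>t. hist_rate (qe x) t - hist_rate q t))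
      + integral {0..T} (\<lambda>t. (pe x t - p t) * ?v t)"
      using en split1 split2 cs by linarith
    finally show "(L2_norm T (\<lambda>t. pe x t - p t))\<^sup>2 \<le> ?rhs x"
      using alpha_pos by (simp add: le_divide_eq mult.commute)
  qed
  have lower: "\<forall>\<^sub>F x in F. 0 \<le> (L2_norm T (\<lambda>t. pe x t - p t))\<^sup>2" by simp
  have "(?rhs \<longlongrightarrow> 0) F" using rhs by (simp only: add_0 mult_zero_right div_0)
  from tendsto_sandwich[OF lower upper tendsto_const this]
  have "((\<lambda>x. (L2_norm T (\<lambda>t. pe x t - p t))\<^sup>2) \<longlongrightarrow> 0) F" .
  from tendsto_real_sqrt[OF this] show ?thesis by simp
qed

end

section \<open>Functionals on \<open>H1\<close>\<close>

text \<open>A substitute for the Riesz representation theorem that needs no completeness: a near minimizer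
  of the quadratic functional represents the given functional up to a small error.\<close>

lemma dual_space_approx_Riesz:
  fixes X :: "(real \<Rightarrow> real ^ 'n) set"
  assumes \<Phi>: "\<Phi> \<in> dual_space X (H1_norm T)" and X: "X \<subseteq> H1 T" "X \<noteq> {}"
    and lincomb: "\<And>u v a b. u \<in> X \<Longrightarrow> v \<in> X \<Longrightarrow> (\<lambda>t. a *\<^sub>R u t + b *\<^sub>R v t) \<in> X"
    and "T > 0" "\<delta> > 0"
  obtains w where "w \<in> X" "\<And>u. u \<in> X \<Longrightarrow> \<bar>\<Phi> u - H1_inner T u w\<bar> \<le> \<delta> * (1 + (H1_norm T u)\<^sup>2)"
proof -
  have scale: "(\<lambda>t. c *\<^sub>R u t) \<in> X" if "u \<in> X" for u c
    using lincomb[OF that that, of c 0] by simp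
  have lin: "\<Phi> (\<lambda>t. a *\<^sub>R u t + b *\<^sub>R v t) = a * \<Phi> u + b * \<Phi> v" if "u \<in> X" "v \<in> X" for u v a b
    using \<Phi> that scale[OF that(1), of a] scale[OF that(2), of b] unfolding dual_space_def by auto
  obtain C where C: "\<And>u. u \<in> X \<Longrightarrow> \<bar>\<Phi> u\<bar> \<le> C * H1_norm T u"
    using \<Phi> unfolding dual_space_def by blast
  define J where "J u = (H1_norm T u)\<^sup>2 / 2 - \<Phi> u" for u
  have bdd: "bdd_below (J ` X)"
  proof (rule bdd_belowI2)
    fix u assume "u \<in> X"
    have "0 \<le> (H1_norm T u - C)\<^sup>2" by simp
    then have "C * H1_norm T u \<le> (H1_norm T u)\<^sup>2 / 2 + C\<^sup>2 / 2" by (simp add: power2_diff algebra_simps)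
    then show "- (C\<^sup>2 / 2) \<le> J u" using C[OF \<open>u \<in> X\<close>] by (simp add: J_def abs_le_iff)
  qed
  \<comment> \<open>The tolerance is of second order because the variation uses s = \<delta> and s =
    -\<delta>: division by \<delta> leaves an error of order \<delta>.\<close>
  have "Inf (J ` X) < Inf (J ` X) + \<delta>\<^sup>2" using \<open>\<delta> > 0\<close> by simp
  then obtain w where w: "w \<in> X" "J w < Inf (J ` X) + \<delta>\<^sup>2"
    using cInf_lessD[of "J ` X"] X(2) by blast
  show ?thesis
  proof (rule that[OF w(1)])
    fix u assume u: "u \<in> X"
    have wH: "w \<in> H1 T" and uH: "u \<in> H1 T" using w u X by auto
    have var: "- \<delta>\<^sup>2 \<le> s * (H1_inner T u w - \<Phi> u) + s\<^sup>2 * (H1_norm T u)\<^sup>2 / 2" for s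
    proof -
      let ?z = "\<lambda>t. 1 *\<^sub>R w t + s *\<^sub>R u t"
      have z: "?z \<in> X" by (rule lincomb[OF w(1) u])
      have "(H1_norm T ?z)\<^sup>2 = (H1_norm T w)\<^sup>2 + 2 * s * H1_inner T u w + s\<^sup>2 * (H1_norm T u)\<^sup>2"
        unfolding H1_norm_add_square[OF wH uH \<open>T > 0\<close>] H1_inner_commute[of T w u] ..
      then have "J ?z = J w + s * (H1_inner T u w - \<Phi> u) + s\<^sup>2 * (H1_norm T u)\<^sup>2 / 2"
        unfolding J_def lin[OF w(1) u] by (simp add: algebra_simps)
      moreover have "Inf (J ` X) \<le> J ?z" using bdd z by (intro cInf_lower) auto
      ultimately show ?thesis using w(2) by linarith
    qed
    have "\<delta> * (\<Phi> u - H1_inner T u w) \<le> \<delta> * (\<delta> * (1 + (H1_norm T u)\<^sup>2 / 2))"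
      using var[of \<delta>] by (simp add: power2_eq_square algebra_simps)
    moreover have "\<delta> * (H1_inner T u w - \<Phi> u) \<le> \<delta> * (\<delta> * (1 + (H1_norm T u)\<^sup>2 / 2))"
      using var[of "- \<delta>"] by (simp add: power2_eq_square algebra_simps)
    ultimately have "\<bar>\<Phi> u - H1_inner T u w\<bar> \<le> \<delta> * (1 + (H1_norm T u)\<^sup>2 / 2)"
      using \<open>\<delta> > 0\<close> by (simp add: abs_le_iff)
    also have "\<dots> \<le> \<delta> * (1 + (H1_norm T u)\<^sup>2)" using \<open>\<delta> > 0\<close> by (intro mult_left_mono) auto
    finally show "\<bar>\<Phi> u - H1_inner T u w\<bar> \<le> \<delta> * (1 + (H1_norm T u)\<^sup>2)" .
  qed
qed

text \<open>The approximate representation of a functional has an error growing with the squared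
  norm, so on a bounded family testing with inner products is enough.\<close>

lemma weak_conv_H1_innerI:
  fixes X :: "(real \<Rightarrow> real ^ 'n) set"
  assumes X: "X \<subseteq> H1 T"
    and lincomb: "\<And>u v a b. u \<in> X \<Longrightarrow> v \<in> X \<Longrightarrow> (\<lambda>t. a *\<^sub>R u t + b *\<^sub>R v t) \<in> X"
    and "T > 0" and f: "\<forall>\<^sub>F x in F. f x \<in> X" and l: "l \<in> X"
    and bound: "\<forall>\<^sub>F x in F. H1_norm T (f x) \<le> K"
    and inner: "\<And>w. w \<in> X \<Longrightarrow> ((\<lambda>x. H1_inner T (f x) w) \<longlongrightarrow> H1_inner T l w) F"
  shows "weak_conv X (H1_norm T) f l F"
  unfolding weak_conv_def
proof (intro conjI ballI)
  fix \<Phi> assume \<Phi>: "\<Phi> \<in> dual_space X (H1_norm T)"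
  show "((\<lambda>x. \<Phi> (f x)) \<longlongrightarrow> \<Phi> l) F"
  proof (rule tendstoI)
    fix e :: real assume "e > 0"
    \<comment> \<open>Sum of the error weights of the family and of its limit: accuracy e / (2 A)
      costs e/2 in total, and the inner products take the other e/2.\<close>
    define A where "A = (1 + K\<^sup>2) + (1 + (H1_norm T l)\<^sup>2)"
    have A: "A > 0" unfolding A_def by (intro add_pos_pos add_pos_nonneg) auto
    have "X \<noteq> {}" using l by blast
    have "e / (2 * A) > 0" using \<open>e > 0\<close> A by simp
    then obtain w where w: "w \<in> X"
      "\<And>u. u \<in> X \<Longrightarrow> \<bar>\<Phi> u - H1_inner T u w\<bar> \<le> e / (2 * A) * (1 + (H1_norm T u)\<^sup>2)"
      using dual_space_approx_Riesz[OF \<Phi> X \<open>X \<noteq> {}\<close> lincomb \<open>T > 0\<close>, of "e / (2 * A)"] by blast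
    have "e / 2 > 0" using \<open>e > 0\<close> by simp
    from eventually_conj[OF tendstoD[OF inner[OF w(1)] this] eventually_conj[OF f bound]]
    show "\<forall>\<^sub>F x in F. dist (\<Phi> (f x)) (\<Phi> l) < e"
    proof (rule eventually_mono)
      fix x assume x: "dist (H1_inner T (f x) w) (H1_inner T l w) < e / 2 \<and> f x \<in> X \<and> H1_norm T (f x) \<le> K"
      have "(H1_norm T (f x))\<^sup>2 \<le> K\<^sup>2" using x H1_norm_nonneg by (intro power_mono) auto
      then have "e / (2 * A) * (1 + (H1_norm T (f x))\<^sup>2) \<le> e / (2 * A) * (1 + K\<^sup>2)"
        using \<open>e / (2 * A) > 0\<close> by (intro mult_left_mono) auto
      moreover have "e / (2 * A) * (1 + K\<^sup>2) + e / (2 * A) * (1 + (H1_norm T l)\<^sup>2) = e / 2"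
        unfolding distrib_left[symmetric] A_def[symmetric] using A by simp
      ultimately show "dist (\<Phi> (f x)) (\<Phi> l) < e"
        using w(2)[OF l] w(2)[of "f x"] x unfolding dist_real_def by linarith
    qed
  qed
qed (use f l in auto)

text \<open>\<open>a j k\<close> stands for the j-th summand evaluated at the k-th element. The sign
  at k depends on smaller indices only, which makes the recursion well-founded; a vanishing partial
  sum gets sign 1, so the values are never 0.\<close>

fun hump_sign :: "(nat \<Rightarrow> nat \<Rightarrow> real) \<Rightarrow> nat \<Rightarrow> real" where
  "hump_sign a k = (if 0 \<le> (\<Sum>j<k. hump_sign a j * a j k) then 1 else - 1)"

declare hump_sign.simps [simp del]

text \<open>Gliding hump: the signs are chosen such that the partial sums of the functional at \<open>v k\<close> do
  not cancel the \<open>k\<close>-th term, which dominates the tail.\<close>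

lemma H1_gliding_hump:
  fixes v :: "nat \<Rightarrow> real \<Rightarrow> real ^ 'n"
  assumes v: "\<And>k. v k \<in> H1 T" and big: "\<And>k. 4 ^ k \<le> H1_norm T (v k)" and "T > 0"
  shows "\<exists>\<Phi>\<in>dual_space (H1 T) (H1_norm T). \<not> Bseq (\<lambda>k. \<Phi> (v k))"
proof -
  let ?N = "H1_norm T"
  have pos: "?N (v k) > 0" for k using big[of k] by (meson less_le_trans zero_less_numeral zero_less_power)
  \<comment> \<open>Normalization makes the j-th summand at most (1/3)^j times the norm. At
    \<open>v k\<close> the tail beyond k is then at most half of the k-th term, so half of that term
    survives; with norms of at least 4^k it grows like (4/3)^k.\<close>
  define b where "b j u = (1/3) ^ j * (H1_inner T u (v j) / ?N (v j))" for j u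
  have b_le: "\<bar>b j u\<bar> \<le> (1/3) ^ j * ?N u" if "u \<in> H1 T" for j u
  proof -
    have "\<bar>H1_inner T u (v j)\<bar> / ?N (v j) \<le> ?N u"
      using H1_inner_Cauchy_Schwarz[OF that v \<open>T > 0\<close>, of j] pos[of j] by (simp add: divide_le_eq)
    then have "(1/3) ^ j * (\<bar>H1_inner T u (v j)\<bar> / ?N (v j)) \<le> (1/3) ^ j * ?N u"
      by (intro mult_left_mono) auto
    then show ?thesis using pos[of j] by (simp add: b_def abs_mult)
  qed
  define \<sigma> where "\<sigma> = hump_sign (\<lambda>j k. b j (v k))"
  have \<sigma>: "\<bar>\<sigma> j\<bar> = 1" for j unfolding \<sigma>_def by (subst hump_sign.simps) auto
  define \<Phi> where "\<Phi> u = (\<Sum>j. \<sigma> j * b j u)" for u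
  have geo: "summable (\<lambda>j. (1/3) ^ j * c)" "(\<Sum>j. (1/3) ^ j * c) = 3 / 2 * c" for c :: real
    using sums_mult2[OF geometric_sums[of "1/3 :: real"], of c] by (auto simp: sums_iff)
  have term_le: "\<bar>\<sigma> j * b j u\<bar> \<le> (1/3) ^ j * ?N u" if "u \<in> H1 T" for j u
    using b_le[OF that] by (simp add: abs_mult \<sigma>)
  have summ: "summable (\<lambda>j. \<sigma> j * b j u)" if "u \<in> H1 T" for u
    by (rule summable_comparison_test'[OF geo(1)]) (use term_le[OF that] in simp)
  have lin: "\<Phi> (\<lambda>t. x *\<^sub>R u t + y *\<^sub>R w t) = x * \<Phi> u + y * \<Phi> w"
    if uw: "u \<in> H1 T" "w \<in> H1 T" for u w x y
  proof -
    have "\<sigma> j * b j (\<lambda>t. x *\<^sub>R u t + y *\<^sub>R w t) = x * (\<sigma> j * b j u) + y * (\<sigma> j * b j w)" for j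
      unfolding b_def H1_inner_lincomb[OF uw v \<open>T > 0\<close>] by (simp add: add_divide_distrib algebra_simps)
    then show ?thesis
      unfolding \<Phi>_def
      using summ[OF uw(1)] summ[OF uw(2)]
      by (simp add: suminf_add[symmetric] suminf_mult summable_mult)
  qed
  have "\<Phi> \<in> dual_space (H1 T) ?N"
    unfolding dual_space_def
  proof (intro CollectI conjI ballI allI exI[of _ "3 / 2"])
    show "\<Phi> (\<lambda>t. u t + w t) = \<Phi> u + \<Phi> w" if "u \<in> H1 T" "w \<in> H1 T" for u w
      using lin[OF that, of 1 1] by simp
    show "\<Phi> (\<lambda>t. c *\<^sub>R u t) = c * \<Phi> u" if "u \<in> H1 T" for u c
      using lin[OF that that, of c 0] by simp
    show "\<bar>\<Phi> u\<bar> \<le> 3 / 2 * ?N u" if u: "u \<in> H1 T" for u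
    proof -
      have "norm (\<Phi> u) \<le> (\<Sum>j. (1/3) ^ j * ?N u)"
        unfolding \<Phi>_def by (rule norm_suminf_le[OF _ geo(1)]) (use term_le[OF u] in simp)
      then show ?thesis by (simp add: geo(2))
    qed
  qed
  moreover have "\<not> Bseq (\<lambda>k. \<Phi> (v k))"
  proof
    assume "Bseq (\<lambda>k. \<Phi> (v k))"
    then obtain B where B: "\<And>k. \<bar>\<Phi> (v k)\<bar> \<le> B" by (auto simp: Bseq_def)
    have growth: "(4/3) ^ k / 2 \<le> B" for k
    proof -
      let ?s = "\<lambda>j. \<sigma> j * b j (v k)"
      have head: "(1/3) ^ k * ?N (v k) \<le> \<bar>\<Sum>j<Suc k. ?s j\<bar>"
      proof -
        have "b k (v k) = (1/3) ^ k * ?N (v k)"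
          using pos[of k] unfolding b_def H1_inner_self[OF v] by (simp add: power2_eq_square)
        moreover have "0 \<le> (1/3) ^ k * ?N (v k)" using pos[of k] by simp
        moreover have "\<sigma> k = (if 0 \<le> (\<Sum>j<k. ?s j) then 1 else - 1)"
          unfolding \<sigma>_def by (subst hump_sign.simps) simp
        ultimately show ?thesis by (auto split: if_splits)
      qed
      have tail_summ: "summable (\<lambda>j. (1/3) ^ (j + Suc k) * ?N (v k))"
        by (rule summable_ignore_initial_segment[OF geo(1)])
      have "norm (\<Sum>j. ?s (j + Suc k)) \<le> (\<Sum>j. (1/3) ^ (j + Suc k) * ?N (v k))"
        by (rule norm_suminf_le[OF _ tail_summ]) (simp only: real_norm_def term_le[OF v])
      also have "\<dots> = (\<Sum>j. (1/3) ^ j * ((1/3) ^ Suc k * ?N (v k)))"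
        by (simp add: power_add mult_ac)
      also have "\<dots> = (1/3) ^ k * ?N (v k) / 2" unfolding geo(2) by simp
      finally have tail: "\<bar>\<Sum>j. ?s (j + Suc k)\<bar> \<le> (1/3) ^ k * ?N (v k) / 2" by simp
      have "\<Phi> (v k) = (\<Sum>j. ?s (j + Suc k)) + (\<Sum>j<Suc k. ?s j)"
        unfolding \<Phi>_def by (rule suminf_split_initial_segment[OF summ[OF v]])
      then have "(1/3) ^ k * ?N (v k) / 2 \<le> B" using head tail B[of k] by linarith
      moreover have "(1/3) ^ k * 4 ^ k \<le> (1/3) ^ k * ?N (v k)" using big by (intro mult_left_mono) auto
      moreover have "(1/3) ^ k * 4 ^ k = (4/3 :: real) ^ k" by (simp add: power_mult_distrib[symmetric])
      ultimately show ?thesis by linarith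
    qed
    obtain k where "2 * B < (4/3) ^ k" using real_arch_pow[of "4/3" "2 * B"] by auto
    then show False using growth[of k] by simp
  qed
  ultimately show ?thesis by blast
qed

text \<open>If no bound holds eventually, parameters decreasing to 0 can be picked along which the
  norms exceed 4^k. The hump functional is unbounded on this sequence, although its values must
  converge there.\<close>

lemma weak_conv_H1_bounded:
  fixes f :: "real \<Rightarrow> real \<Rightarrow> real ^ 'n"
  assumes w: "weak_conv (H1 T) (H1_norm T) f l (at_right 0)" and "T > 0"
  shows "\<exists>K. \<forall>\<^sub>F x in at_right 0. H1_norm T (f x) \<le> K"
proof (rule ccontr)
  assume contra: "\<nexists>K. \<forall>\<^sub>F x in at_right 0. H1_norm T (f x) \<le> K"
  have "\<exists>x>0. x < inverse (real (Suc k)) \<and> f x \<in> H1 T \<and> 4 ^ k < H1_norm T (f x)" for k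
  proof -
    have "\<exists>\<^sub>F x in at_right 0. \<not> H1_norm T (f x) \<le> 4 ^ k"
      using contra unfolding frequently_def by simp
    moreover have "\<forall>\<^sub>F x in at_right 0. f x \<in> H1 T" using w by (simp add: weak_conv_def)
    moreover have "\<forall>\<^sub>F x in at_right 0. x > 0 \<and> x < inverse (real (Suc k))"
      by (intro eventually_conj eventually_at_right_less eventually_at_right_real[of 0, THEN eventually_mono])
        (auto simp: eventually_at_right_less)
    ultimately have "\<exists>\<^sub>F x in at_right 0. \<not> H1_norm T (f x) \<le> 4 ^ k \<and> f x \<in> H1 T \<and> x > 0 \<and> x < inverse (real (Suc k))"
      by (rule frequently_eventually_frequently[OF _ eventually_conj])
    from frequently_ex[OF this] show ?thesis by force
  qed
  then obtain x where x: "\<And>k. x k > 0" "\<And>k. x k < inverse (real (Suc k))"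
    "\<And>k. f (x k) \<in> H1 T" "\<And>k. 4 ^ k < H1_norm T (f (x k))" by metis
  have "x \<longlonglongrightarrow> 0"
  proof (rule tendsto_sandwich[OF _ _ tendsto_const LIMSEQ_inverse_real_of_nat])
    show "\<forall>\<^sub>F k in sequentially. 0 \<le> x k" using x(1) by (intro always_eventually) (auto intro: less_imp_le)
    show "\<forall>\<^sub>F k in sequentially. x k \<le> inverse (real (Suc k))"
      using x(2) by (intro always_eventually) (auto intro: less_imp_le)
  qed
  then have fl: "filterlim x (at_right 0) sequentially"
    unfolding filterlim_at using x(1) by (simp add: less_imp_neq[symmetric] always_eventually)
  obtain \<Phi> where \<Phi>: "\<Phi> \<in> dual_space (H1 T) (H1_norm T)" "\<not> Bseq (\<lambda>k. \<Phi> (f (x k)))"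
    using H1_gliding_hump[of "\<lambda>k. f (x k)" T] x(3,4) \<open>T > 0\<close> by (auto intro: less_imp_le)
  have "((\<lambda>e. \<Phi> (f e)) \<longlongrightarrow> \<Phi> l) (at_right 0)" using w \<Phi>(1) by (simp add: weak_conv_def)
  then have "(\<lambda>k. \<Phi> (f (x k))) \<longlonglongrightarrow> \<Phi> l" by (rule filterlim_compose[OF _ fl])
  then have "Bseq (\<lambda>k. \<Phi> (f (x k)))" by (intro convergent_imp_Bseq) (auto simp: convergent_def)
  then show False using \<Phi>(2) by simp
qed

lemma strong_conv_imp_weak_conv_H1:
  fixes f :: "'b \<Rightarrow> real \<Rightarrow> real ^ 'n"
  assumes "strong_conv (H1 T) (H1_norm T) f l F"
  shows "weak_conv (H1 T) (H1_norm T) f l F"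
  unfolding weak_conv_def
proof (intro conjI ballI)
  show f: "\<forall>\<^sub>F x in F. f x \<in> H1 T" and l: "l \<in> H1 T" using assms by (auto simp: strong_conv_def)
  have lim: "((\<lambda>x. H1_norm T (\<lambda>t. f x t - l t)) \<longlongrightarrow> 0) F" using assms by (simp add: strong_conv_def)
  fix \<Phi> :: "(real \<Rightarrow> real ^ 'n) \<Rightarrow> real" assume \<Phi>: "\<Phi> \<in> dual_space (H1 T) (H1_norm T)"
  then obtain C where C: "\<And>u. u \<in> H1 T \<Longrightarrow> \<bar>\<Phi> u\<bar> \<le> C * H1_norm T u"
    unfolding dual_space_def by blast
  show "((\<lambda>x. \<Phi> (f x)) \<longlongrightarrow> \<Phi> l) F"
  proof (rule LIM_zero_cancel, rule Lim_null_comparison[OF _ tendsto_mult_right_zero[OF lim]])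
    show "\<forall>\<^sub>F x in F. norm (\<Phi> (f x) - \<Phi> l) \<le> C * H1_norm T (\<lambda>t. f x t - l t)"
      using f
    proof (rule eventually_mono)
      fix x assume x: "f x \<in> H1 T"
      have m: "(\<lambda>t. - 1 *\<^sub>R l t) \<in> H1 T" using H1_lincomb[OF l l, of "- 1" 0] by simp
      have "\<Phi> (\<lambda>t. f x t + - 1 *\<^sub>R l t) = \<Phi> (f x) + - 1 * \<Phi> l"
        using \<Phi> x l m unfolding dual_space_def by (simp del: scaleR_minus1_left scaleR_minus_left)
      then show "norm (\<Phi> (f x) - \<Phi> l) \<le> C * H1_norm T (\<lambda>t. f x t - l t)"
        using C[OF H1_lincomb[OF x l, of 1 "- 1"]] by simp
    qed
  qed
qed

text \<open>Turns weak convergence of loads into convergence at each point, including the initial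
  time.\<close>

lemma H1_evaluation_dual:
  assumes "T > 0" "t \<in> {0..T}"
  shows "(\<lambda>u :: real \<Rightarrow> real ^ 'n. u t $ i) \<in> dual_space (H1 T) (H1_norm T)"
  unfolding dual_space_def using H1_eval_le[OF _ assms, of _ i] by auto

text \<open>Pointwise convergence is uniform on a finite net of times, and the common modulus of
  continuity carries it to the points in between.\<close>

lemma equicontinuous_uniform_limit:
  fixes f :: "'b \<Rightarrow> real \<Rightarrow> real"
  assumes "T > 0" and conv: "\<And>t. t \<in> {0..T} \<Longrightarrow> ((\<lambda>x. f x t) \<longlongrightarrow> g t) F"
    and f: "\<forall>\<^sub>F x in F. \<forall>s\<in>{0..T}. \<forall>t\<in>{0..T}. \<bar>f x t - f x s\<bar> \<le> K * sqrt \<bar>t - s\<bar>"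
    and g: "\<And>s t. s \<in> {0..T} \<Longrightarrow> t \<in> {0..T} \<Longrightarrow> \<bar>g t - g s\<bar> \<le> K' * sqrt \<bar>t - s\<bar>"
  shows "uniform_limit {0..T} f g F"
proof (rule uniform_limitI)
  fix e :: real assume "e > 0"
  define A where "A = \<bar>K\<bar> + \<bar>K'\<bar> + 1"
  have A: "A > 0" "\<bar>K\<bar> \<le> A" "\<bar>K'\<bar> \<le> A" by (auto simp: A_def)
  \<comment> \<open>Points closer than \<delta> have values differing by at most A sqrt \<delta> =
    e/4, both for the family and for the limit; with e/4 for the net this stays below e.\<close>
  define \<delta> where "\<delta> = (e / (4 * A))\<^sup>2"
  have \<delta>: "\<delta> > 0" using \<open>e > 0\<close> A by (simp add: \<delta>_def)
  obtain S where S: "finite S" "S \<subseteq> {0..T}" "{0..T} \<subseteq> (\<Union>s\<in>S. ball s \<delta>)"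
    using compactE_image[of "{0..T}" "{0..T}" "\<lambda>s. ball s \<delta>"] \<delta> by (metis UN_I centre_in_ball compact_Icc open_ball subsetI)
  have near: "c * sqrt \<bar>t - s\<bar> \<le> e / 4" if "\<bar>c\<bar> \<le> A" "\<bar>t - s\<bar> < \<delta>" for c s t :: real
  proof -
    have "sqrt \<bar>t - s\<bar> \<le> e / (4 * A)"
      using that(2) \<open>e > 0\<close> A by (intro real_le_lsqrt) (auto simp: \<delta>_def)
    then have "A * sqrt \<bar>t - s\<bar> \<le> A * (e / (4 * A))" using A by (intro mult_left_mono) auto
    moreover have "c * sqrt \<bar>t - s\<bar> \<le> A * sqrt \<bar>t - s\<bar>" using that(1) by (intro mult_right_mono) auto
    moreover have "A * (e / (4 * A)) = e / 4" using A by simp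
    ultimately show ?thesis by linarith
  qed
  have "e / 4 > 0" using \<open>e > 0\<close> by simp
  then have "\<forall>\<^sub>F x in F. \<forall>s\<in>S. dist (f x s) (g s) < e / 4"
    using tendstoD[OF conv[OF subsetD[OF S(2)]]] by (intro eventually_ball_finite S(1)) blast
  with f show "\<forall>\<^sub>F x in F. \<forall>t\<in>{0..T}. dist (f x t) (g t) < e"
  proof (rule eventually_elim2, intro ballI)
    fix x t
    assume x: "\<forall>s\<in>{0..T}. \<forall>t\<in>{0..T}. \<bar>f x t - f x s\<bar> \<le> K * sqrt \<bar>t - s\<bar>"
      "\<forall>s\<in>S. dist (f x s) (g s) < e / 4" and t: "t \<in> {0..T}"
    obtain s where s: "s \<in> S" "\<bar>t - s\<bar> < \<delta>" using S(3) t by (auto simp: dist_real_def abs_minus_commute)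
    have s': "s \<in> {0..T}" using s S by blast
    have "\<bar>f x t - f x s\<bar> \<le> e / 4" using x(1) s' t near[OF A(2) s(2)] by fastforce
    moreover have "\<bar>g t - g s\<bar> \<le> e / 4" using g[OF s' t] near[OF A(3) s(2)] by linarith
    moreover have "\<bar>f x s - g s\<bar> < e / 4" using x(2) s(1) by (auto simp: dist_real_def)
    ultimately show "dist (f x t) (g t) < e" unfolding dist_real_def using \<open>e > 0\<close> by linarith
  qed
qed

section \<open>The vector-valued problems\<close>

lemma dissip_eps_0: "dissip_eps \<kappa> 0 = dissip \<kappa>"
  by (intro ext) (simp add: dissip_eps_def dissip_def)

lemma subdifferential_dissip_eps:
  fixes \<xi> \<zeta> \<eta> :: "real ^ 'n"
  assumes \<xi>: "\<xi> \<in> subdifferential (dissip_eps \<kappa> e \<zeta>) \<eta>"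
  shows "0 \<le> \<eta> $ i"
    and "0 \<le> x \<Longrightarrow> (\<xi> $ i - \<kappa> (\<zeta> $ i)) * (x - \<eta> $ i) \<le> e / 2 * (x\<^sup>2 - (\<eta> $ i)\<^sup>2)"
proof -
  let ?k = "\<chi> i. \<kappa> (\<zeta> $ i)"
  have sub: "dissip_eps \<kappa> e \<zeta> \<eta> + ereal (\<xi> \<bullet> (v - \<eta>)) \<le> dissip_eps \<kappa> e \<zeta> v" for v
    using \<xi> by (simp add: subdifferential_def)
  \<comment> \<open>The potential is finite at v = 0, so an infinite value at \<eta> would violate
    the subgradient inequality.\<close>
  have cone: "\<eta> \<in> nonneg_cone"
  proof (rule ccontr)
    assume "\<eta> \<notin> nonneg_cone"
    moreover have "(0 :: real ^ 'n) \<in> nonneg_cone" by (simp add: nonneg_cone_def)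
    ultimately show False using sub[of 0] by (simp add: dissip_eps_def)
  qed
  then show "0 \<le> \<eta> $ i" by (simp add: nonneg_cone_def)
  assume x: "0 \<le> x"
  define d where "d = x - \<eta> $ i"
  let ?v = "\<eta> + axis i d"
  have "?v \<in> nonneg_cone"
    using cone x by (auto simp: nonneg_cone_def axis_def d_def)
  then have "?k \<bullet> \<eta> + e / 2 * (norm \<eta>)\<^sup>2 + \<xi> \<bullet> axis i d \<le> ?k \<bullet> ?v + e / 2 * (norm ?v)\<^sup>2"
    using sub[of ?v] cone by (simp add: dissip_eps_def)
  moreover have "(norm ?v)\<^sup>2 = (norm \<eta>)\<^sup>2 + (x\<^sup>2 - (\<eta> $ i)\<^sup>2)"
    unfolding power2_norm_eq_inner
    by (simp add: inner_add_left inner_add_right inner_axis inner_axis' d_def power2_eq_square algebra_simps)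
  ultimately have "\<xi> $ i * d \<le> \<kappa> (\<zeta> $ i) * d + e / 2 * (x\<^sup>2 - (\<eta> $ i)\<^sup>2)"
    by (simp add: inner_add_right inner_axis distrib_left)
  then show "(\<xi> $ i - \<kappa> (\<zeta> $ i)) * (x - \<eta> $ i) \<le> e / 2 * (x\<^sup>2 - (\<eta> $ i)\<^sup>2)"
    by (simp add: d_def left_diff_distrib)
qed

text \<open>The scalar inequality is tested at the point expected to minimize e/2 times the square
  of x minus c x over x \<ge> 0: this is 0 for c \<le> 0 and c / e otherwise, where the inequality
  becomes a square that must vanish.\<close>

lemma subdifferential_dissip_eps_pos:
  assumes \<xi>: "\<xi> \<in> subdifferential (dissip_eps \<kappa> e \<zeta>) \<eta>" and "e > 0"
  shows "e * \<eta> $ i = max 0 (\<xi> $ i - \<kappa> (\<zeta> $ i))"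
proof -
  define c where "c = \<xi> $ i - \<kappa> (\<zeta> $ i)"
  note \<eta> = subdifferential_dissip_eps(1)[OF \<xi>, of i]
  have var: "c * (x - \<eta> $ i) \<le> e / 2 * (x\<^sup>2 - (\<eta> $ i)\<^sup>2)" if "0 \<le> x" for x
    using subdifferential_dissip_eps(2)[OF \<xi> that] by (simp add: c_def)
  show ?thesis
  proof (cases "c \<le> 0")
    case True
    have "0 \<le> - (c * \<eta> $ i)" using True \<eta> by (simp add: mult_nonpos_nonneg)
    also have "\<dots> \<le> - (e / 2 * (\<eta> $ i)\<^sup>2)" using var[of 0] by simp
    finally have "(\<eta> $ i)\<^sup>2 \<le> 0" using \<open>e > 0\<close> by (simp add: mult_le_0_iff)
    then show ?thesis using True by (simp add: c_def)
  next
    case False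
    define y where "y = c / e"
    have c: "c = e * y" using \<open>e > 0\<close> by (simp add: y_def)
    have "0 \<le> y" using False \<open>e > 0\<close> by (simp add: y_def)
    from var[OF this] have "e * ((y - \<eta> $ i)\<^sup>2 / 2) \<le> e * 0"
      by (simp add: c power2_eq_square algebra_simps)
    then have "(y - \<eta> $ i)\<^sup>2 \<le> 0" using \<open>e > 0\<close> by (simp add: mult_le_0_iff)
    then have "e * \<eta> $ i = c" by (simp add: c)
    then show ?thesis using False by (simp add: c_def)
  qed
qed

text \<open>Without the quadratic term, raising the coordinate by 1 gives the sign of the residual,
  and moving it to 0 gives complementarity.\<close>

lemma subdifferential_dissip:
  assumes \<xi>: "\<xi> \<in> subdifferential (dissip \<kappa> \<zeta>) \<eta>"
  shows "0 \<le> \<eta> $ i" "\<xi> $ i - \<kappa> (\<zeta> $ i) \<le> 0" "\<eta> $ i * (\<xi> $ i - \<kappa> (\<zeta> $ i)) = 0"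
proof -
  define c where "c = \<xi> $ i - \<kappa> (\<zeta> $ i)"
  have \<xi>0: "\<xi> \<in> subdifferential (dissip_eps \<kappa> 0 \<zeta>) \<eta>" using \<xi> by (simp add: dissip_eps_0)
  show \<eta>: "0 \<le> \<eta> $ i" by (rule subdifferential_dissip_eps(1)[OF \<xi>0])
  have var: "c * (x - \<eta> $ i) \<le> 0" if "0 \<le> x" for x
    using subdifferential_dissip_eps(2)[OF \<xi>0 that, of i] by (simp add: c_def)
  have c: "c \<le> 0" using var[of "\<eta> $ i + 1"] \<eta> by simp
  then show "\<xi> $ i - \<kappa> (\<zeta> $ i) \<le> 0" by (simp add: c_def)
  have "0 \<le> \<eta> $ i * c" using var[of 0] by (simp add: mult.commute)
  moreover have "\<eta> $ i * c \<le> 0" using \<eta> c by (rule mult_nonneg_nonpos)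
  ultimately show "\<eta> $ i * (\<xi> $ i - \<kappa> (\<zeta> $ i)) = 0" by (simp add: c_def)
qed

lemma history_component:
  fixes q :: "real \<Rightarrow> real ^ 'n"
  assumes "continuous_on {0..t} q"
  shows "history y0 q t $ i = integral {0..t} (\<lambda>s. q s $ i) + y0 $ i"
proof -
  have "integrable (lebesgue_on {0..t}) q"
    using absolutely_integrable_continuous_real[OF assms]
    by (simp add: set_integrable_def integrable_restrict_space)
  then have "(LINT s|lebesgue_on {0..t}. q s) = integral {0..t} q"
    by (intro lebesgue_integral_eq_integral) auto
  moreover have "integral {0..t} (\<lambda>s. q s $ i) = integral {0..t} q $ i"
    using assms by (intro integral_component_eq_cart integrable_continuous_interval)
  ultimately show ?thesis by (simp add: history_def)
qed

text \<open>One hypothesis serves every component: the history offsets \<open>y0 $ i\<close> are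
  unrestricted and are inserted in the sublocale.\<close>

locale vector_history_problem =
  fixes T \<alpha> L :: real and y0 :: "real ^ 'n" and \<kappa> :: "real \<Rightarrow> real"
  assumes component_problem: "history_problem T \<alpha> L \<kappa> (deriv \<kappa>)"
begin

sublocale comp: history_problem T \<alpha> "y0 $ i" L \<kappa> "deriv \<kappa>" for i
  by (rule component_problem)

abbreviation "wd \<equiv> weak_deriv {0<..<T}"

lemma solves_residual:
  assumes q: "q \<in> H10 T" and t: "t \<in> {0<..<T}"
  shows "(- (\<alpha> *\<^sub>R q t) + l t) $ i - \<kappa> (history y0 q t $ i) = comp.residual i (\<lambda>t. l t $ i) (\<lambda>t. q t $ i) t"
proof -
  have "continuous_on {0..T} q" using q by (auto simp: H10_def intro: H1_D)
  then have "continuous_on {0..t} q" by (rule continuous_on_subset) (use t in auto)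
  from history_component[OF this, of y0 i] show ?thesis
    by (simp add: comp.residual_def comp.hist_def)
qed

lemma solves_primitive:
  assumes "q \<in> H10 T"
  shows "L2_primitive T (\<lambda>t. q t $ i) (\<lambda>t. wd q t $ i)" "q 0 $ i = 0"
  using assms comp.T_pos by (auto simp: H10_def intro: H1_component_primitive)

lemma solves_eps_component:
  assumes "solves T \<alpha> y0 (dissip_eps \<kappa> e) l q" "e > 0"
  shows "comp.reg_solution i e (\<lambda>t. l t $ i) (\<lambda>t. q t $ i) (\<lambda>t. wd q t $ i)"
proof -
  have q: "q \<in> H10 T" and ae: "AE t in lebesgue_on {0<..<T}.
      - (\<alpha> *\<^sub>R q t) + l t \<in> subdifferential (dissip_eps \<kappa> e (history y0 q t)) (wd q t)"
    using assms by (auto simp: solves_def)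
  have "AE t in lebesgue_on {0<..<T}. t \<in> {0<..<T}" by (rule AE_I2) simp
  with ae have "AE t in lebesgue_on {0<..<T}. e * wd q t $ i
      = max 0 (comp.residual i (\<lambda>t. l t $ i) (\<lambda>t. q t $ i) t)"
    by eventually_elim
      (simp only: solves_residual[OF q, symmetric] subdifferential_dissip_eps_pos[OF _ \<open>e > 0\<close>])
  then show ?thesis using solves_primitive[OF q] by (simp add: comp.reg_solution_def)
qed

lemma solves_component:
  assumes "solves T \<alpha> y0 (dissip \<kappa>) l q"
  shows "comp.lim_solution i (\<lambda>t. l t $ i) (\<lambda>t. q t $ i) (\<lambda>t. wd q t $ i)"
proof -
  have q: "q \<in> H10 T" and ae: "AE t in lebesgue_on {0<..<T}.
      - (\<alpha> *\<^sub>R q t) + l t \<in> subdifferential (dissip \<kappa> (history y0 q t)) (wd q t)"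
    using assms by (auto simp: solves_def)
  have "AE t in lebesgue_on {0<..<T}. t \<in> {0<..<T}" by (rule AE_I2) simp
  with ae have "AE t in lebesgue_on {0<..<T}. 0 \<le> wd q t $ i
      \<and> comp.residual i (\<lambda>t. l t $ i) (\<lambda>t. q t $ i) t \<le> 0
      \<and> wd q t $ i * comp.residual i (\<lambda>t. l t $ i) (\<lambda>t. q t $ i) t = 0"
    by eventually_elim
      (simp only: solves_residual[OF q, symmetric] subdifferential_dissip simp_thms)
  then show ?thesis using solves_primitive[OF q] by (simp add: comp.lim_solution_def)
qed

section \<open>Convergence of solutions for bounded, uniformly convergent loads\<close>

context
  fixes le qe :: "real \<Rightarrow> real \<Rightarrow> real ^ 'n" and l q :: "real \<Rightarrow> real ^ 'n" and K :: real
  assumes le: "\<And>e. e > 0 \<Longrightarrow> le e \<in> H10 T"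
    and qe: "\<And>e. e > 0 \<Longrightarrow> solves T \<alpha> y0 (dissip_eps \<kappa> e) (le e) (qe e)"
    and q: "solves T \<alpha> y0 (dissip \<kappa>) l q"
    and bound: "\<forall>\<^sub>F e in at_right 0. H1_norm T (le e) \<le> K"
    and unif: "\<And>i. uniform_limit {0..T} (\<lambda>e t. le e t $ i) (\<lambda>t. l t $ i) (at_right 0)"
begin

lemma eps_pos: "\<forall>\<^sub>F e in at_right (0::real). e > 0"
  by (rule eventually_at_right_less)

lemma K_nonneg: "0 \<le> K"
proof -
  obtain e :: real where "H1_norm T (le e) \<le> K"
    using eventually_happens[OF bound] by auto
  then show ?thesis using H1_norm_nonneg[of T "le e"] by linarith
qed

lemma qe_H10: "e > 0 \<Longrightarrow> qe e \<in> H10 T"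
  using qe by (simp add: solves_def)

lemma qe_H1: "e > 0 \<Longrightarrow> qe e \<in> H1 T"
  using qe_H10 by (simp add: H10_def)

lemma q_H10: "q \<in> H10 T" and q_H1: "q \<in> H1 T"
  using q by (simp_all add: solves_def H10_def)

lemma reg: "\<forall>\<^sub>F e in at_right 0. comp.reg_solution i e (\<lambda>t. le e t $ i) (\<lambda>t. qe e t $ i) (\<lambda>t. wd (qe e) t $ i)"
  using eps_pos by (rule eventually_mono) (intro solves_eps_component qe)

lemma load: "\<forall>\<^sub>F e in at_right 0. L2_primitive T (\<lambda>t. le e t $ i) (\<lambda>t. wd (le e) t $ i)
    \<and> le e 0 $ i = 0 \<and> L2_norm T (\<lambda>t. wd (le e) t $ i) \<le> K"
  using eventually_conj[OF eps_pos bound]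
proof (rule eventually_mono)
  fix e :: real assume e: "e > 0 \<and> H1_norm T (le e) \<le> K"
  then have "le e \<in> H10 T" using le by blast
  then show "L2_primitive T (\<lambda>t. le e t $ i) (\<lambda>t. wd (le e) t $ i)
    \<and> le e 0 $ i = 0 \<and> L2_norm T (\<lambda>t. wd (le e) t $ i) \<le> K"
    using e solves_primitive[of "le e" i] H1_component_norm_le(2)[of "le e" T i]
    by (auto simp: H10_def)
qed

lemma uniform_solution: "uniform_limit {0..T} (\<lambda>e t. qe e t $ i) (\<lambda>t. q t $ i) (at_right 0)"
  by (rule comp.reg_solution_uniform_limit[OF tendsto_ident_at eps_pos solves_component[OF q] unif reg load K_nonneg])

lemma rate_solution: "\<forall>\<^sub>F e in at_right 0. L2_norm T (\<lambda>t. wd (qe e) t $ i) \<le> comp.rate_bound K"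
  using eventually_conj[OF reg[of i] eventually_conj[OF load[of i] eps_pos]]
  by (rule eventually_mono) (blast intro: comp.reg_solution_rate)

lemma component_L2_tendsto: "((\<lambda>e. L2_norm T (\<lambda>t. qe e t $ i - q t $ i)) \<longlongrightarrow> 0) (at_right 0)"
proof (rule L2_norm_uniform_tendsto_0[OF uniform_solution])
  show "\<forall>\<^sub>F e in at_right 0. (\<lambda>t. qe e t $ i) \<in> L2 {0<..<T}"
    using eps_pos by (rule eventually_mono) (intro H1_component_L2 qe_H1)
  show "(\<lambda>t. q t $ i) \<in> L2 {0<..<T}" by (rule H1_component_L2[OF q_H1])
qed (rule comp.T_pos)

lemma bounded_solution: "\<exists>C. \<forall>\<^sub>F e in at_right 0. H1_norm T (qe e) \<le> C"
proof
  let ?P = "comp.rate_bound K"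
  \<comment> \<open>Eventually each component is within L2 distance 1 of its limit, and each rate
    obeys the uniform bound.\<close>
  let ?C = "sqrt (\<Sum>i\<in>(UNIV :: 'n set). (1 + L2_norm T (\<lambda>t. q t $ i))\<^sup>2 + ?P\<^sup>2)"
  have "\<forall>\<^sub>F e in at_right 0. \<forall>i. L2_norm T (\<lambda>t. qe e t $ i - q t $ i) < 1
      \<and> L2_norm T (\<lambda>t. wd (qe e) t $ i) \<le> ?P"
    by (intro eventually_all_finite eventually_conj rate_solution order_tendstoD(2)[OF component_L2_tendsto]) simp
  with eps_pos show "\<forall>\<^sub>F e in at_right 0. H1_norm T (qe e) \<le> ?C"
  proof (rule eventually_elim2)
    fix e :: real
    assume e: "e > 0" "\<forall>i. L2_norm T (\<lambda>t. qe e t $ i - q t $ i) < 1 \<and> L2_norm T (\<lambda>t. wd (qe e) t $ i) \<le> ?P"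
    have H: "qe e \<in> H1 T" "q \<in> H1 T" using qe_H1[OF e(1)] q_H1 by auto
    have "L2_norm T (\<lambda>t. qe e t $ i) \<le> 1 + L2_norm T (\<lambda>t. q t $ i)" for i
    proof -
      have "L2_norm T (\<lambda>t. (qe e t $ i - q t $ i) - (- 1 * q t $ i))
          \<le> L2_norm T (\<lambda>t. qe e t $ i - q t $ i) + L2_norm T (\<lambda>t. - 1 * q t $ i)"
        by (intro L2_norm_diff_triangle L2_diff L2_cmult H1_component_L2 H)
      moreover have "L2_norm T (\<lambda>t. - 1 * q t $ i) = L2_norm T (\<lambda>t. q t $ i)" by (simp add: L2_norm_def)
      moreover have "L2_norm T (\<lambda>t. (qe e t $ i - q t $ i) - (- 1 * q t $ i)) = L2_norm T (\<lambda>t. qe e t $ i)" by simp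
      ultimately show ?thesis using e(2)[rule_format, of i] by linarith
    qed
    then have "(H1_norm T (qe e))\<^sup>2 \<le> (\<Sum>i\<in>(UNIV :: 'n set). (1 + L2_norm T (\<lambda>t. q t $ i))\<^sup>2 + ?P\<^sup>2)"
      unfolding H1_norm_square[OF H(1)] using e(2) by (intro sum_mono add_mono power_mono) auto
    then show "H1_norm T (qe e) \<le> ?C" by (rule real_le_rsqrt)
  qed
qed

text \<open>The values converge strongly in L2 by uniform convergence, so only the pairing of the
  rates needs the norm bound and the weak argument.\<close>

lemma weak_limit_solution: "weak_conv (H10 T) (H1_norm T) qe q (at_right 0)"
proof -
  obtain C where C: "\<forall>\<^sub>F e in at_right 0. H1_norm T (qe e) \<le> C" using bounded_solution by blast
  show ?thesis
  proof (rule weak_conv_H1_innerI[OF _ H10_lincomb comp.T_pos _ q_H10 C])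
    show "H10 T \<subseteq> H1 T" by (auto simp: H10_def)
    show "\<forall>\<^sub>F e in at_right 0. qe e \<in> H10 T" using eps_pos by (rule eventually_mono) (rule qe_H10)
    fix w :: "real \<Rightarrow> real ^ 'n" assume w: "w \<in> H10 T"
    have wH: "w \<in> H1 T" using w by (simp add: H10_def)
    have qeL: "\<forall>\<^sub>F e in at_right 0. (\<lambda>t. qe e t $ i) \<in> L2 {0<..<T}"
      "\<forall>\<^sub>F e in at_right 0. (\<lambda>t. wd (qe e) t $ i) \<in> L2 {0<..<T}" for i
      by (rule eventually_mono[OF eps_pos], intro H1_component_L2 qe_H1, assumption)+
    have "((\<lambda>e. integral {0..T} (\<lambda>t. (wd (qe e) t $ i - wd q t $ i) * wd w t $ i)) \<longlongrightarrow> 0) (at_right 0)" for i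
    proof (rule L2_pairing_tendsto_0[OF H1_component_L2(2)[OF wH] comp.T_pos])
      show "\<forall>\<^sub>F e in at_right 0. L2_primitive T (\<lambda>t. qe e t $ i - q t $ i) (\<lambda>t. wd (qe e) t $ i - wd q t $ i)
          \<and> qe e 0 $ i - q 0 $ i = 0"
        using eps_pos
      proof (rule eventually_mono)
        fix e :: real assume "e > 0"
        from solves_primitive[OF qe_H10[OF this], of i] solves_primitive[OF q_H10, of i]
        show "L2_primitive T (\<lambda>t. qe e t $ i - q t $ i) (\<lambda>t. wd (qe e) t $ i - wd q t $ i)
          \<and> qe e 0 $ i - q 0 $ i = 0" by (simp add: L2_primitive_diff)
      qed
      show "\<forall>\<^sub>F e in at_right 0. L2_norm T (\<lambda>t. wd (qe e) t $ i - wd q t $ i)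
          \<le> comp.rate_bound K + L2_norm T (\<lambda>t. wd q t $ i)"
        using eventually_conj[OF eps_pos rate_solution[of i]]
      proof (rule eventually_mono)
        fix e :: real assume e: "e > 0 \<and> L2_norm T (\<lambda>t. wd (qe e) t $ i) \<le> comp.rate_bound K"
        then have H: "qe e \<in> H1 T" by (intro qe_H1) simp
        from L2_norm_diff_triangle[OF H1_component_L2(2)[OF H] H1_component_L2(2)[OF q_H1], of i i] e
        show "L2_norm T (\<lambda>t. wd (qe e) t $ i - wd q t $ i)
          \<le> comp.rate_bound K + L2_norm T (\<lambda>t. wd q t $ i)" by linarith
      qed
      show "uniform_limit {0..T} (\<lambda>e t. qe e t $ i - q t $ i) (\<lambda>_. 0) (at_right 0)"
        using uniform_solution[of i] unfolding uniform_limit_iff by (simp add: dist_real_def)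
    qed
    note weak = L2_pairing_tendsto[OF qeL(2) H1_component_L2(2)[OF q_H1] H1_component_L2(2)[OF wH] this]
    show "((\<lambda>e. H1_inner T (qe e) w) \<longlongrightarrow> H1_inner T q w) (at_right 0)"
      unfolding H1_inner_def
      by (intro tendsto_sum tendsto_add weak L2_pairing_tendsto_strong[OF qeL(1) _ _ component_L2_tendsto]
          H1_component_L2 q_H1 wH)
  qed
qed

lemma strong_limit_solution:
  assumes l: "l \<in> H1 T" and strong: "((\<lambda>e. H1_norm T (\<lambda>t. le e t - l t)) \<longlongrightarrow> 0) (at_right 0)"
  shows "strong_conv (H10 T) (H1_norm T) qe q (at_right 0)"
  unfolding strong_conv_def
proof (intro conjI q_H10)
  show "\<forall>\<^sub>F e in at_right 0. qe e \<in> H10 T" using eps_pos by (rule eventually_mono) (rule qe_H10)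
  \<comment> \<open>The chosen weak derivative of a difference agrees with the difference of the
    chosen ones almost everywhere, which is all the norms can see.\<close>
  have norm_diff: "(H1_norm T (\<lambda>t. u t - v t))\<^sup>2
      = (\<Sum>i\<in>UNIV. (L2_norm T (\<lambda>t. u t $ i - v t $ i))\<^sup>2 + (L2_norm T (\<lambda>t. wd u t $ i - wd v t $ i))\<^sup>2)"
    and diff_H1: "(\<lambda>t. u t - v t) \<in> H1 T"
    and wd_diff: "L2_norm T (\<lambda>t. wd (\<lambda>t. u t - v t) t $ i) = L2_norm T (\<lambda>t. wd u t $ i - wd v t $ i)"
    if "u \<in> H1 T" "v \<in> H1 T" for u v :: "real \<Rightarrow> real ^ 'n" and i
  proof -
    show H: "(\<lambda>t. u t - v t) \<in> H1 T" using H1_lincomb[OF that, of 1 "- 1"] by simp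
    have L: "L2_norm T (\<lambda>t. wd (\<lambda>t. u t - v t) t $ i) = L2_norm T (\<lambda>t. wd u t $ i - wd v t $ i)" for i
    proof -
      have "AE t in lebesgue_on {0<..<T}. (wd (\<lambda>t. u t - v t) t $ i)\<^sup>2 = (wd u t $ i - wd v t $ i)\<^sup>2"
        using H1_weak_deriv_lincomb[OF that comp.T_pos, of 1 "- 1" i]
        by (rule eventually_mono) simp
      from integral_AE_cong[OF this, of 0 T] show ?thesis by (simp add: L2_norm_def)
    qed
    then show "L2_norm T (\<lambda>t. wd (\<lambda>t. u t - v t) t $ i) = L2_norm T (\<lambda>t. wd u t $ i - wd v t $ i)" .
    show "(H1_norm T (\<lambda>t. u t - v t))\<^sup>2
      = (\<Sum>i\<in>UNIV. (L2_norm T (\<lambda>t. u t $ i - v t $ i))\<^sup>2 + (L2_norm T (\<lambda>t. wd u t $ i - wd v t $ i))\<^sup>2)"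
      unfolding H1_norm_square[OF H] L by simp
  qed
  have load_strong: "((\<lambda>e. L2_norm T (\<lambda>t. wd (le e) t $ i - wd l t $ i)) \<longlongrightarrow> 0) (at_right 0)" for i
  proof (rule Lim_null_comparison[OF _ strong])
    show "\<forall>\<^sub>F e in at_right 0. norm (L2_norm T (\<lambda>t. wd (le e) t $ i - wd l t $ i)) \<le> H1_norm T (\<lambda>t. le e t - l t)"
      using eps_pos
    proof (rule eventually_mono)
      fix e :: real assume "e > 0"
      then have H: "le e \<in> H1 T" using le by (auto simp: H10_def)
      show "norm (L2_norm T (\<lambda>t. wd (le e) t $ i - wd l t $ i)) \<le> H1_norm T (\<lambda>t. le e t - l t)"
        using H1_component_norm_le(2)[OF diff_H1[OF H l], of i] by (simp add: wd_diff[OF H l])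
    qed
  qed
  have rate: "((\<lambda>e. L2_norm T (\<lambda>t. wd (qe e) t $ i - wd q t $ i)) \<longlongrightarrow> 0) (at_right 0)" for i
    by (rule comp.reg_solution_strong_limit[OF eps_pos solves_component[OF q]
          H1_component_primitive[OF l comp.T_pos] reg load uniform_solution load_strong])
  have "((\<lambda>e. sqrt (\<Sum>i\<in>UNIV. (L2_norm T (\<lambda>t. qe e t $ i - q t $ i))\<^sup>2
      + (L2_norm T (\<lambda>t. wd (qe e) t $ i - wd q t $ i))\<^sup>2)) \<longlongrightarrow> sqrt (\<Sum>i\<in>(UNIV :: 'n set). 0\<^sup>2 + 0\<^sup>2)) (at_right 0)"
    by (intro tendsto_real_sqrt tendsto_sum tendsto_add tendsto_power component_L2_tendsto rate)
  moreover have "\<forall>\<^sub>F e in at_right 0. sqrt (\<Sum>i\<in>UNIV. (L2_norm T (\<lambda>t. qe e t $ i - q t $ i))\<^sup>2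
      + (L2_norm T (\<lambda>t. wd (qe e) t $ i - wd q t $ i))\<^sup>2) = H1_norm T (\<lambda>t. qe e t - q t)"
    using eps_pos
  proof (rule eventually_mono)
    fix e :: real assume "e > 0"
    then have H: "qe e \<in> H1 T" "q \<in> H1 T" using qe_H1 q_H1 by auto
    show "sqrt (\<Sum>i\<in>UNIV. (L2_norm T (\<lambda>t. qe e t $ i - q t $ i))\<^sup>2
      + (L2_norm T (\<lambda>t. wd (qe e) t $ i - wd q t $ i))\<^sup>2) = H1_norm T (\<lambda>t. qe e t - q t)"
      unfolding norm_diff[OF H, symmetric] by (simp add: H1_norm_nonneg)
  qed
  ultimately show "((\<lambda>e. H1_norm T (\<lambda>t. qe e t - q t)) \<longlongrightarrow> 0) (at_right 0)"
    by (simp add: tendsto_cong)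
qed

end

end

section \<open>Passage to the solution operators\<close>

theorem proposition2p8:
  fixes T \<alpha> :: real and y0 :: "real ^ 'n" and \<kappa> :: "real \<Rightarrow> real"
    and le :: "real \<Rightarrow> real \<Rightarrow> real ^ 'n" and l :: "real \<Rightarrow> real ^ 'n"
  assumes "T > 0" and "\<alpha> > 0"
    and "\<And>x. 0 \<le> \<kappa> x"
    and "\<exists>L. L-lipschitz_on UNIV \<kappa>"
    and "\<kappa> differentiable_on UNIV"
    and "deriv \<kappa> \<in> W12 UNIV"
    and solvable: "\<And>m :: real \<Rightarrow> real ^ 'n. m \<in> H10 T \<Longrightarrow> \<exists>!q. solves T \<alpha> y0 (dissip \<kappa>) m q"
    and solvable_eps: "\<And>\<epsilon> (m :: real \<Rightarrow> real ^ 'n). \<epsilon> > 0 \<Longrightarrow> m \<in> L2 {0<..<T} \<Longrightarrow>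
           \<exists>!q. solves T \<alpha> y0 (dissip_eps \<kappa> \<epsilon>) m q"
    and "\<And>\<epsilon>. \<epsilon> > 0 \<Longrightarrow> le \<epsilon> \<in> H10 T"
  shows "(weak_conv (H1 T) (H1_norm T) le l (at_right 0) \<longrightarrow>
            weak_conv (H10 T) (H1_norm T)
              (\<lambda>\<epsilon>. sol_op_eps T \<alpha> y0 \<kappa> \<epsilon> (le \<epsilon>)) (sol_op T \<alpha> y0 \<kappa> l) (at_right 0)) \<and>
         (strong_conv (H1 T) (H1_norm T) le l (at_right 0) \<longrightarrow>
            strong_conv (H10 T) (H1_norm T)
              (\<lambda>\<epsilon>. sol_op_eps T \<alpha> y0 \<kappa> \<epsilon> (le \<epsilon>)) (sol_op T \<alpha> y0 \<kappa> l) (at_right 0))"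
proof -
  have T: "T > 0" by fact
  have le: "le e \<in> H10 T" if "e > 0" for e using assms(9) that by blast
  have leH1: "le e \<in> H1 T" if "e > 0" for e using le[OF that] by (simp add: H10_def)
  have le0: "le e 0 $ i = 0" if "e > 0" for e i using le[OF that] by (simp add: H10_def)
  obtain L where L: "L-lipschitz_on UNIV \<kappa>" using assms(4) by blast
  have "history_problem T \<alpha> L \<kappa> (deriv \<kappa>)"
  proof
    show "\<bar>\<kappa> x - \<kappa> y\<bar> \<le> L * \<bar>x - y\<bar>" for x y
      using lipschitz_onD[OF L, of x y] by (simp add: dist_real_def)
    show "(\<kappa> has_real_derivative deriv \<kappa> x) (at x)" for x
      using assms(5) by (simp add: differentiable_on_def DERIV_deriv_iff_real_differentiable)
    show "continuous_on UNIV (deriv \<kappa>)" by (rule W12_deriv_continuous[OF assms(5,6)])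
  qed (use assms(1-3) in auto)
  then interpret vector_history_problem T \<alpha> L y0 \<kappa> by (rule vector_history_problem.intro)
  let ?qe = "\<lambda>e. sol_op_eps T \<alpha> y0 \<kappa> e (le e)" and ?q = "sol_op T \<alpha> y0 \<kappa> l"
  have qe: "solves T \<alpha> y0 (dissip_eps \<kappa> e) (le e) (?qe e)" if "e > 0" for e
    unfolding sol_op_eps_def by (rule theI'[OF solvable_eps[OF that H1_D(1)[OF leH1[OF that]]]])
  \<comment> \<open>Weak convergence is the common hypothesis, because strong convergence implies
    it; the strong statement thus inherits the bound and the uniform convergence of the
    loads.\<close>
  have convergence: "weak_conv (H10 T) (H1_norm T) ?qe ?q (at_right 0)
      \<and> (strong_conv (H1 T) (H1_norm T) le l (at_right 0) \<longrightarrow> strong_conv (H10 T) (H1_norm T) ?qe ?q (at_right 0))"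
    if w: "weak_conv (H1 T) (H1_norm T) le l (at_right 0)"
  proof -
    obtain K where K: "\<forall>\<^sub>F e in at_right 0. H1_norm T (le e) \<le> K"
      using weak_conv_H1_bounded[OF w T] by blast
    have l: "l \<in> H1 T" using w by (simp add: weak_conv_def)
    have conv: "((\<lambda>e. le e t $ i) \<longlongrightarrow> l t $ i) (at_right 0)" if "t \<in> {0..T}" for t i
      using w H1_evaluation_dual[OF T that, of i] by (auto simp: weak_conv_def)
    \<comment> \<open>The limit load is known to lie in \<open>H1\<close> only. Evaluation at 0
      passes to the limit, so \<open>l\<close> belongs to \<open>H10\<close> and the unique
      solvability of the limit problem applies to it.\<close>
    have "l 0 $ i = 0" for i
    proof (rule tendsto_unique[OF trivial_limit_at_right_real conv])
      have "\<forall>\<^sub>F e in at_right 0. le e 0 $ i = 0"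
        using eventually_at_right_less by (rule eventually_mono) (rule le0)
      then show "((\<lambda>e. le e 0 $ i) \<longlongrightarrow> 0) (at_right 0)" by (rule tendsto_eventually)
    qed (use T in simp)
    then have "l \<in> H10 T" using l by (simp add: H10_def vec_eq_iff)
    then have q: "solves T \<alpha> y0 (dissip \<kappa>) l ?q" unfolding sol_op_def by (rule theI'[OF solvable])
    have Hoelder: "\<bar>u t $ i - u s $ i\<bar> \<le> H1_norm T u * sqrt \<bar>t - s\<bar>"
      if u: "u \<in> H1 T" and st: "s \<in> {0..T}" "t \<in> {0..T}" for u :: "real \<Rightarrow> real ^ 'n" and i s t
    proof -
      have "sqrt \<bar>t - s\<bar> * L2_norm T (\<lambda>t. wd u t $ i) \<le> sqrt \<bar>t - s\<bar> * H1_norm T u"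
        by (intro mult_left_mono H1_component_norm_le u) auto
      then show ?thesis
        using L2_primitive_Hoelder[OF H1_component_primitive[OF u T, of i] st] by (simp add: mult.commute)
    qed
    have unif: "uniform_limit {0..T} (\<lambda>e t. le e t $ i) (\<lambda>t. l t $ i) (at_right 0)" for i
    proof (rule equicontinuous_uniform_limit[OF T conv])
      show "\<forall>\<^sub>F e in at_right 0. \<forall>s\<in>{0..T}. \<forall>t\<in>{0..T}. \<bar>le e t $ i - le e s $ i\<bar> \<le> K * sqrt \<bar>t - s\<bar>"
        using eventually_at_right_less K
      proof (rule eventually_elim2, intro ballI)
        fix e s t :: real
        assume *: "0 < e" "H1_norm T (le e) \<le> K" "s \<in> {0..T}" "t \<in> {0..T}"
        have "H1_norm T (le e) * sqrt \<bar>t - s\<bar> \<le> K * sqrt \<bar>t - s\<bar>"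
          using *(2) by (intro mult_right_mono) auto
        then show "\<bar>le e t $ i - le e s $ i\<bar> \<le> K * sqrt \<bar>t - s\<bar>"
          using Hoelder[OF leH1[OF *(1)] *(3,4), of i] by linarith
      qed
    qed (assumption, rule Hoelder[OF l])
    show ?thesis
      using weak_limit_solution[OF le qe q K unif] strong_limit_solution[OF le qe q K unif l]
      by (auto simp: strong_conv_def)
  qed
  then show ?thesis using strong_conv_imp_weak_conv_H1 by blast
qed

end
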